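(* Let $n\ge 1$ be an integer, let $\beta\in\mathbb{R}$, and let $\varphi$ be a pointwise multiplier of the Hardy-Sobolev space $H^2_\beta$ on the open unit ball $\mathbb{B}_n$. Then the spectrum of the bounded multiplication operator $M_\varphi: H^2_\beta\to H^2_\beta$, $M_\varphi f=\varphi f$, is the closure of the range of $\varphi$ in the complex plane: $\sigma(M_\varphi)=\overline{\varphi(\mathbb{B}_n)}$.
   Context: $\mathbb{B}_n$ is the open unit ball in $\mathbb{C}^n$, $H(\mathbb{B}_n)$ is the space of holomorphic functions on $\mathbb{B}_n$, and $\mathbb{S}_n=\partial\mathbb{B}_n$ carries the normalized Lebesgue measure $d\sigma$. The Hardy space $H^2$ consists of $f\in H(\mathbb{B}_n)$ with $\|f\|_{H^2}^2=\sup_{0<r<1}\int_{\mathbb{S}_n}|f(r\zeta)|^2\,d\sigma(\zeta)<\infty$. For $f\in H(\mathbb{B}_n)$ with homogeneous expansion $f=\sum_{k=0}^\infty f_k$ and $\beta\in\mathbb{R}$, set $R^\beta f=\sum_{k=1}^\infty k^\beta f_k$. The Hardy-Sobolev space $H^2_\beta$ consists of all $f\in H(\mathbb{B}_n)$ with $R^\beta f\in H^2$; it is a Hilbert space with inner product $\langle f,g\rangle_\beta=f(0)\overline{g(0)}+\langle R^\beta f,R^\beta g\rangle_{H^2}$. A pointwise multiplier of $H^2_\beta$ is a function $\varphi\in H(\mathbb{B}_n)$ such that $\varphi f\in H^2_\beta$ for every $f\in H^2_\beta$; by the closed graph theorem $M_\varphi$ is then bounded on $H^2_\beta$. *)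

theory Defs
  imports "HOL-Analysis.Analysis"
begin

text \<open>
  \<open>\<complex>\<^sup>n\<close> is rendered as \<open>complex ^ 'n\<close> with its Euclidean norm, so the unit ball is
  \<open>ball 0 1\<close> and \<open>n = CARD('n) \<ge> 1\<close>.
\<close>

text \<open>Complex (Frechet) differentiability in several variables.\<close>

definition holomorphic_n_on :: "(complex ^ 'n::finite \<Rightarrow> complex) \<Rightarrow> (complex ^ 'n) set \<Rightarrow> bool"
  where "holomorphic_n_on f U \<longleftrightarrow>
    (\<forall>z\<in>U. \<exists>a :: complex ^ 'n. (f has_derivative (\<lambda>h. \<Sum>i\<in>UNIV. a $ i * h $ i)) (at z within U))"

definition homogeneous_poly :: "nat \<Rightarrow> (complex ^ 'n::finite \<Rightarrow> complex) \<Rightarrow> bool"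
  where "homogeneous_poly k p \<longleftrightarrow>
    (\<exists>a :: ('n \<Rightarrow> nat) \<Rightarrow> complex.
      p = (\<lambda>z. \<Sum>m | (\<Sum>i\<in>UNIV. m i) = k. a m * (\<Prod>i\<in>UNIV. z $ i ^ m i)))"

definition homogeneous_expansion ::
    "(complex ^ 'n::finite \<Rightarrow> complex) \<Rightarrow> (nat \<Rightarrow> complex ^ 'n \<Rightarrow> complex) \<Rightarrow> bool"
  where "homogeneous_expansion f F \<longleftrightarrow>
    (\<forall>k. homogeneous_poly k (F k)) \<and> (\<forall>z\<in>ball 0 1. (\<lambda>k. F k z) sums f z)"

text \<open>
  A function that is holomorphic on the ball has exactly one homogeneous expansion: on each
  complex line through the origin it is the Taylor series of a function of one variable.
\<close>

definition homogeneous_part ::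
    "(complex ^ 'n::finite \<Rightarrow> complex) \<Rightarrow> nat \<Rightarrow> complex ^ 'n \<Rightarrow> complex"
  where "homogeneous_part f = (THE F. homogeneous_expansion f F)"

text \<open>
  The sum runs over \<open>k \<ge> 1\<close>, with the index shifted by one. For holomorphic \<open>f\<close> it converges on
  the ball, because \<open>k\<^sup>\<beta>\<close> grows at most polynomially.
\<close>

definition radial_power ::
    "real \<Rightarrow> (complex ^ 'n::finite \<Rightarrow> complex) \<Rightarrow> complex ^ 'n \<Rightarrow> complex"
  where "radial_power \<beta> f = (\<lambda>z. if z \<in> ball 0 1
    then \<Sum>k. complex_of_real (real (Suc k) powr \<beta>) * homogeneous_part f (Suc k) z else 0)"

text \<open>
  Normalized surface measure: by polar coordinates, the measure of \<open>A\<close> is the proportion of the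
  volume of the unit ball taken up by the cone \<open>{r \<zeta> | 0 < r < 1, \<zeta> \<in> A}\<close>. The restriction
  to the sphere only removes the null point \<open>sgn 0 = 0\<close>.
\<close>

definition sphere_measure :: "(complex ^ 'n::finite) measure"
  where "sphere_measure =
    restrict_space (distr (uniform_measure lborel (ball 0 1)) borel sgn) (sphere 0 1)"

definition hardy_norm_sq :: "(complex ^ 'n::finite \<Rightarrow> complex) \<Rightarrow> ennreal"
  where "hardy_norm_sq f =
    (SUP r\<in>{0<..<1::real}. \<integral>\<^sup>+\<zeta>. ennreal ((cmod (f (r *\<^sub>R \<zeta>)))\<^sup>2) \<partial>sphere_measure)"

text \<open>
  Elements of a function space on the ball are represented by total functions that vanish off
  the ball, so that equality of functions on the ball is equality in HOL.
\<close>

definition hardy_space :: "(complex ^ 'n::finite \<Rightarrow> complex) set"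
  where "hardy_space =
    {f. holomorphic_n_on f (ball 0 1) \<and> (\<forall>z. z \<notin> ball 0 1 \<longrightarrow> f z = 0) \<and> hardy_norm_sq f < \<infinity>}"

definition hardy_sobolev :: "real \<Rightarrow> (complex ^ 'n::finite \<Rightarrow> complex) set"
  where "hardy_sobolev \<beta> =
    {f. holomorphic_n_on f (ball 0 1) \<and> (\<forall>z. z \<notin> ball 0 1 \<longrightarrow> f z = 0)
        \<and> radial_power \<beta> f \<in> hardy_space}"

text \<open>
  The norm induced by the inner product
  \<open>f(0) cnj (g(0)) + \<langle>R\<^sup>\<beta> f, R\<^sup>\<beta> g\<rangle>\<close> of the Hardy-Sobolev space.
\<close>

definition hardy_sobolev_norm :: "real \<Rightarrow> (complex ^ 'n::finite \<Rightarrow> complex) \<Rightarrow> real"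
  where "hardy_sobolev_norm \<beta> f =
    sqrt ((cmod (f 0))\<^sup>2 + enn2real (hardy_norm_sq (radial_power \<beta> f)))"

text \<open>
  The multiplier itself need not vanish off the ball; its values there are irrelevant.
\<close>

definition mult_op ::
    "(complex ^ 'n::finite \<Rightarrow> complex) \<Rightarrow> (complex ^ 'n \<Rightarrow> complex) \<Rightarrow> complex ^ 'n \<Rightarrow> complex"
  where "mult_op \<phi> f = (\<lambda>z. \<phi> z * f z)"

definition pointwise_multiplier :: "real \<Rightarrow> (complex ^ 'n::finite \<Rightarrow> complex) \<Rightarrow> bool"
  where "pointwise_multiplier \<beta> \<phi> \<longleftrightarrow>
    holomorphic_n_on \<phi> (ball 0 1) \<and> (\<forall>f\<in>hardy_sobolev \<beta>. mult_op \<phi> f \<in> hardy_sobolev \<beta>)"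

text \<open>
  Operators on a linear space \<open>H\<close> of complex-valued functions with norm \<open>N\<close>. The spectrum is the
  set of all \<open>c\<close> for which \<open>T - c I\<close> has no bounded two-sided inverse on \<open>H\<close>.
\<close>

definition bounded_operator_on ::
    "('a \<Rightarrow> complex) set \<Rightarrow> (('a \<Rightarrow> complex) \<Rightarrow> real)
      \<Rightarrow> (('a \<Rightarrow> complex) \<Rightarrow> 'a \<Rightarrow> complex) \<Rightarrow> bool"
  where "bounded_operator_on H N T \<longleftrightarrow>
    (\<forall>f\<in>H. T f \<in> H) \<and>
    (\<forall>f\<in>H. \<forall>g\<in>H. T (\<lambda>x. f x + g x) = (\<lambda>x. T f x + T g x)) \<and>
    (\<forall>c. \<forall>f\<in>H. T (\<lambda>x. c * f x) = (\<lambda>x. c * T f x)) \<and>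
    (\<exists>C. \<forall>f\<in>H. N (T f) \<le> C * N f)"

definition spectrum_on ::
    "('a \<Rightarrow> complex) set \<Rightarrow> (('a \<Rightarrow> complex) \<Rightarrow> real)
      \<Rightarrow> (('a \<Rightarrow> complex) \<Rightarrow> 'a \<Rightarrow> complex) \<Rightarrow> complex set"
  where "spectrum_on H N T =
    {c. \<not> (\<exists>S. bounded_operator_on H N S \<and>
          (\<forall>f\<in>H. S (\<lambda>x. T f x - c * f x) = f) \<and>
          (\<forall>f\<in>H. (\<lambda>x. T (S f) x - c * S f x) = f))}"

end

theory Submission
  imports Defs "HOL-Complex_Analysis.Complex_Analysis"
begin

text \<open>
  Expanding in homogeneous parts, the square of the Hardy-Sobolev norm is
  \<open>\<Sum>\<^sub>k max(1, k)\<^sup>2\<^sup>\<beta> \<parallel>f\<^sub>k\<parallel>\<^sup>2\<close>, with the \<open>L\<^sup>2\<close> norm on the sphere. Multiplication is lower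
  triangular for this grading, so a multiplier of order \<open>\<beta>\<close> is bounded on every truncation and, by
  Abel summation, on every order \<open>\<alpha> \<le> \<beta>\<close> with the same bound; in particular bounded holomorphic
  functions act on all orders \<open>\<alpha> \<le> 0\<close>. If \<open>|\<phi> - c|\<close> is bounded below, \<open>\<psi> = 1 / (\<phi> - c)\<close> acts on
  order \<open>\<beta> - m \<le> 0\<close>, and the Leibniz rule for the radial derivative lifts this in \<open>m\<close> unit steps to
  order \<open>\<beta>\<close>. Conversely, if \<open>M\<^sub>\<phi> - c\<close> has an inverse of norm at most \<open>C\<close>, the powers of that inverse
  applied to \<open>1\<close> are \<open>(\<phi> - c)\<^sup>-\<^sup>n\<close>, and boundedness of point evaluations gives \<open>|\<phi> - c| \<ge> 1 / C\<close>.
\<close>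

subsection \<open>Holomorphic functions of several variables\<close>

text \<open>The obstacle is \<beta> > 0. There a bounded holomorphic function need not be a
  multiplier, so a bound on 1 / (\<phi> - c) alone says nothing at order \<beta>, and fractional
  orders obey no Leibniz rule. Hence the descent to an order \<beta> - m \<le> 0, where boundedness
  suffices, and the return in steps of exactly one order, each of which uses that \<phi> - c acts
  boundedly at the intermediate order as well. A second obstacle is that a multiplier is given only
  as mapping the space into itself, whereas these estimates need an operator bound; the closed graph
  theorem is therefore proved for this graded situation. Two definitions cost work of their own:
  homogeneous parts are a definite description over polynomials, so the Taylor coefficients on
  complex lines must be shown to be polynomials, and the surface measure is given by cones in the
  ball, so its rotation invariance has to be drawn from Lebesgue measure.\<close>

lemma norm_vector_smult: "norm (t *s z) = cmod t * norm (z :: complex ^ 'n::finite)"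
proof -
  have "norm (t *s z) = L2_set (\<lambda>i. cmod t * cmod (z $ i)) UNIV"
    by (simp add: norm_vec_def norm_mult)
  then show ?thesis
    by (simp add: norm_vec_def L2_set_right_distrib)
qed

lemma bounded_linear_smult_left: "bounded_linear (\<lambda>t. t *s (w :: complex ^ 'n::finite))"
proof -
  have "linear (\<lambda>t. t *s w)"
    by (rule linearI) (simp_all add: vec_eq_iff distrib_right)
  then show ?thesis by (simp add: linear_conv_bounded_linear)
qed

lemma continuous_on_smult [continuous_intros]:
  fixes g :: "'a::topological_space \<Rightarrow> complex ^ 'n::finite"
  assumes "continuous_on S f" "continuous_on S g"
  shows "continuous_on S (\<lambda>x. f x *s g x)"
  unfolding vector_scalar_mult_def
  by (intro continuous_on_vec_lambda continuous_intros assms)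

lemma holomorphic_n_onD:
  assumes "holomorphic_n_on f U" "open U" "z \<in> U"
  obtains a where "(f has_derivative (\<lambda>h. \<Sum>i\<in>UNIV. a $ i * h $ i)) (at z)"
  using assms at_within_open[OF assms(3,2)] unfolding holomorphic_n_on_def by auto

lemma holomorphic_n_onI:
  assumes "\<And>z. z \<in> U \<Longrightarrow> \<exists>a. (f has_derivative (\<lambda>h. \<Sum>i\<in>UNIV. a i * h $ i)) (at z)"
  shows "holomorphic_n_on f U"
  unfolding holomorphic_n_on_def
proof
  fix z assume "z \<in> U"
  then obtain a where a: "(f has_derivative (\<lambda>h. \<Sum>i\<in>UNIV. a i * h $ i)) (at z)"
    using assms by blast
  show "\<exists>a. (f has_derivative (\<lambda>h. \<Sum>i\<in>UNIV. a $ i * h $ i)) (at z within U)"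
    using has_derivative_at_withinI[OF a] by (intro exI[of _ "\<chi> i. a i"]) simp
qed

lemma holomorphic_n_on_cong:
  assumes "holomorphic_n_on f U" "\<And>z. z \<in> U \<Longrightarrow> f z = g z"
  shows "holomorphic_n_on g U"
  unfolding holomorphic_n_on_def
proof
  fix z assume z: "z \<in> U"
  with assms(1) obtain a where "(f has_derivative (\<lambda>h. \<Sum>i\<in>UNIV. a $ i * h $ i)) (at z within U)"
    unfolding holomorphic_n_on_def by blast
  then have "(g has_derivative (\<lambda>h. \<Sum>i\<in>UNIV. a $ i * h $ i)) (at z within U)"
    by (rule has_derivative_transform[OF z, rotated]) (simp add: assms(2))
  then show "\<exists>a. (g has_derivative (\<lambda>h. \<Sum>i\<in>UNIV. a $ i * h $ i)) (at z within U)"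
    by blast
qed

lemma holomorphic_n_on_imp_continuous_on:
  "holomorphic_n_on f U \<Longrightarrow> continuous_on U f"
  unfolding holomorphic_n_on_def continuous_on_eq_continuous_within
  using has_derivative_continuous by blast

lemma holomorphic_n_on_const: "holomorphic_n_on (\<lambda>z. c) U"
  by (rule holomorphic_n_onI) (auto intro!: exI[of _ "\<lambda>_. 0"])

lemma holomorphic_n_on_add:
  assumes "holomorphic_n_on f U" "holomorphic_n_on g U"
  shows "holomorphic_n_on (\<lambda>z. f z + g z) U"
  unfolding holomorphic_n_on_def
proof
  fix z assume "z \<in> U"
  with assms obtain a b where
    "(f has_derivative (\<lambda>h. \<Sum>i\<in>UNIV. a $ i * h $ i)) (at z within U)"
    "(g has_derivative (\<lambda>h. \<Sum>i\<in>UNIV. b $ i * h $ i)) (at z within U)"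
    unfolding holomorphic_n_on_def by blast
  from has_derivative_add[OF this]
  show "\<exists>a. ((\<lambda>z. f z + g z) has_derivative (\<lambda>h. \<Sum>i\<in>UNIV. a $ i * h $ i)) (at z within U)"
    by (intro exI[of _ "a + b"]) (simp add: distrib_right sum.distrib)
qed

lemma holomorphic_n_on_mult:
  assumes "holomorphic_n_on f U" "holomorphic_n_on g U"
  shows "holomorphic_n_on (\<lambda>z. f z * g z) U"
  unfolding holomorphic_n_on_def
proof
  fix z assume "z \<in> U"
  with assms obtain a b where
    "(f has_derivative (\<lambda>h. \<Sum>i\<in>UNIV. a $ i * h $ i)) (at z within U)"
    "(g has_derivative (\<lambda>h. \<Sum>i\<in>UNIV. b $ i * h $ i)) (at z within U)"
    unfolding holomorphic_n_on_def by blast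
  from has_derivative_mult[OF this]
  show "\<exists>a. ((\<lambda>z. f z * g z) has_derivative (\<lambda>h. \<Sum>i\<in>UNIV. a $ i * h $ i)) (at z within U)"
    by (intro exI[of _ "f z *s b + g z *s a"])
      (simp add: algebra_simps sum.distrib sum_distrib_left)
qed

lemma holomorphic_n_on_inverse:
  assumes "holomorphic_n_on f U" "\<And>z. z \<in> U \<Longrightarrow> f z \<noteq> 0"
  shows "holomorphic_n_on (\<lambda>z. inverse (f z)) U"
  unfolding holomorphic_n_on_def
proof
  fix z assume z: "z \<in> U"
  with assms obtain a where
    "(f has_derivative (\<lambda>h. \<Sum>i\<in>UNIV. a $ i * h $ i)) (at z within U)"
    unfolding holomorphic_n_on_def by blast
  from Deriv.has_derivative_inverse[OF assms(2)[OF z] this]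
  show "\<exists>a. ((\<lambda>z. inverse (f z)) has_derivative (\<lambda>h. \<Sum>i\<in>UNIV. a $ i * h $ i)) (at z within U)"
    by (intro exI[of _ "(- (inverse (f z))\<^sup>2) *s a"])
      (simp add: algebra_simps sum_distrib_left power2_eq_square sum_negf)
qed

lemma holomorphic_n_on_cmult:
  "holomorphic_n_on f U \<Longrightarrow> holomorphic_n_on (\<lambda>z. c * f z) U"
  by (rule holomorphic_n_on_mult[OF holomorphic_n_on_const])

lemma holomorphic_n_on_diff:
  assumes "holomorphic_n_on f U" "holomorphic_n_on g U"
  shows "holomorphic_n_on (\<lambda>z. f z - g z) U"
  using holomorphic_n_on_add[OF assms(1) holomorphic_n_on_cmult[OF assms(2), of "-1"]] by simp

lemma holomorphic_n_on_sum:
  assumes "\<And>i. i \<in> I \<Longrightarrow> holomorphic_n_on (f i) U"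
  shows "holomorphic_n_on (\<lambda>z. \<Sum>i\<in>I. f i z) U"
  using assms
  by (induction I rule: infinite_finite_induct)
    (auto intro: holomorphic_n_on_add holomorphic_n_on_const)

lemma slice_has_field_derivative:
  fixes z w :: "complex ^ 'n::finite"
  assumes "(f has_derivative (\<lambda>h. \<Sum>i\<in>UNIV. a $ i * h $ i)) (at (z + t *s w))"
  shows "((\<lambda>t. f (z + t *s w)) has_field_derivative (\<Sum>i\<in>UNIV. a $ i * w $ i)) (at t)"
proof -
  have "((\<lambda>t. z + t *s w) has_derivative (\<lambda>s. s *s w)) (at t)"
    using has_derivative_add[OF has_derivative_const[of z]
        bounded_linear_imp_has_derivative[OF bounded_linear_smult_left[of w]]] by simp
  from has_derivative_compose[OF this assms]
  have "((\<lambda>t. f (z + t *s w)) has_derivative (\<lambda>s. \<Sum>i\<in>UNIV. a $ i * (s *s w) $ i)) (at t)" .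
  moreover have "(\<lambda>s. \<Sum>i\<in>UNIV. a $ i * (s *s w) $ i) = (*) (\<Sum>i\<in>UNIV. a $ i * w $ i)"
    by (simp add: fun_eq_iff sum_distrib_left sum_distrib_right ac_simps)
  ultimately show ?thesis
    by (simp add: has_field_derivative_def)
qed

lemma holomorphic_n_on_imp_slice:
  assumes "holomorphic_n_on f U" "open U" "\<And>t. t \<in> T \<Longrightarrow> z + t *s w \<in> U"
  shows "(\<lambda>t. f (z + t *s w)) holomorphic_on T"
  unfolding holomorphic_on_def field_differentiable_def
proof
  fix t assume "t \<in> T"
  then obtain a where "(f has_derivative (\<lambda>h. \<Sum>i\<in>UNIV. a $ i * h $ i)) (at (z + t *s w))"
    using holomorphic_n_onD[OF assms(1,2) assms(3)] by blast
  from has_field_derivative_at_within[OF slice_has_field_derivative[OF this]]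
  show "\<exists>f'. ((\<lambda>t. f (z + t *s w)) has_field_derivative f') (at t within T)" by blast
qed

text \<open>Cauchy's inequality on complex lines makes the partial derivatives converge uniformly.\<close>

lemma holomorphic_n_on_uniform_limit:
  fixes g :: "nat \<Rightarrow> complex ^ 'n::finite \<Rightarrow> complex"
  assumes U: "open U" and hol: "\<And>n. holomorphic_n_on (g n) U"
    and lim: "\<And>z. z \<in> U \<Longrightarrow> \<exists>d>0. ball z d \<subseteq> U \<and> uniform_limit (ball z d) g l sequentially"
  shows "holomorphic_n_on l U"
proof (rule holomorphic_n_onI)
  fix z assume "z \<in> U"
  then obtain d where d: "d > 0" "ball z d \<subseteq> U" "uniform_limit (ball z d) g l sequentially"
    using lim by blast
  \<comment> \<open>Half the radius: from a centre in \<open>S\<close>, discs of radius d/4 in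
    coordinate directions stay inside \<open>ball z d\<close>, where the convergence is
    uniform.\<close>
  define S where "S = ball z (d/2)"
  have "\<exists>a. \<forall>n. \<forall>x\<in>U. (g n has_derivative (\<lambda>h. \<Sum>i\<in>UNIV. a n x $ i * h $ i)) (at x)"
  proof -
    have "\<forall>n. \<forall>x\<in>U. \<exists>a. (g n has_derivative (\<lambda>h. \<Sum>i\<in>UNIV. a $ i * h $ i)) (at x)"
      using holomorphic_n_onD[OF hol U] by blast
    then have "\<forall>n. \<exists>a. \<forall>x\<in>U. (g n has_derivative (\<lambda>h. \<Sum>i\<in>UNIV. a x $ i * h $ i)) (at x)"
      by (intro allI bchoice) auto
    then show ?thesis by (rule choice)
  qed
  then obtain a where
    a: "\<And>n x. x \<in> U \<Longrightarrow> (g n has_derivative (\<lambda>h. \<Sum>i\<in>UNIV. a n x $ i * h $ i)) (at x)"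
    by blast
  have SU: "x + t *s axis i 1 \<in> ball z d" if "x \<in> S" "cmod t \<le> d/4" for x t i
  proof -
    have "dist z (x + t *s axis i 1) \<le> dist z x + dist x (x + t *s axis i 1)"
      by (rule dist_triangle)
    also have "dist x (x + t *s axis i 1) = cmod t"
      by (simp add: dist_norm norm_vector_smult norm_axis_1)
    finally show ?thesis using that d(1) by (auto simp: S_def)
  qed
  \<comment> \<open>The hypothesis carries the factor d/4, the radius of the disc, so that Cauchy's
    inequality for the first derivative returns exactly \<open>e\<close>.\<close>
  have cauchy: "cmod (a m x $ i - a n x $ i) \<le> e"
    if x: "x \<in> S" and e: "\<And>y. y \<in> ball z d \<Longrightarrow> cmod (g m y - g n y) \<le> e * (d/4)" for m n x i e
  proof -
    define h where "h = (\<lambda>t. g m (x + t *s axis i 1) - g n (x + t *s axis i 1))"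
    have inU: "x + t *s axis i 1 \<in> U" if "cmod t \<le> d/4" for t
      using SU[OF x that] d(2) by blast
    have holh: "h holomorphic_on cball 0 (d/4)"
      unfolding h_def
      by (intro holomorphic_on_diff holomorphic_n_on_imp_slice[OF hol U]) (auto intro: inU)
    have "x \<in> U" using inU[of 0] d(1) by simp
    then have der: "((\<lambda>t. g k (x + t *s axis i 1)) has_field_derivative
        (\<Sum>j\<in>UNIV. a k x $ j * axis i 1 $ j)) (at 0)" for k
      using slice_has_field_derivative[where f = "g k" and z = x and t = 0 and w = "axis i 1"
          and a = "a k x"] a[of x k] by simp
    have "(h has_field_derivative (\<Sum>j\<in>UNIV. a m x $ j * axis i 1 $ j) -
        (\<Sum>j\<in>UNIV. a n x $ j * axis i 1 $ j)) (at 0)"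
      unfolding h_def
      by (rule DERIV_diff[OF der der])
    moreover have "(\<Sum>j\<in>UNIV. a k x $ j * axis i 1 $ j) = a k x $ i" for k
    proof -
      have "(\<Sum>j\<in>UNIV. a k x $ j * axis i 1 $ j) = (\<Sum>j\<in>UNIV. if j = i then a k x $ j else 0)"
        by (intro sum.cong) (auto simp: axis_def)
      then show ?thesis by simp
    qed
    ultimately have "(h has_field_derivative (a m x $ i - a n x $ i)) (at 0)"
      by simp
    then have "deriv h 0 = a m x $ i - a n x $ i"
      by (rule DERIV_imp_deriv)
    moreover have "norm ((deriv ^^ 1) h 0) \<le> fact 1 * (e * (d/4)) / (d/4) ^ 1"
    proof (rule Cauchy_inequality)
      show "h holomorphic_on ball 0 (d/4)"
        using holh by (rule holomorphic_on_subset) auto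
      show "continuous_on (cball 0 (d/4)) h"
        using holh by (rule holomorphic_on_imp_continuous_on)
      show "norm (h t) \<le> e * (d/4)" if "cmod (0 - t) = d/4" for t
        unfolding h_def using that by (intro e SU x) auto
    qed (use d in auto)
    ultimately show ?thesis using d(1) by simp
  qed
  have "uniformly_Cauchy_on S (\<lambda>n x. a n x $ i)" for i
    unfolding uniformly_Cauchy_on_def
  proof (intro allI impI)
    fix e :: real assume e: "e > 0"
    have "uniformly_Cauchy_on (ball z d) g"
      using d(3) by (meson uniformly_convergent_Cauchy uniformly_convergent_on_def)
    moreover have "e/2 * (d/4) > 0" using e d(1) by simp
    ultimately obtain M where M: "\<And>x m n. x \<in> ball z d \<Longrightarrow> m \<ge> M \<Longrightarrow> n \<ge> M \<Longrightarrow>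
        dist (g m x) (g n x) < e/2 * (d/4)"
      unfolding uniformly_Cauchy_on_def by meson
    have "dist (a m x $ i) (a n x $ i) < e" if "x \<in> S" "m \<ge> M" "n \<ge> M" for x m n
    proof -
      have "cmod (a m x $ i - a n x $ i) \<le> e/2"
        using M that by (intro cauchy) (auto simp: dist_norm less_imp_le)
      then show ?thesis using e by (simp add: dist_norm)
    qed
    then show "\<exists>M. \<forall>x\<in>S. \<forall>m\<ge>M. \<forall>n\<ge>M. dist (a m x $ i) (a n x $ i) < e" by blast
  qed
  then have "\<forall>i. \<exists>b. uniform_limit S (\<lambda>n x. a n x $ i) b sequentially"
    using Cauchy_uniformly_convergent unfolding uniformly_convergent_on_def by blast
  then have "\<exists>b. \<forall>i. uniform_limit S (\<lambda>n x. a n x $ i) (b i) sequentially"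
    by (rule choice)
  then obtain b where b: "\<And>i. uniform_limit S (\<lambda>n x. a n x $ i) (b i) sequentially"
    by blast
  have "\<exists>L. \<forall>x\<in>S. (\<lambda>n. g n x) \<longlonglongrightarrow> L x \<and>
      (L has_derivative (\<lambda>h. \<Sum>i\<in>UNIV. b i x * h $ i)) (at x within S)"
  proof (rule has_derivative_sequence[where f = g and f' = "\<lambda>n x h. \<Sum>i\<in>UNIV. a n x $ i * h $ i"
        and g' = "\<lambda>x h. \<Sum>i\<in>UNIV. b i x * h $ i" and ?x0.0 = z])
    show "convex S" "z \<in> S" using d(1) by (auto simp: S_def)
    show "(g n has_derivative (\<lambda>h. \<Sum>i\<in>UNIV. a n x $ i * h $ i)) (at x within S)"
      if "x \<in> S" for n x
    proof -
      have "x \<in> U" using SU[OF that, of 0] d by auto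
      then show ?thesis using has_derivative_at_withinI[OF a] by blast
    qed
    show "(\<lambda>n. g n z) \<longlonglongrightarrow> l z"
      using d by (auto intro: tendsto_uniform_limitI)
    fix e :: real assume e: "e > 0"
    let ?c = "real CARD('n)"
    have "\<forall>\<^sub>F n in sequentially. \<forall>x\<in>S. dist (a n x $ i) (b i x) < e / ?c" for i
      using b[of i] e by (auto simp: uniform_limit_iff)
    then have "\<forall>\<^sub>F n in sequentially. \<forall>i. \<forall>x\<in>S. dist (a n x $ i) (b i x) < e / ?c"
      by (rule eventually_all_finite)
    then show "\<forall>\<^sub>F n in sequentially. \<forall>x\<in>S. \<forall>h.
        norm ((\<Sum>i\<in>UNIV. a n x $ i * h $ i) - (\<Sum>i\<in>UNIV. b i x * h $ i)) \<le> e * norm h"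
    proof eventually_elim
      case (elim n)
      show ?case
      proof (intro ballI allI)
        fix x h assume x: "x \<in> S"
        have "norm ((\<Sum>i\<in>UNIV. a n x $ i * h $ i) - (\<Sum>i\<in>UNIV. b i x * h $ i))
            = norm (\<Sum>i\<in>UNIV. (a n x $ i - b i x) * h $ i)"
          by (simp add: sum_subtractf left_diff_distrib)
        also have "\<dots> \<le> (\<Sum>i::'n\<in>UNIV. e / ?c * norm h)"
        proof (rule sum_norm_le)
          fix i
          show "norm ((a n x $ i - b i x) * h $ i) \<le> e / ?c * norm h"
            unfolding norm_mult using elim x e
            by (intro mult_mono) (auto simp: dist_norm less_imp_le Finite_Cartesian_Product.norm_nth_le)
        qed
        also have "\<dots> = e * norm h" by simp
        finally show "norm ((\<Sum>i\<in>UNIV. a n x $ i * h $ i) - (\<Sum>i\<in>UNIV. b i x * h $ i)) \<le> e * norm h" .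
      qed
    qed
  qed
  then obtain L where L: "\<And>x. x \<in> S \<Longrightarrow> (\<lambda>n. g n x) \<longlonglongrightarrow> L x"
    "\<And>x. x \<in> S \<Longrightarrow> (L has_derivative (\<lambda>h. \<Sum>i\<in>UNIV. b i x * h $ i)) (at x within S)"
    by blast
  \<comment> \<open>The limit supplied by the differentiation theorem is anonymous; pointwise it is
    the given \<open>l\<close>.\<close>
  have "L x = l x" if "x \<in> S" for x
  proof (rule LIMSEQ_unique[OF L(1)[OF that]])
    have "x \<in> ball z d" using SU[OF that, of 0] d by auto
    then show "(\<lambda>n. g n x) \<longlonglongrightarrow> l x" using d by (auto intro: tendsto_uniform_limitI)
  qed
  moreover have zS: "z \<in> S" using d(1) by (simp add: S_def)
  ultimately have "(l has_derivative (\<lambda>h. \<Sum>i\<in>UNIV. b i z * h $ i)) (at z within S)"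
    by (intro has_derivative_transform[OF _ _ L(2)[OF zS]]) auto
  moreover have "open S" by (simp add: S_def)
  ultimately show "\<exists>a. (l has_derivative (\<lambda>h. \<Sum>i\<in>UNIV. a i * h $ i)) (at z)"
    using at_within_open[OF zS] by (intro exI[of _ "\<lambda>i. b i z"]) simp
qed

subsection \<open>Homogeneous parts\<close>

text \<open>The k-th Taylor coefficient at 0 of the slice t -> f(t z). It makes sense for every z,
  since the slice is determined by the ball near t = 0, and it can be studied before a homogeneous
  expansion is known to exist; \<open>homogeneous_part_eq_hpart\<close> identifies it with the
  definite description.\<close>

definition hpart :: "(complex ^ 'n::finite \<Rightarrow> complex) \<Rightarrow> nat \<Rightarrow> complex ^ 'n \<Rightarrow> complex"
  where "hpart f k z = (deriv ^^ k) (\<lambda>t. f (t *s z)) 0 / fact k"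

lemma slice_0_holomorphic_on:
  assumes "holomorphic_n_on f (ball 0 1)" "R * norm z \<le> 1"
  shows "(\<lambda>t. f (t *s z)) holomorphic_on ball 0 R"
proof -
  have "0 + t *s z \<in> ball 0 1" if "t \<in> ball 0 R" for t
  proof (cases "z = 0")
    case False
    then have "cmod t * norm z < R * norm z" using that by simp
    then show ?thesis using assms(2) by (simp add: norm_vector_smult)
  qed simp
  from holomorphic_n_on_imp_slice[OF assms(1) open_ball this, of "ball 0 R"] show ?thesis by simp
qed

lemma hpart_sums_slice:
  assumes "holomorphic_n_on f (ball 0 1)" "cmod t * norm z < 1"
  shows "(\<lambda>k. hpart f k z * t ^ k) sums f (t *s z)"
proof -
  obtain R where R: "cmod t < R" "R * norm z \<le> 1"
  proof (cases "z = 0")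
    case True
    then show ?thesis using that[of "cmod t + 1"] by simp
  next
    case False
    then show ?thesis using that[of "1 / norm z"] assms(2) by (simp add: field_simps)
  qed
  have "t \<in> ball 0 R" using R by simp
  from holomorphic_power_series[OF slice_0_holomorphic_on[OF assms(1) R(2)] this]
  show ?thesis by (simp add: hpart_def)
qed

lemma hpart_sums:
  assumes "holomorphic_n_on f (ball 0 1)" "z \<in> ball 0 1"
  shows "(\<lambda>k. hpart f k z) sums f z"
  using hpart_sums_slice[OF assms(1), of 1 z] assms(2) by simp

text \<open>On each complex line through the origin a homogeneous expansion is a power series in t,
  and such a series is unique. Only the scaling of \<open>F k\<close> is required, neither
  continuity nor polynomiality; the later formulas for parts of sums, products and radial powers
  rest on this.\<close>

lemma hpart_unique:
  assumes sums: "\<And>z. z \<in> ball 0 1 \<Longrightarrow> (\<lambda>k. F k z) sums f z"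
    and hom: "\<And>k t z. F k (t *s z) = t ^ k * F k z"
  shows "hpart f k z = F k z"
proof -
  have "(\<lambda>t. f (t *s z)) has_fps_expansion Abs_fps (\<lambda>k. F k z)"
  proof (rule has_fps_expansionI)
    have "\<forall>\<^sub>F t in nhds 0. t \<in> ball 0 (1 / (norm z + 1))"
      by (intro eventually_nhds_in_open) (auto simp: add_nonneg_pos)
    then show "\<forall>\<^sub>F t in nhds 0. (\<lambda>n. fps_nth (Abs_fps (\<lambda>k. F k z)) n * t ^ n) sums f (t *s z)"
    proof eventually_elim
      case (elim t)
      have "cmod t * norm z \<le> cmod t * (norm z + 1)" by (intro mult_left_mono) auto
      also have "\<dots> < 1"
      proof -
        have "0 < norm z + 1" by (simp add: add_nonneg_pos)
        then show ?thesis using elim by (simp add: field_simps)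
      qed
      finally have "t *s z \<in> ball 0 1" by (simp add: norm_vector_smult)
      from sums[OF this] show ?case by (simp add: hom mult.commute)
    qed
  qed
  from fps_nth_fps_expansion[OF this, of k] show ?thesis
    by (simp add: hpart_def)
qed

lemma hpart_cong:
  assumes "\<And>z. z \<in> ball 0 1 \<Longrightarrow> f z = g z"
  shows "hpart f k z = hpart g k z"
proof -
  have "\<forall>\<^sub>F t in nhds 0. t \<in> ball 0 (1 / (norm z + 1))"
    by (intro eventually_nhds_in_open) (auto simp: add_nonneg_pos)
  then have "\<forall>\<^sub>F t in nhds 0. f (t *s z) = g (t *s z)"
  proof eventually_elim
    case (elim t)
    have "cmod t * norm z \<le> cmod t * (norm z + 1)" by (intro mult_left_mono) auto
    also have "\<dots> < 1"
    proof -
      have "0 < norm z + 1" by (simp add: add_nonneg_pos)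
      then show ?thesis using elim by (simp add: field_simps)
    qed
    finally show ?case by (intro assms) (simp add: norm_vector_smult)
  qed
  then show ?thesis unfolding hpart_def by (simp add: higher_deriv_cong_ev)
qed

lemma hpart_smult:
  assumes "holomorphic_n_on f (ball 0 1)"
  shows "hpart f k (t *s z) = t ^ k * hpart f k z"
proof -
  let ?T = "ball 0 (1 / (norm z + 1)) :: complex set"
  let ?S = "ball 0 (1 / ((norm z + 1) * (cmod t + 1))) :: complex set"
  have pos: "norm z + 1 > 0" "cmod t + 1 > 0" by (simp_all add: add_nonneg_pos)
  have "(deriv ^^ k) (\<lambda>w. (\<lambda>s. f (s *s z)) (t * w)) 0 = t ^ k * (deriv ^^ k) (\<lambda>s. f (s *s z)) (t * 0)"
  proof (rule higher_deriv_compose_linear)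
    show "(\<lambda>s. f (s *s z)) holomorphic_on ?T"
      using pos by (intro slice_0_holomorphic_on[OF assms]) (simp add: field_simps)
    show "t * w \<in> ?T" if "w \<in> ?S" for w
    proof -
      have "cmod t * cmod w \<le> (cmod t + 1) * cmod w" by (intro mult_right_mono) auto
      also have "\<dots> < (cmod t + 1) * (1 / ((norm z + 1) * (cmod t + 1)))"
        using that pos by (intro mult_strict_left_mono) auto
      also have "\<dots> = 1 / (norm z + 1)" using pos by simp
      finally show ?thesis by (simp add: norm_mult)
    qed
    show "0 \<in> ?S" using pos by simp
  qed auto
  then show ?thesis by (simp add: hpart_def mult.commute)
qed

lemma hpart_0 [simp]: "hpart f 0 z = f 0"
  by (simp add: hpart_def)

lemma hpart_at_0:
  assumes "holomorphic_n_on f (ball 0 1)" "k > 0"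
  shows "hpart f k 0 = 0"
  using hpart_smult[OF assms(1), of k 0 0] assms(2) by (simp add: power_0_left)

lemma holomorphic_n_on_bounded:
  assumes "holomorphic_n_on f (ball 0 1)" "R < 1"
  obtains M where "M \<ge> 0" "\<And>z. z \<in> cball 0 R \<Longrightarrow> cmod (f z) \<le> M"
proof -
  have "continuous_on (cball 0 R) f"
    by (rule continuous_on_subset[OF holomorphic_n_on_imp_continuous_on[OF assms(1)]])
      (use assms(2) in auto)
  then have "bounded (f ` cball 0 R)"
    by (intro compact_imp_bounded compact_continuous_image compact_cball)
  then obtain M where M: "\<And>z. z \<in> cball 0 R \<Longrightarrow> cmod (f z) \<le> M"
    unfolding bounded_iff by blast
  then have "cmod (f z) \<le> max M 0" if "z \<in> cball 0 R" for z
    using that by (meson max.coboundedI1)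
  then show ?thesis by (intro that[of "max M 0"]) auto
qed

text \<open>Cauchy's inequality for the slice through z on the circle of radius R / norm z, where
  the argument has norm R. The bound holds for all z, also outside the ball: it gives geometric
  decay inside and growth of order k at infinity.\<close>

lemma hpart_bound:
  assumes hol: "holomorphic_n_on f (ball 0 1)" and R: "0 < R" "R < 1"
    and M: "\<And>z. z \<in> cball 0 R \<Longrightarrow> cmod (f z) \<le> M"
  shows "cmod (hpart f k z) \<le> M * (norm z / R) ^ k"
proof (cases "z = 0")
  case True
  have "M \<ge> 0" using M[of 0] R by (simp add: order_trans[OF norm_ge_zero])
  then show ?thesis
    using True M[of 0] R hpart_at_0[OF hol, of k] by (cases "k = 0") auto
next
  case False
  let ?r = "R / norm z"
  have "1 / norm z * norm z \<le> 1" by simp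
  have hol': "(\<lambda>t. f (t *s z)) holomorphic_on ball 0 (1 / norm z)"
    using False by (intro slice_0_holomorphic_on[OF hol]) simp
  have sub: "cball 0 ?r \<subseteq> ball 0 (1 / norm z)"
    using False R by (auto simp: field_simps)
  have "cmod ((deriv ^^ k) (\<lambda>t. f (t *s z)) 0) \<le> fact k * M / ?r ^ k"
  proof (rule Cauchy_inequality)
    show "(\<lambda>t. f (t *s z)) holomorphic_on ball 0 ?r"
      using sub by (intro holomorphic_on_subset[OF hol']) auto
    show "continuous_on (cball 0 ?r) (\<lambda>t. f (t *s z))"
      using sub by (intro continuous_on_subset[OF holomorphic_on_imp_continuous_on[OF hol']]) auto
    show "0 < ?r" using False R by simp
    show "cmod (f (t *s z)) \<le> M" if "cmod (0 - t) = ?r" for t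
      using that False by (intro M) (simp add: norm_vector_smult)
  qed
  then have "cmod (hpart f k z) \<le> M / ?r ^ k"
    by (simp add: hpart_def norm_divide field_simps)
  also have "M / ?r ^ k = M * (norm z / R) ^ k"
    using False R by (simp add: field_simps)
  finally show ?thesis .
qed

lemma hpart_bound_ex:
  assumes "holomorphic_n_on f (ball 0 1)" "0 < R" "R < 1"
  shows "\<exists>M\<ge>0. \<forall>k z. cmod (hpart f k z) \<le> M * (norm z / R) ^ k"
proof -
  obtain M where "M \<ge> 0" "\<And>z. z \<in> cball 0 R \<Longrightarrow> cmod (f z) \<le> M"
    using holomorphic_n_on_bounded[OF assms(1,3)] by blast
  then show ?thesis using hpart_bound[OF assms] by blast
qed

lemma summable_norm_hpart:
  assumes "holomorphic_n_on f (ball 0 1)" "z \<in> ball 0 1"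
  shows "summable (\<lambda>k. cmod (hpart f k z))"
proof -
  obtain R where R: "norm z < R" "R < 1" using assms(2) dense[of "norm z" 1] by auto
  then have "R > 0" using norm_ge_zero[of z] by linarith
  obtain M where "M \<ge> 0" and M: "\<And>k z. cmod (hpart f k z) \<le> M * (norm z / R) ^ k"
    using hpart_bound_ex[OF assms(1) \<open>R > 0\<close> R(2)] by auto
  have "summable (\<lambda>k. M * (norm z / R) ^ k)"
    using R \<open>R > 0\<close> by (intro summable_mult summable_geometric) simp
  then show ?thesis by (rule summable_comparison_test'[of _ 0]) (use M in auto)
qed

lemma hpart_add:
  assumes "holomorphic_n_on f (ball 0 1)" "holomorphic_n_on g (ball 0 1)"
  shows "hpart (\<lambda>z. f z + g z) k z = hpart f k z + hpart g k z"
  by (rule hpart_unique[where F = "\<lambda>k z. hpart f k z + hpart g k z"])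
    (auto intro!: sums_add hpart_sums simp: assms hpart_smult distrib_left)

lemma hpart_cmult:
  assumes "holomorphic_n_on f (ball 0 1)"
  shows "hpart (\<lambda>z. c * f z) k z = c * hpart f k z"
  by (rule hpart_unique[where F = "\<lambda>k z. c * hpart f k z"])
    (auto intro!: sums_mult hpart_sums simp: assms hpart_smult)

lemma hpart_diff:
  assumes "holomorphic_n_on f (ball 0 1)" "holomorphic_n_on g (ball 0 1)"
  shows "hpart (\<lambda>z. f z - g z) k z = hpart f k z - hpart g k z"
  by (rule hpart_unique[where F = "\<lambda>k z. hpart f k z - hpart g k z"])
    (auto intro!: sums_diff hpart_sums simp: assms hpart_smult right_diff_distrib)

lemma hpart_mult:
  assumes "holomorphic_n_on f (ball 0 1)" "holomorphic_n_on g (ball 0 1)"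
  shows "hpart (\<lambda>z. f z * g z) k z = (\<Sum>i\<le>k. hpart f i z * hpart g (k - i) z)"
proof (rule hpart_unique[where F = "\<lambda>k z. \<Sum>i\<le>k. hpart f i z * hpart g (k - i) z"])
  show "(\<lambda>k. \<Sum>i\<le>k. hpart f i z * hpart g (k - i) z) sums (f z * g z)" if "z \<in> ball 0 1" for z
  proof -
    have "(\<Sum>k. hpart f k z) = f z" "(\<Sum>k. hpart g k z) = g z"
      using hpart_sums[OF assms(1) that] hpart_sums[OF assms(2) that] by (auto dest: sums_unique)
    then show ?thesis
      using Cauchy_product_sums[OF summable_norm_hpart[OF assms(1) that] summable_norm_hpart[OF assms(2) that]]
      by simp
  qed
  show "(\<Sum>i\<le>k. hpart f i (t *s z) * hpart g (k - i) (t *s z)) =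
      t ^ k * (\<Sum>i\<le>k. hpart f i z * hpart g (k - i) z)" for k t z
    unfolding sum_distrib_left
  proof (rule sum.cong)
    fix i assume "i \<in> {..k}"
    then have "t ^ k = t ^ i * t ^ (k - i)" by (simp flip: power_add)
    then show "hpart f i (t *s z) * hpart g (k - i) (t *s z) = t ^ k * (hpart f i z * hpart g (k - i) z)"
      by (simp add: hpart_smult assms)
  qed simp
qed

text \<open>
  On a complex line the \<open>k\<close>-th homogeneous part is the locally uniform limit, as \<open>c \<rightarrow> 0\<close>, of
  \<open>(f (c z) - \<Sum>\<^sub>j\<^sub><\<^sub>k c\<^sup>j f\<^sub>j z) / c\<^sup>k\<close>.
\<close>

lemma hpart_line_holomorphic:
  assumes hol: "holomorphic_n_on f (ball 0 1)"
  shows "(\<lambda>t. hpart f k (z + t *s w)) holomorphic_on UNIV"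
proof (induction k rule: less_induct)
  case (less k)
  obtain M where M: "M \<ge> 0" "\<And>k z. cmod (hpart f k z) \<le> M * (norm z / (1/2)) ^ k"
    using hpart_bound_ex[OF hol, of "1/2"] by auto
  have "(\<lambda>t. hpart f k (z + t *s w)) holomorphic_on ball 0 B" for B
  proof (cases "B > 0")
    case B: True
    define L where "L = norm z + B * norm w + 1"
    have L: "L \<ge> 1" using B by (simp add: L_def)
    \<comment> \<open>With R = 1/2 in the bound \<open>M\<close>, the tail of the expansion at c z
      is dominated by a geometric series of ratio 2 L c. This choice makes the ratio 1 / (2 (m +
      1)): at most 1/2, and tending to 0.\<close>
    define c where "c = (\<lambda>m::nat. 1 / (4 * L * (real m + 1)))"
    have c: "0 < c m" "2 * L * c m = 1 / (2 * (real m + 1))" for m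
    proof -
      have "0 < 4 * L * (real m + 1)" using L by (intro mult_pos_pos) auto
      then show "0 < c m" "2 * L * c m = 1 / (2 * (real m + 1))"
        using L by (simp_all add: c_def field_simps)
    qed
    define h where "h = (\<lambda>m t. (f (complex_of_real (c m) *s (z + t *s w)) -
        (\<Sum>j<k. complex_of_real (c m) ^ j * hpart f j (z + t *s w))) / complex_of_real (c m) ^ k)"
    have nL: "norm (z + t *s w) \<le> L" if "t \<in> ball 0 B" for t
    proof -
      have "cmod t * norm w \<le> B * norm w" using that by (intro mult_right_mono) auto
      then show ?thesis
        using norm_triangle_ineq[of z "t *s w"] by (simp add: L_def norm_vector_smult)
    qed
    have cL: "c m * x < 1" if "x \<le> L" for x m
    proof -
      have "c m * x \<le> c m * L" using that c(1)[of m] by (intro mult_left_mono) auto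
      also have "\<dots> = 1 / (4 * (real m + 1))" using c(2)[of m] by (simp add: field_simps)
      also have "\<dots> < 1" by (simp add: field_simps)
      finally show ?thesis .
    qed
    have err: "cmod (h m t - hpart f k (z + t *s w)) \<le> M * (2 * L) ^ k / (real m + 1)"
      if t: "t \<in> ball 0 B" for m t
    proof -
      let ?x = "z + t *s w" and ?c = "complex_of_real (c m)"
      define q where "q = 1 / (2 * (real m + 1))"
      have q: "0 < q" "q \<le> 1/2" by (auto simp: q_def field_simps)
      have "(\<lambda>j. hpart f j ?x * ?c ^ j) sums f (?c *s ?x)"
        using c(1)[of m] cL[OF nL[OF t]] by (intro hpart_sums_slice[OF hol]) simp
      \<comment> \<open>Dropping the degrees below k and dividing by the k-th power of c leaves a
        series whose leading term is the k-th part; the rest is the error.\<close>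
      from sums_split_initial_segment[OF this, of k]
      have "(\<lambda>j. hpart f (j + k) ?x * ?c ^ (j + k)) sums (h m t * ?c ^ k)"
        using c(1)[of m] by (simp add: h_def mult.commute)
      from sums_divide[OF this, of "?c ^ k"]
      have "(\<lambda>j. hpart f (j + k) ?x * ?c ^ j) sums h m t"
        using c(1)[of m] by (simp add: power_add)
      from sums_split_initial_segment[OF this, of 1]
      have "(\<lambda>j. hpart f (Suc j + k) ?x * ?c ^ Suc j) sums (h m t - hpart f k ?x)"
        by simp
      moreover have "(\<lambda>j. (M * (2 * L) ^ k * q) * q ^ j) sums ((M * (2 * L) ^ k * q) * (1 / (1 - q)))"
        using q by (intro sums_mult geometric_sums) auto
      moreover have "cmod (hpart f (Suc j + k) ?x * ?c ^ Suc j) \<le> (M * (2 * L) ^ k * q) * q ^ j" for j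
      proof -
        have "cmod (hpart f (Suc j + k) ?x * ?c ^ Suc j)
            \<le> (M * (norm ?x / (1/2)) ^ (Suc j + k)) * c m ^ Suc j"
          unfolding norm_mult norm_power using c(1)[of m]
          by (intro mult_mono M(2)) (auto intro!: mult_nonneg_nonneg M(1))
        also have "\<dots> \<le> (M * (2 * L) ^ (Suc j + k)) * c m ^ Suc j"
          using c(1)[of m] nL[OF t] M(1) L by (intro mult_right_mono mult_left_mono power_mono) auto
        also have "\<dots> = M * (2 * L) ^ k * (2 * L * c m) ^ Suc j"
          by (simp add: power_add power_mult_distrib)
        also have "\<dots> = (M * (2 * L) ^ k * q) * q ^ j"
          unfolding c(2) q_def[symmetric] by simp
        finally show ?thesis .
      qed
      ultimately have "cmod (h m t - hpart f k ?x) \<le> (M * (2 * L) ^ k * q) * (1 / (1 - q))"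
        by (rule norm_sums_le)
      also have "\<dots> \<le> (M * (2 * L) ^ k * q) * 2"
        using q M(1) L by (intro mult_left_mono) (auto simp: field_simps)
      also have "\<dots> = M * (2 * L) ^ k / (real m + 1)"
        by (simp add: q_def field_simps)
      finally show ?thesis .
    qed
    show ?thesis
    proof (rule holomorphic_uniform_sequence[where f = h])
      show "h m holomorphic_on ball 0 B" for m
        unfolding h_def
      proof (intro holomorphic_on_divide holomorphic_on_diff holomorphic_on_sum holomorphic_on_mult
          holomorphic_on_const)
        have "(\<lambda>t. f (complex_of_real (c m) *s z + t *s (complex_of_real (c m) *s w)))
            holomorphic_on ball 0 B"
        proof (rule holomorphic_n_on_imp_slice[OF hol open_ball])
          fix t :: complex assume t: "t \<in> ball 0 B"
          have "complex_of_real (c m) *s z + t *s (complex_of_real (c m) *s w)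
              = complex_of_real (c m) *s (z + t *s w)"
            by (simp add: vec_eq_iff algebra_simps)
          moreover have "complex_of_real (c m) *s (z + t *s w) \<in> ball 0 1"
            using cL[OF nL[OF t], of m] c(1)[of m] unfolding mem_ball_0 norm_vector_smult by simp
          ultimately show "complex_of_real (c m) *s z + t *s (complex_of_real (c m) *s w) \<in> ball 0 1"
            by (simp only:)
        qed
        moreover have "complex_of_real (c m) *s z + t *s (complex_of_real (c m) *s w)
              = complex_of_real (c m) *s (z + t *s w)" for t
          by (simp add: vec_eq_iff algebra_simps)
        ultimately show "(\<lambda>t. f (complex_of_real (c m) *s (z + t *s w))) holomorphic_on ball 0 B"
          by (simp only:)
        show "(\<lambda>t. hpart f j (z + t *s w)) holomorphic_on ball 0 B" if "j \<in> {..<k}" for j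
          using less.IH[of j] that by (auto intro: holomorphic_on_subset)
        show "complex_of_real (c m) ^ k \<noteq> 0" using c(1)[of m] by simp
      qed
      fix t0 :: complex assume t0: "t0 \<in> ball 0 B"
      then obtain d where d: "d > 0" "cball t0 d \<subseteq> ball 0 B"
        using open_contains_cball open_ball by metis
      have "uniform_limit (cball t0 d) h (\<lambda>t. hpart f k (z + t *s w)) sequentially"
      proof (rule uniform_limitI)
        fix e :: real assume "e > 0"
        have "(\<lambda>m. M * (2 * L) ^ k / (real m + 1)) \<longlonglongrightarrow> 0"
          by real_asymp
        then have "\<forall>\<^sub>F m in sequentially. M * (2 * L) ^ k / (real m + 1) < e"
          using \<open>e > 0\<close> order_tendstoD(2) by blast
        then show "\<forall>\<^sub>F m in sequentially. \<forall>t\<in>cball t0 d. dist (h m t) (hpart f k (z + t *s w)) < e"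
        proof eventually_elim
          case (elim m)
          then show ?case using err d(2) unfolding dist_norm by (meson le_less_trans subsetD)
        qed
      qed
      then show "\<exists>d>0. cball t0 d \<subseteq> ball 0 B \<and>
          uniform_limit (cball t0 d) h (\<lambda>t. hpart f k (z + t *s w)) sequentially"
        using d by blast
    qed simp
  qed (simp add: holomorphic_on_def ball_empty not_less)
  note ball = this
  show ?case
    unfolding holomorphic_on_open[OF open_UNIV]
  proof
    fix t :: complex
    have "t \<in> ball 0 (cmod t + 1)" by simp
    then show "\<exists>f'. ((\<lambda>t. hpart f k (z + t *s w)) has_field_derivative f') (at t)"
      using ball[of "cmod t + 1"] unfolding holomorphic_on_open[OF open_ball] by blast
  qed
qed

text \<open>The k-th part is entire on the line and by \<open>hpart_bound\<close> grows at most like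
  the k-th power, so Liouville's theorem makes it a polynomial. The point is that the line need not
  pass through the origin, where this would be mere homogeneity.\<close>

lemma hpart_line_polynomial:
  assumes hol: "holomorphic_n_on f (ball 0 1)"
  obtains c where "\<And>t. hpart f k (z + t *s w) = (\<Sum>e\<le>k. c e * t ^ e)"
proof -
  obtain M where M: "M \<ge> 0" "\<And>k z. cmod (hpart f k z) \<le> M * (norm z / (1/2)) ^ k"
    using hpart_bound_ex[OF hol, of "1/2"] by auto
  let ?C = "M * (2 * (norm z + norm w)) ^ k"
  have bound: "cmod (hpart f k (z + t *s w)) \<le> ?C * cmod t ^ k" if "1 \<le> cmod t" for t
  proof -
    have "norm (z + t *s w) \<le> norm z + cmod t * norm w"
      using norm_triangle_ineq[of z "t *s w"] by (simp add: norm_vector_smult)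
    also have "\<dots> \<le> cmod t * norm z + cmod t * norm w"
      using mult_right_mono[OF that norm_ge_zero[of z]] by simp
    finally have *: "norm (z + t *s w) \<le> (norm z + norm w) * cmod t" by (simp add: algebra_simps)
    have "cmod (hpart f k (z + t *s w)) \<le> M * (2 * norm (z + t *s w)) ^ k"
      using M(2)[of k "z + t *s w"] by (simp add: mult.commute)
    also have "\<dots> \<le> M * (2 * ((norm z + norm w) * cmod t)) ^ k"
      using * M(1) by (intro mult_left_mono power_mono) auto
    also have "\<dots> = ?C * cmod t ^ k"
      unfolding power_mult_distrib by (simp add: mult_ac)
    finally show ?thesis .
  qed
  have "hpart f k (z + t *s w) =
      (\<Sum>e\<le>k. (deriv ^^ e) (\<lambda>t. hpart f k (z + t *s w)) 0 / fact e * t ^ e)" for t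
    using Liouville_polynomial[OF hpart_line_holomorphic[OF hol], of 1 k z w ?C k t] bound by simp
  then show ?thesis by (rule that)
qed

section \<open>Finite Fourier analysis with roots of unity\<close>

lemma roots_of_unity_orthogonal:
  fixes N :: nat
  assumes "d < N" "e < N"
  shows "(\<Sum>j<N. cis (2 * pi * real j / real N) ^ d * cnj (cis (2 * pi * real j / real N)) ^ e)
    = (if d = e then of_nat N else 0)"
proof -
  define q where "q = cis (2 * pi * real d / real N) * cnj (cis (2 * pi * real e / real N))"
  have eq: "cis (2 * pi * real j / real N) ^ d * cnj (cis (2 * pi * real j / real N)) ^ e = q ^ j" for j
    by (simp add: q_def power_mult_distrib Complex.DeMoivre cis_cnj cis_mult algebra_simps
        flip: complex_cnj_power)
  show ?thesis
  proof (cases "d = e")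
    case True
    then have "q = 1" by (simp add: q_def cis_cnj cis_mult)
    then show ?thesis using True unfolding eq by simp
  next
    case False
    have "q \<noteq> 1"
    proof
      assume "q = 1"
      then have "cis (2 * pi * real d / real N) = cis (2 * pi * real e / real N)"
        by (simp add: q_def cis_cnj field_simps flip: cis_inverse)
      moreover have "inj_on (\<lambda>k. cis (2 * pi * real k / real N)) {..<N}"
        using Complex.bij_betw_roots_unity[of N] assms by (auto simp: bij_betw_def)
      ultimately show False using False assms by (auto simp: inj_on_def)
    qed
    moreover have "q ^ N = 1"
    proof -
      have "cis (2 * pi * real k / real N) ^ N = 1" for k
        using assms by (simp add: Complex.DeMoivre cis_multiple_2pi)
      then show ?thesis by (simp add: q_def power_mult_distrib flip: complex_cnj_power)
    qed
    ultimately show ?thesis using False by (simp add: eq geometric_sum)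
  qed
qed

text \<open>The average over the N-th roots of unity stands in for Cauchy's coefficient integral and
  is exact for polynomials of degree below N. Such finite averages replace integrals over the circle
  below, for coefficients, Parseval's identity, orthogonality and the mean value inequality.\<close>

lemma roots_of_unity_coeff:
  fixes N :: nat
  assumes "e < N"
  shows "(\<Sum>j<N. cnj (cis (2 * pi * real j / real N)) ^ e *
    (\<Sum>d<N. c d * cis (2 * pi * real j / real N) ^ d)) = of_nat N * c e"
proof -
  let ?w = "\<lambda>j. cis (2 * pi * real j / real N)"
  have "(\<Sum>j<N. cnj (?w j) ^ e * (\<Sum>d<N. c d * ?w j ^ d))
      = (\<Sum>d<N. c d * (\<Sum>j<N. ?w j ^ d * cnj (?w j) ^ e))"
    unfolding sum_distrib_left by (subst sum.swap) (simp add: mult_ac)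
  also have "\<dots> = (\<Sum>d<N. if d = e then c d * of_nat N else 0)"
    by (intro sum.cong) (simp_all add: roots_of_unity_orthogonal assms)
  also have "\<dots> = of_nat N * c e" using assms by simp
  finally show ?thesis .
qed

section \<open>Polynomial functions and their homogeneous components\<close>

lemma finite_multi_indices: "finite {m :: 'n::finite \<Rightarrow> nat. (\<Sum>i\<in>UNIV. m i) = k}"
proof (rule finite_subset)
  show "{m :: 'n \<Rightarrow> nat. (\<Sum>i\<in>UNIV. m i) = k} \<subseteq> PiE UNIV (\<lambda>_. {..k})"
    by (auto simp: PiE_def extensional_def intro: member_le_sum)
  show "finite (PiE (UNIV :: 'n set) (\<lambda>_. {..k}))"
    by (intro finite_PiE) auto
qed

lemma homogeneous_poly_zero: "homogeneous_poly k (\<lambda>z. 0)"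
  unfolding homogeneous_poly_def by (intro exI[of _ "\<lambda>_. 0"]) simp

lemma homogeneous_poly_add:
  assumes "homogeneous_poly k p" "homogeneous_poly k q"
  shows "homogeneous_poly k (\<lambda>z. p z + q z)"
proof -
  from assms obtain a b where
    "p = (\<lambda>z. \<Sum>m | (\<Sum>i\<in>UNIV. m i) = k. a m * (\<Prod>i\<in>UNIV. z $ i ^ m i))"
    "q = (\<lambda>z. \<Sum>m | (\<Sum>i\<in>UNIV. m i) = k. b m * (\<Prod>i\<in>UNIV. z $ i ^ m i))"
    unfolding homogeneous_poly_def by blast
  then show ?thesis unfolding homogeneous_poly_def
    by (intro exI[of _ "\<lambda>m. a m + b m"]) (simp add: distrib_right sum.distrib)
qed

lemma homogeneous_poly_monomial:
  "homogeneous_poly (\<Sum>i\<in>UNIV. m i) (\<lambda>z. c * (\<Prod>i\<in>UNIV. z $ i ^ m i))"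
proof -
  have "(\<Sum>m' | (\<Sum>i\<in>UNIV. m' i) = (\<Sum>i\<in>UNIV. m i).
      (if m' = m then c else 0) * (\<Prod>i\<in>UNIV. z $ i ^ m' i)) = c * (\<Prod>i\<in>UNIV. z $ i ^ m i)" for z
  proof -
    have "(\<Sum>m' | (\<Sum>i\<in>UNIV. m' i) = (\<Sum>i\<in>UNIV. m i).
        (if m' = m then c else 0) * (\<Prod>i\<in>UNIV. z $ i ^ m' i))
      = (\<Sum>m' | (\<Sum>i\<in>UNIV. m' i) = (\<Sum>i\<in>UNIV. m i).
        if m' = m then c * (\<Prod>i\<in>UNIV. z $ i ^ m i) else 0)"
      by (intro sum.cong) auto
    also have "\<dots> = c * (\<Prod>i\<in>UNIV. z $ i ^ m i)"
      by (simp add: finite_multi_indices)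
    finally show ?thesis .
  qed
  then show ?thesis unfolding homogeneous_poly_def
    by (intro exI[of _ "\<lambda>m'. if m' = m then c else 0"]) auto
qed

lemma homogeneous_poly_smult:
  assumes "homogeneous_poly k p"
  shows "p (t *s z) = t ^ k * p z"
proof -
  from assms obtain a where
    p: "p = (\<lambda>z. \<Sum>m | (\<Sum>i\<in>UNIV. m i) = k. a m * (\<Prod>i\<in>UNIV. z $ i ^ m i))"
    unfolding homogeneous_poly_def by blast
  show ?thesis unfolding p sum_distrib_left
    by (intro sum.cong) (auto simp: power_mult_distrib prod.distrib simp flip: power_sum)
qed

lemma homogeneous_poly_holomorphic:
  assumes "homogeneous_poly k p"
  shows "holomorphic_n_on p U"
proof -
  from assms obtain a where
    p: "p = (\<lambda>z. \<Sum>m | (\<Sum>i\<in>UNIV. m i) = k. a m * (\<Prod>i\<in>UNIV. z $ i ^ m i))"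
    unfolding homogeneous_poly_def by blast
  have coord: "holomorphic_n_on (\<lambda>z. z $ i) U" for i
  proof (rule holomorphic_n_onI)
    fix z :: "complex ^ 'a"
    have "(\<lambda>h::complex ^ 'a. \<Sum>j\<in>UNIV. (if j = i then 1 else 0) * h $ j) = (\<lambda>h. h $ i)"
      by (simp add: if_distrib[of "\<lambda>x. x * _"] cong: if_cong)
    moreover have "((\<lambda>z. z $ i) has_derivative (\<lambda>h. h $ i)) (at z)"
      by (rule bounded_linear_imp_has_derivative[OF bounded_linear_vec_nth])
    ultimately show "\<exists>a. ((\<lambda>z. z $ i) has_derivative (\<lambda>h::complex ^ 'a. \<Sum>j\<in>UNIV. a j * h $ j)) (at z)"
      by (intro exI[of _ "\<lambda>j. if j = i then 1 else 0"]) (simp only:)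
  qed
  have pow: "holomorphic_n_on (\<lambda>z. z $ i ^ e) U" for i e
    by (induction e) (auto intro: holomorphic_n_on_mult holomorphic_n_on_const coord)
  have "holomorphic_n_on (\<lambda>z. \<Prod>i\<in>I. z $ i ^ m i) U" if "finite I" for I m
    using that
  proof (induction I rule: finite_induct)
    case (insert i I)
    then show ?case
      using holomorphic_n_on_mult[OF pow] by auto
  qed (simp add: holomorphic_n_on_const)
  then show ?thesis unfolding p
    by (intro holomorphic_n_on_sum holomorphic_n_on_cmult) auto
qed

text \<open>Polynomials without a grading. Eliminating one coordinate after another does not respect
  the total degree, so monomials are sorted by degree only afterwards, in
  \<open>poly_functions_homogeneous_decomposition\<close>.\<close>

inductive_set poly_functions :: "(complex ^ 'n::finite \<Rightarrow> complex) set" where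
  zero: "(\<lambda>z. 0) \<in> poly_functions"
| step: "p \<in> poly_functions \<Longrightarrow> (\<lambda>z. c * (\<Prod>i\<in>UNIV. z $ i ^ m i) + p z) \<in> poly_functions"

lemma poly_functions_add:
  "p \<in> poly_functions \<Longrightarrow> q \<in> poly_functions \<Longrightarrow> (\<lambda>z. p z + q z) \<in> poly_functions"
proof (induction p rule: poly_functions.induct)
  case (step p c m)
  from poly_functions.step[OF step.IH[OF step.prems], of c m] show ?case
    by (simp add: add.assoc)
qed simp

lemma poly_functions_sum:
  "(\<And>i. i \<in> I \<Longrightarrow> p i \<in> poly_functions) \<Longrightarrow> (\<lambda>z. \<Sum>i\<in>I. p i z) \<in> poly_functions"
  by (induction I rule: infinite_finite_induct) (auto intro: poly_functions.zero poly_functions_add)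

lemma poly_functions_mult_coord:
  "p \<in> poly_functions \<Longrightarrow> (\<lambda>z. p z * z $ i ^ e) \<in> poly_functions"
proof (induction p rule: poly_functions.induct)
  case zero
  then show ?case by (simp add: poly_functions.zero)
next
  case (step p c m)
  have "c * (\<Prod>j\<in>UNIV. z $ j ^ m j) * z $ i ^ e
      = c * (\<Prod>j\<in>UNIV. z $ j ^ (m(i := m i + e)) j)" for z :: "complex ^ 'a"
  proof -
    have "(\<Prod>j\<in>UNIV. z $ j ^ (m(i := m i + e)) j)
        = z $ i ^ (m i + e) * (\<Prod>j\<in>UNIV - {i}. z $ j ^ m j)"
      by (subst prod.remove[of _ i]) auto
    moreover have "(\<Prod>j\<in>UNIV. z $ j ^ m j) = z $ i ^ m i * (\<Prod>j\<in>UNIV - {i}. z $ j ^ m j)"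
      by (subst prod.remove[of _ i]) auto
    ultimately show ?thesis by (simp add: power_add)
  qed
  then have "(\<lambda>z::complex ^ 'a. (c * (\<Prod>j\<in>UNIV. z $ j ^ m j) + p z) * z $ i ^ e)
      = (\<lambda>z. c * (\<Prod>j\<in>UNIV. z $ j ^ (m(i := m i + e)) j) + p z * z $ i ^ e)"
    by (simp only: distrib_right)
  with poly_functions.step[OF step.IH, of c "m(i := m i + e)"] show ?case
    by (simp only:)
qed

definition upd_coord :: "complex ^ 'n \<Rightarrow> 'n \<Rightarrow> complex \<Rightarrow> complex ^ 'n"
  where "upd_coord z i t = (\<chi> j. if j = i then t else z $ j)"

text \<open>
  The coefficients of \<open>P\<close> as a polynomial in one coordinate are averages of values of \<open>P\<close> over
  roots of unity, hence again polynomials in each of the remaining coordinates.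
\<close>

lemma separately_polynomial_imp_poly_functions:
  fixes P :: "complex ^ 'n::finite \<Rightarrow> complex"
  assumes "finite I"
    and "\<And>z z'. (\<And>i. i \<in> I \<Longrightarrow> z $ i = z' $ i) \<Longrightarrow> P z = P z'"
    and "\<And>i z. \<exists>c. \<forall>t. P (upd_coord z i t) = (\<Sum>d<N. c d * t ^ d)"
  shows "P \<in> poly_functions"
  using assms
proof (induction I arbitrary: P rule: finite_induct)
  case empty
  have "P = (\<lambda>z. P 0)"
    using empty(1) by force
  moreover have "(\<lambda>z. P 0) \<in> poly_functions"
    using poly_functions.step[OF poly_functions.zero, of "P 0" "\<lambda>_. 0"] by simp
  ultimately show ?case by metis
next
  case (insert i I)
  let ?w = "\<lambda>j. cis (2 * pi * real j / real N)"
  \<comment> \<open>Coordinate i is overwritten here, so \<open>Q e\<close> depends on the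
    coordinates in \<open>I\<close> alone and the induction hypothesis applies.\<close>
  define Q where "Q = (\<lambda>e z. \<Sum>j<N. cnj (?w j) ^ e / of_nat N * P (upd_coord z i (?w j)))"
  have "P z = (\<Sum>e<N. Q e z * z $ i ^ e)" for z
  proof -
    obtain c where c: "\<And>t. P (upd_coord z i t) = (\<Sum>d<N. c d * t ^ d)"
      using insert.prems(2) by blast
    have "Q e z = c e" if "e < N" for e
    proof -
      have "of_nat N * Q e z = (\<Sum>j<N. cnj (?w j) ^ e * (\<Sum>d<N. c d * ?w j ^ d))"
        using that by (simp add: Q_def c sum_distrib_left[of "of_nat N"])
      also have "\<dots> = of_nat N * c e" by (rule roots_of_unity_coeff[OF that])
      finally show ?thesis using that by simp
    qed
    moreover have "P z = P (upd_coord z i (z $ i))"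
      by (rule arg_cong[of _ _ P]) (simp add: upd_coord_def vec_eq_iff)
    ultimately show ?thesis by (simp add: c)
  qed
  moreover have "Q e \<in> poly_functions" for e
  proof (rule insert.IH)
    fix z z' :: "complex ^ 'n" assume "\<And>i. i \<in> I \<Longrightarrow> z $ i = z' $ i"
    then have "P (upd_coord z i t) = P (upd_coord z' i t)" for t
      by (intro insert.prems(1)) (auto simp: upd_coord_def)
    then show "Q e z = Q e z'" by (simp add: Q_def)
  next
    fix k :: 'n and z
    have "\<exists>c. \<forall>t. P (upd_coord (upd_coord z k t) i s) = (\<Sum>d<N. c d * t ^ d)" for s
    proof (cases "k = i")
      case True
      obtain c' where c': "\<And>t. P (upd_coord z i t) = (\<Sum>d<N. c' d * t ^ d)"
        using insert.prems(2) by blast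
      have *: "upd_coord (upd_coord z k t) i s = upd_coord z i s" for t
        by (simp add: upd_coord_def vec_eq_iff True)
      show ?thesis
      \<comment> \<open>A constant is a sum over d < N only if the index 0 occurs; for N = 0 the
        polynomial hypothesis forces the value 0.\<close>
      proof (cases "N = 0")
        case True
        then show ?thesis using c' by (simp add: *)
      next
        case False
        then have "(\<Sum>d<N. (if d = 0 then P (upd_coord z i s) else 0) * t ^ d) = P (upd_coord z i s)" for t
          by (simp add: if_distrib[of "\<lambda>x. x * _"] cong: if_cong)
        then show ?thesis
          by (intro exI[of _ "\<lambda>d. if d = 0 then P (upd_coord z i s) else 0"]) (simp add: *)
      qed
    next
      case False
      have *: "upd_coord (upd_coord z k t) i s = upd_coord (upd_coord z i s) k t" for t
        using False by (auto simp: upd_coord_def vec_eq_iff)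
      show ?thesis unfolding * by (rule insert.prems(2))
    qed
    then have "\<exists>c. \<forall>s t. P (upd_coord (upd_coord z k t) i s) = (\<Sum>d<N. c s d * t ^ d)"
      by (intro choice allI)
    then obtain c where c: "\<And>s t. P (upd_coord (upd_coord z k t) i s) = (\<Sum>d<N. c s d * t ^ d)"
      by blast
    have "Q e (upd_coord z k t) = (\<Sum>d<N. (\<Sum>j<N. cnj (?w j) ^ e / of_nat N * c (?w j) d) * t ^ d)" for t
      unfolding Q_def c sum_distrib_left sum_distrib_right by (subst sum.swap) (simp add: mult.assoc)
    then show "\<exists>c. \<forall>t. Q e (upd_coord z k t) = (\<Sum>d<N. c d * t ^ d)"
      by (intro exI[of _ "\<lambda>d. \<Sum>j<N. cnj (?w j) ^ e / of_nat N * c (?w j) d"] allI)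
  qed
  ultimately show ?case
    using poly_functions_sum[OF poly_functions_mult_coord, of "{..<N}" Q "\<lambda>_. i" "\<lambda>e. e"]
    by presburger
qed

lemma poly_functions_homogeneous_decomposition:
  assumes "p \<in> poly_functions"
  shows "\<exists>N F. (\<forall>k. homogeneous_poly k (F k)) \<and> (\<forall>k\<ge>N. F k = (\<lambda>z. 0)) \<and> (\<forall>z. p z = (\<Sum>k<N. F k z))"
  using assms
proof (induction p rule: poly_functions.induct)
  case zero
  show ?case by (intro exI[of _ 0] exI[of _ "\<lambda>_ _. 0"]) (simp add: homogeneous_poly_zero)
next
  case (step p c m)
  then obtain N F where F: "\<And>k. homogeneous_poly k (F k)" "\<And>k. k \<ge> N \<Longrightarrow> F k = (\<lambda>z. 0)"
    "\<And>z. p z = (\<Sum>k<N. F k z)" by blast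
  let ?d = "\<Sum>i\<in>UNIV. m i"
  define G where "G = (\<lambda>k z. (if k = ?d then c * (\<Prod>i\<in>UNIV. z $ i ^ m i) else 0) + F k z)"
  have "homogeneous_poly k (G k)" for k
    unfolding G_def
  proof (intro homogeneous_poly_add F)
    show "homogeneous_poly k (\<lambda>z. if k = ?d then c * (\<Prod>i\<in>UNIV. z $ i ^ m i) else 0)"
      using homogeneous_poly_monomial[of m c] by (cases "k = ?d") (simp_all add: homogeneous_poly_zero)
  qed
  moreover have "G k = (\<lambda>z. 0)" if "k \<ge> max N (Suc ?d)" for k
    using that F(2)[of k] by (auto simp: G_def)
  moreover have "c * (\<Prod>i\<in>UNIV. z $ i ^ m i) + p z = (\<Sum>k<max N (Suc ?d). G k z)" for z
  proof -
    have "(\<Sum>k<max N (Suc ?d). F k z) = p z"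
      unfolding F(3) by (rule sum.mono_neutral_right) (auto simp: F(2))
    then show ?thesis by (simp add: G_def sum.distrib)
  qed
  ultimately show ?case by blast
qed

text \<open>By Liouville on coordinate lines the part is polynomial in each coordinate with degree
  at most k, hence a polynomial. Its components of other degrees vanish because it scales like
  \<open>t ^ k\<close>.\<close>

lemma hpart_homogeneous_poly:
  fixes f :: "complex ^ 'n::finite \<Rightarrow> complex"
  assumes hol: "holomorphic_n_on f (ball 0 1)"
  shows "homogeneous_poly k (hpart f k)"
proof -
  have "hpart f k \<in> poly_functions"
  proof (rule separately_polynomial_imp_poly_functions[of UNIV _ "Suc k"])
    fix i and z :: "complex ^ 'n"
    obtain c where c: "\<And>t. hpart f k (upd_coord z i 0 + t *s axis i 1) = (\<Sum>e\<le>k. c e * t ^ e)"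
      using hpart_line_polynomial[OF hol] by blast
    have "upd_coord z i 0 + t *s axis i 1 = upd_coord z i t" for t
      by (simp add: upd_coord_def axis_def vec_eq_iff)
    then show "\<exists>c. \<forall>t. hpart f k (upd_coord z i t) = (\<Sum>d<Suc k. c d * t ^ d)"
      using c unfolding lessThan_Suc_atMost by metis
  next
    fix z z' :: "complex ^ 'n" assume "\<And>i. i \<in> UNIV \<Longrightarrow> z $ i = z' $ i"
    then have "z = z'" by (simp add: vec_eq_iff)
    then show "hpart f k z = hpart f k z'" by simp
  qed simp
  then obtain N F where F: "\<And>k. homogeneous_poly k (F k)" "\<And>k. k \<ge> N \<Longrightarrow> F k = (\<lambda>z. 0)"
    "\<And>z. hpart f k z = (\<Sum>k<N. F k z)"
    using poly_functions_homogeneous_decomposition by blast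
  have "hpart f k z = F k z" for z
  proof -
    \<comment> \<open>The k-th part of the k-th part is computed twice: from the decomposition
      \<open>F\<close>, and from the expansion consisting of the single term of degree k.\<close>
    have "hpart (hpart f k) k z = F k z"
    proof (rule hpart_unique)
      show "(\<lambda>k. F k z) sums hpart f k z" for z
        unfolding F(3) by (rule sums_finite) (auto simp: F(2))
    qed (rule homogeneous_poly_smult[OF F(1)])
    moreover have "hpart (hpart f k) k z = (if k = k then hpart f k z else 0)"
    proof (rule hpart_unique[where F = "\<lambda>j z. if j = k then hpart f k z else 0"])
      show "(\<lambda>j. if j = k then hpart f k z else 0) sums hpart f k z" for z
        using sums_single[of k "\<lambda>_. hpart f k z"] by (simp add: eq_commute)
    qed (simp add: hpart_smult[OF hol])
    ultimately show ?thesis by simp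
  qed
  then have "hpart f k = F k" by blast
  then show ?thesis using F(1) by simp
qed

text \<open>Polynomiality gives the existence of the expansion and scaling its uniqueness, so the
  definite description is meaningful for functions holomorphic on the ball.\<close>

lemma homogeneous_part_eq_hpart:
  assumes hol: "holomorphic_n_on f (ball 0 1)"
  shows "homogeneous_part f = hpart f"
  unfolding homogeneous_part_def
proof (rule the_equality)
  show "homogeneous_expansion f (hpart f)"
    unfolding homogeneous_expansion_def
    using hpart_homogeneous_poly[OF hol] hpart_sums[OF hol] by blast
  fix F assume F: "homogeneous_expansion f F"
  have "F k z = hpart f k z" for k z
    using F unfolding homogeneous_expansion_def
    by (intro hpart_unique[symmetric]) (auto intro: homogeneous_poly_smult)
  then show "F = hpart f" by blast
qed

lemma hpart_holomorphic:
  "holomorphic_n_on f (ball 0 1) \<Longrightarrow> holomorphic_n_on (hpart f k) U"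
  using homogeneous_poly_holomorphic hpart_homogeneous_poly by blast

lemma continuous_on_hpart:
  "holomorphic_n_on f (ball 0 1) \<Longrightarrow> continuous_on U (hpart f k)"
  using hpart_holomorphic holomorphic_n_on_imp_continuous_on by blast

subsection \<open>Rotation invariance\<close>

lemma nn_integral_lborel_translate:
  fixes g :: "'a::euclidean_space \<Rightarrow> ennreal"
  assumes [measurable]: "g \<in> borel_measurable borel"
  shows "(\<integral>\<^sup>+x. g (c + x) \<partial>lborel) = (\<integral>\<^sup>+x. g x \<partial>lborel)"
proof -
  have "(\<integral>\<^sup>+x. g x \<partial>lborel) = (\<integral>\<^sup>+x. g x \<partial>distr lborel borel ((+) c))"
    by (simp add: lborel_distr_plus)
  also have "\<dots> = (\<integral>\<^sup>+x. g (c + x) \<partial>lborel)"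
    by (rule nn_integral_distr) simp_all
  finally show ?thesis by simp
qed

lemma emeasure_lborel_unit_ball:
  "emeasure lborel (ball 0 1 :: 'a::euclidean_space set) \<noteq> 0"
  "emeasure lborel (ball 0 1 :: 'a::euclidean_space set) \<noteq> \<infinity>"
  using unit_ball_vol_pos[of "DIM('a)"] by (simp_all add: emeasure_ball del: unit_ball_vol_pos)

text \<open>
  Uniqueness of translation-invariant measures: by Fubini, \<open>\<lambda> (T\<^sup>-\<^sup>1 A) \<lambda> B = \<lambda> A \<lambda> B\<close> for the
  unit ball \<open>B\<close>, because \<open>T\<close> maps balls to balls.
\<close>

lemma lborel_distr_orthogonal_transformation:
  fixes T :: "'a::euclidean_space \<Rightarrow> 'a"
  assumes T: "orthogonal_transformation T"
  shows "distr lborel borel T = lborel"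
proof (rule measure_eqI)
  have lin: "linear T" and isom: "\<And>x. norm (T x) = norm x"
    using T by (auto simp: orthogonal_transformation)
  define T' where "T' = inv T"
  have TT': "T (T' y) = y" for y
    using orthogonal_transformation_surj[OF T] by (simp add: T'_def surj_f_inv_f)
  have T_borel [measurable]: "T \<in> borel_measurable borel"
    using lin by (intro borel_measurable_continuous_onI linear_continuous_on)
      (simp add: linear_conv_bounded_linear)
  show "sets (distr lborel borel T) = sets lborel" by simp
  fix A assume "A \<in> sets (distr lborel borel T)"
  then have A [measurable]: "A \<in> sets borel" by simp
  let ?E = "ball (0::'a) 1"
  have [measurable]: "?E \<in> sets borel" by simp
  have norm_diff: "norm (y - T x) = norm (x - T' y)" for x y
  proof -
    have "y - T x = T (T' y - x)" by (simp add: linear_diff[OF lin] TT')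
    then show ?thesis by (simp add: isom norm_minus_commute)
  qed
  have "emeasure (distr lborel borel T) A * emeasure lborel ?E
      = (\<integral>\<^sup>+x. indicator A (T x) \<partial>lborel) * (\<integral>\<^sup>+y. indicator ?E y \<partial>lborel)"
    by (simp add: nn_integral_distr flip: nn_integral_indicator)
  also have "\<dots> = (\<integral>\<^sup>+y. (\<integral>\<^sup>+x. indicator A (T x) \<partial>lborel) * indicator ?E y \<partial>lborel)"
    by (rule nn_integral_cmult[symmetric], rule borel_measurable_indicator) simp
  also have "\<dots> = (\<integral>\<^sup>+y. (\<integral>\<^sup>+x. indicator A (y + T x) * indicator ?E y \<partial>lborel) \<partial>lborel)"
  proof (rule nn_integral_cong)
    \<comment> \<open>Translating x by \<open>T' y\<close> moves the argument \<open>T x\<close> to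
      \<open>y + T x\<close>; this is where the linearity of \<open>T\<close> enters.\<close>
    fix y
    have "(\<integral>\<^sup>+x. indicator A (T x) \<partial>lborel) = (\<integral>\<^sup>+x. indicator A (T (T' y + x)) \<partial>lborel)"
      by (rule nn_integral_lborel_translate[symmetric]) measurable
    also have "\<dots> = (\<integral>\<^sup>+x. indicator A (y + T x) \<partial>lborel)"
      by (simp add: linear_add[OF lin] TT')
    finally show "(\<integral>\<^sup>+x. indicator A (T x) \<partial>lborel) * indicator ?E y
        = (\<integral>\<^sup>+x. indicator A (y + T x) * indicator ?E y \<partial>lborel)"
      by (simp add: nn_integral_multc)
  qed
  also have "\<dots> = (\<integral>\<^sup>+x. (\<integral>\<^sup>+y. indicator A (y + T x) * indicator ?E y \<partial>lborel) \<partial>lborel)"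
    by (rule lborel_pair.Fubini') measurable
  also have "\<dots> = (\<integral>\<^sup>+x. (\<integral>\<^sup>+y. indicator A y * indicator ?E (y - T x) \<partial>lborel) \<partial>lborel)"
  proof (rule nn_integral_cong)
    fix x
    have "(\<lambda>y. indicator A y * indicator ?E (y - T x) :: ennreal) \<in> borel_measurable borel"
      by measurable
    from nn_integral_lborel_translate[OF this, of "T x"]
    show "(\<integral>\<^sup>+y. indicator A (y + T x) * indicator ?E y \<partial>lborel)
        = (\<integral>\<^sup>+y. indicator A y * indicator ?E (y - T x) \<partial>lborel)"
      by (simp add: add.commute)
  qed
  also have "\<dots> = (\<integral>\<^sup>+y. (\<integral>\<^sup>+x. indicator A y * indicator ?E (y - T x) \<partial>lborel) \<partial>lborel)"
    by (rule lborel_pair.Fubini'[symmetric]) measurable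
  also have "\<dots> = (\<integral>\<^sup>+y. indicator A y * emeasure lborel ?E \<partial>lborel)"
  proof (rule nn_integral_cong)
    fix y
    have "(\<integral>\<^sup>+x. indicator ?E (y - T x) \<partial>lborel) = (\<integral>\<^sup>+x. indicator ?E (- T' y + x) \<partial>lborel)"
      by (intro nn_integral_cong) (simp add: indicator_def norm_diff)
    also have "\<dots> = (\<integral>\<^sup>+x. indicator ?E x \<partial>lborel)"
      by (rule nn_integral_lborel_translate) measurable
    also have "\<dots> = emeasure lborel ?E" by simp
    finally show "(\<integral>\<^sup>+x. indicator A y * indicator ?E (y - T x) \<partial>lborel)
        = indicator A y * emeasure lborel ?E"
      by (simp add: nn_integral_cmult)
  qed
  also have "\<dots> = emeasure lborel A * emeasure lborel ?E"
    by (simp add: nn_integral_multc)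
  finally have "emeasure (distr lborel borel T) A * emeasure lborel ?E
      = emeasure lborel A * emeasure lborel ?E" .
  \<comment> \<open>Cancelling is legitimate because the unit ball has positive finite
    volume.\<close>
  then show "emeasure (distr lborel borel T) A = emeasure lborel A"
    using emeasure_lborel_unit_ball[where 'a = 'a]
    by (simp add: ennreal_mult_cancel_left mult.commute[of _ "emeasure lborel ?E"])
qed

lemma orthogonal_transformation_smult:
  assumes "cmod w = 1"
  shows "orthogonal_transformation (\<lambda>z :: complex ^ 'n::finite. w *s z)"
  unfolding orthogonal_transformation
proof (intro conjI allI)
  show "linear (\<lambda>z :: complex ^ 'n. w *s z)"
    by (rule linearI) (auto simp: vec_eq_iff algebra_simps)
qed (simp add: norm_vector_smult assms)

lemma nn_integral_lborel_smult:
  assumes "cmod w = 1" and [measurable]: "g \<in> borel_measurable borel"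
  shows "(\<integral>\<^sup>+z. g (w *s z) \<partial>lborel) = (\<integral>\<^sup>+z. g z \<partial>(lborel :: (complex ^ 'n::finite) measure))"
proof -
  have [measurable]: "(\<lambda>z :: complex ^ 'n. w *s z) \<in> borel_measurable borel"
    by (intro borel_measurable_continuous_onI continuous_intros)
  have "(\<integral>\<^sup>+z. g z \<partial>(lborel :: (complex ^ 'n::finite) measure))
      = (\<integral>\<^sup>+z. g z \<partial>distr lborel borel (\<lambda>z. w *s z))"
    by (simp only: lborel_distr_orthogonal_transformation[OF orthogonal_transformation_smult[OF assms(1)]])
  also have "\<dots> = (\<integral>\<^sup>+z. g (w *s z) \<partial>lborel)"
    by (rule nn_integral_distr) simp_all
  finally show ?thesis by simp
qed

lemma borel_measurable_sgn_vec [measurable]: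
  "(sgn :: complex ^ 'n::finite \<Rightarrow> _) \<in> borel_measurable borel"
  unfolding sgn_div_norm[abs_def] by measurable

text \<open>The restriction to the sphere turns into removal of the origin, since sgn z lies on the
  sphere exactly when z is nonzero. Sphere integrals thereby become volume integrals of radially
  constant functions.\<close>

lemma nn_integral_sphere_measure:
  fixes g :: "complex ^ 'n::finite \<Rightarrow> ennreal"
  assumes [measurable]: "g \<in> borel_measurable borel"
  shows "(\<integral>\<^sup>+\<zeta>. g \<zeta> \<partial>sphere_measure)
    = (\<integral>\<^sup>+z. g (sgn z) * indicator (ball 0 1 - {0}) z \<partial>lborel) / emeasure lborel (ball 0 1 :: (complex ^ 'n) set)"
proof -
  let ?B = "ball 0 1 :: (complex ^ 'n) set"
  have [measurable]: "sphere 0 1 \<in> sets (borel :: (complex ^ 'n) measure)" by (simp add: borel_closed)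
  have "(\<integral>\<^sup>+\<zeta>. g \<zeta> \<partial>sphere_measure)
      = (\<integral>\<^sup>+\<zeta>. g \<zeta> * indicator (sphere 0 1) \<zeta> \<partial>distr (uniform_measure lborel ?B) borel sgn)"
    unfolding sphere_measure_def by (rule nn_integral_restrict_space) simp
  also have "\<dots> = (\<integral>\<^sup>+z. g (sgn z) * indicator (sphere 0 1) (sgn z) \<partial>uniform_measure lborel ?B)"
    by (rule nn_integral_distr) measurable
  also have "\<dots> = (\<integral>\<^sup>+z. g (sgn z) * indicator (sphere 0 1) (sgn z) * indicator ?B z \<partial>lborel) / emeasure lborel ?B"
    using measurable_compose[OF borel_measurable_sgn_vec borel_measurable_indicator[OF borel_closed[OF closed_sphere]]]
    by (intro nn_integral_uniform_measure borel_measurable_times) simp_all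
  also have "(\<integral>\<^sup>+z. g (sgn z) * indicator (sphere 0 1) (sgn z) * indicator ?B z \<partial>lborel)
      = (\<integral>\<^sup>+z. g (sgn z) * indicator (?B - {0}) z \<partial>lborel)"
    by (intro nn_integral_cong) (auto simp: indicator_def norm_sgn)
  finally show ?thesis .
qed

lemma space_sphere_measure: "space sphere_measure = (sphere 0 1 :: (complex ^ 'n::finite) set)"
  by (simp add: sphere_measure_def space_restrict_space)

lemma borel_measurable_sphere_measure:
  assumes "continuous_on (sphere 0 1) g"
  shows "g \<in> borel_measurable (sphere_measure :: (complex ^ 'n::finite) measure)"
proof -
  have "sets (sphere_measure :: (complex ^ 'n) measure) = sets (restrict_space borel (sphere 0 1))"
    unfolding sphere_measure_def by (rule sets_restrict_space_cong) simp
  then show ?thesis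
    using borel_measurable_continuous_on_restrict[OF assms] measurable_cong_sets by blast
qed

lemma emeasure_space_sphere_measure:
  "emeasure sphere_measure (space sphere_measure :: (complex ^ 'n::finite) set) = 1"
proof -
  let ?B = "ball 0 1 :: (complex ^ 'n) set"
  have "emeasure sphere_measure (space sphere_measure :: (complex ^ 'n) set)
      = (\<integral>\<^sup>+\<zeta>. 1 \<partial>(sphere_measure :: (complex ^ 'n) measure))"
    by simp
  also have "\<dots> = (\<integral>\<^sup>+z. indicator (?B - {0}) z \<partial>lborel) / emeasure lborel ?B"
    by (subst nn_integral_sphere_measure) simp_all
  also have "(\<integral>\<^sup>+z. indicator (?B - {0}) z \<partial>lborel) = emeasure lborel (?B - {0})"
    by (rule nn_integral_indicator) simp
  also have "\<dots> = emeasure lborel ?B"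
    by (rule emeasure_Diff_null_set) (simp_all add: null_sets_def)
  also have "\<dots> / emeasure lborel ?B = 1"
    using emeasure_lborel_unit_ball[where 'a = "complex ^ 'n"] by (simp add: ennreal_divide_self top.not_eq_extremum)
  finally show ?thesis .
qed

text \<open>The radial projection \<open>sgn\<close> commutes with unimodular scalars, so the
  invariance of Lebesgue measure passes to the surface measure.\<close>

lemma nn_integral_sphere_measure_smult:
  fixes g :: "complex ^ 'n::finite \<Rightarrow> ennreal"
  assumes w: "cmod w = 1" and [measurable]: "g \<in> borel_measurable borel"
  shows "(\<integral>\<^sup>+\<zeta>. g (w *s \<zeta>) \<partial>sphere_measure) = (\<integral>\<^sup>+\<zeta>. g \<zeta> \<partial>sphere_measure)"
proof -
  have [measurable]: "(\<lambda>z :: complex ^ 'n. w *s z) \<in> borel_measurable borel"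
    by (intro borel_measurable_continuous_onI continuous_intros)
  have "w \<noteq> 0" using w by auto
  then have w0: "w *s z = 0 \<longleftrightarrow> z = 0" for z :: "complex ^ 'n" by (auto simp: vec_eq_iff)
  have sgn: "sgn (w *s z) = w *s sgn z" for z :: "complex ^ 'n"
    by (simp add: sgn_div_norm norm_vector_smult w vec_eq_iff)
  have [measurable]: "ball 0 1 \<in> sets (borel :: (complex ^ 'n) measure)"
    "{0} \<in> sets (borel :: (complex ^ 'n) measure)" by simp_all
  let ?h = "\<lambda>z. g (sgn z) * indicator (ball 0 1 - {0}) z"
  have "(\<integral>\<^sup>+z. g (w *s sgn z) * indicator (ball 0 1 - {0}) z \<partial>lborel) = (\<integral>\<^sup>+z. ?h (w *s z) \<partial>lborel)"
    by (intro nn_integral_cong) (simp add: sgn indicator_def norm_vector_smult w w0 \<open>w \<noteq> 0\<close>)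
  also have "\<dots> = (\<integral>\<^sup>+z. ?h z \<partial>lborel)"
    by (rule nn_integral_lborel_smult[OF w]) measurable
  finally show ?thesis
    by (simp add: nn_integral_sphere_measure)
qed

subsection \<open>Orthogonality of homogeneous parts\<close>

text \<open>Serves twice: with the values of homogeneous functions at a point as coefficients, for
  orthogonality on the sphere, and with the coefficients of a polynomial on a complex line, for a
  mean value inequality.\<close>

lemma roots_of_unity_parseval:
  fixes c :: "nat \<Rightarrow> complex"
  shows "(\<Sum>j<N. (cmod (\<Sum>k<N. c k * cis (2 * pi * real j / real N) ^ k))\<^sup>2)
    = real N * (\<Sum>k<N. (cmod (c k))\<^sup>2)"
proof -
  let ?w = "\<lambda>j. cis (2 * pi * real j / real N)"
  have "complex_of_real (\<Sum>j<N. (cmod (\<Sum>k<N. c k * ?w j ^ k))\<^sup>2)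
      = (\<Sum>j<N. (\<Sum>k<N. c k * ?w j ^ k) * (\<Sum>l<N. cnj (c l) * cnj (?w j) ^ l))"
    by (simp add: complex_norm_square del: of_real_power)
  also have "\<dots> = (\<Sum>j<N. \<Sum>l<N. cnj (c l) * (cnj (?w j) ^ l * (\<Sum>k<N. c k * ?w j ^ k)))"
    unfolding sum_distrib_left[of _ "\<lambda>l. cnj (c l) * cnj (?w _) ^ l"] by (simp add: mult_ac)
  also have "\<dots> = (\<Sum>l<N. cnj (c l) * (\<Sum>j<N. cnj (?w j) ^ l * (\<Sum>k<N. c k * ?w j ^ k)))"
    unfolding sum_distrib_left[of "cnj (c _)"] by (rule sum.swap)
  also have "\<dots> = (\<Sum>l<N. cnj (c l) * (of_nat N * c l))"
    by (intro sum.cong refl) (simp only: roots_of_unity_coeff lessThan_iff)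
  also have "\<dots> = complex_of_real (real N * (\<Sum>k<N. (cmod (c k))\<^sup>2))"
    by (simp add: complex_norm_square sum_distrib_left mult_ac del: of_real_power)
  finally show ?thesis by (simp only: of_real_eq_iff)
qed

text \<open>Real-valued, so an infinite integral would be read as 0;
  \<open>nn_integral_sphere_sq\<close> rules this out for continuous p.\<close>

definition sphere_sq :: "(complex ^ 'n::finite \<Rightarrow> complex) \<Rightarrow> real"
  where "sphere_sq p = enn2real (\<integral>\<^sup>+\<zeta>. ennreal ((cmod (p \<zeta>))\<^sup>2) \<partial>sphere_measure)"

lemma sphere_sq_nonneg [simp]: "sphere_sq p \<ge> 0"
  by (simp add: sphere_sq_def)

lemma nn_integral_sphere_le:
  fixes g :: "complex ^ 'n::finite \<Rightarrow> real"
  assumes "\<And>\<zeta>. norm \<zeta> = 1 \<Longrightarrow> g \<zeta> \<le> M"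
  shows "(\<integral>\<^sup>+\<zeta>. ennreal (g \<zeta>) \<partial>sphere_measure) \<le> ennreal M"
proof -
  have "(\<integral>\<^sup>+\<zeta>. ennreal (g \<zeta>) \<partial>sphere_measure) \<le> (\<integral>\<^sup>+\<zeta>. ennreal M \<partial>(sphere_measure :: (complex ^ 'n) measure))"
    using assms by (intro nn_integral_mono ennreal_leI) (simp add: space_sphere_measure)
  also have "\<dots> = ennreal M" using emeasure_space_sphere_measure[where 'n = 'n] by simp
  finally show ?thesis .
qed

lemma nn_integral_sphere_sq:
  assumes "continuous_on UNIV p"
  shows "(\<integral>\<^sup>+\<zeta>. ennreal ((cmod (p \<zeta>))\<^sup>2) \<partial>sphere_measure) = ennreal (sphere_sq p)"
proof -
  have "compact (p ` sphere 0 1)"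
    by (intro compact_continuous_image continuous_on_subset[OF assms]) auto
  then obtain M where M: "\<And>\<zeta>. norm \<zeta> = 1 \<Longrightarrow> cmod (p \<zeta>) \<le> M"
    using compact_imp_bounded[of "p ` sphere 0 1"] unfolding bounded_iff by force
  have "(\<integral>\<^sup>+\<zeta>. ennreal ((cmod (p \<zeta>))\<^sup>2) \<partial>sphere_measure) \<le> ennreal (M\<^sup>2)"
    by (rule nn_integral_sphere_le) (simp add: M power_mono)
  then show ?thesis
    unfolding sphere_sq_def by (simp add: ennreal_enn2real top.not_eq_extremum order_le_less_trans)
qed

lemma sphere_sq_const: "sphere_sq (\<lambda>z :: complex ^ 'n::finite. c) = (cmod c)\<^sup>2"
  using emeasure_space_sphere_measure[where 'n = 'n] by (simp add: sphere_sq_def)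

lemma borel_measurable_cmod_sq:
  fixes g :: "complex ^ 'n::finite \<Rightarrow> complex"
  assumes "continuous_on UNIV g"
  shows "(\<lambda>\<zeta>. ennreal ((cmod (g \<zeta>))\<^sup>2)) \<in> borel_measurable sphere_measure"
    and "(\<lambda>\<zeta>. ennreal ((cmod (g \<zeta>))\<^sup>2)) \<in> borel_measurable borel"
proof -
  have cont: "continuous_on UNIV (\<lambda>\<zeta>. (cmod (g \<zeta>))\<^sup>2)" by (intro continuous_intros assms)
  show "(\<lambda>\<zeta>. ennreal ((cmod (g \<zeta>))\<^sup>2)) \<in> borel_measurable borel"
    by (rule measurable_compose[OF borel_measurable_continuous_onI[OF cont] measurable_ennreal])
  have "continuous_on (sphere 0 1) (\<lambda>\<zeta>. (cmod (g \<zeta>))\<^sup>2)"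
    by (rule continuous_on_subset[OF cont]) simp
  then show "(\<lambda>\<zeta>. ennreal ((cmod (g \<zeta>))\<^sup>2)) \<in> borel_measurable sphere_measure"
    by (rule measurable_compose[OF borel_measurable_sphere_measure measurable_ennreal])
qed

lemma sphere_sq_cmult:
  assumes "continuous_on UNIV p"
  shows "sphere_sq (\<lambda>z. c * p z) = (cmod c)\<^sup>2 * sphere_sq p"
proof -
  have "(\<integral>\<^sup>+\<zeta>. ennreal ((cmod (c * p \<zeta>))\<^sup>2) \<partial>sphere_measure)
      = (\<integral>\<^sup>+\<zeta>. ennreal ((cmod c)\<^sup>2) * ennreal ((cmod (p \<zeta>))\<^sup>2) \<partial>sphere_measure)"
    by (simp add: norm_mult power_mult_distrib flip: ennreal_mult)
  also have "\<dots> = ennreal ((cmod c)\<^sup>2) * ennreal (sphere_sq p)"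
    unfolding nn_integral_sphere_sq[OF assms, symmetric]
    by (rule nn_integral_cmult[OF borel_measurable_cmod_sq(1)[OF assms]])
  finally show ?thesis unfolding sphere_sq_def
    by (simp add: enn2real_mult flip: sphere_sq_def)
qed

text \<open>Averaging over the rotations by \<open>N\<close>-th roots of unity removes the mixed terms.\<close>

lemma nn_integral_sphere_sum_homogeneous:
  fixes p :: "nat \<Rightarrow> complex ^ 'n::finite \<Rightarrow> complex"
  assumes cont: "\<And>k. continuous_on UNIV (p k)"
    and hom: "\<And>k t z. p k (t *s z) = t ^ k * p k z"
  shows "(\<integral>\<^sup>+\<zeta>. ennreal ((cmod (\<Sum>k<N. p k \<zeta>))\<^sup>2) \<partial>sphere_measure) = ennreal (\<Sum>k<N. sphere_sq (p k))"
proof (cases "N = 0")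
  case False
  let ?w = "\<lambda>j. cis (2 * pi * real j / real N)"
  let ?I = "\<integral>\<^sup>+\<zeta>. ennreal ((cmod (\<Sum>k<N. p k \<zeta>))\<^sup>2) \<partial>sphere_measure"
  have cont_w: "continuous_on UNIV (\<lambda>\<zeta>. \<Sum>k<N. p k (?w j *s \<zeta>))" for j
  proof (rule continuous_on_sum)
    have smult: "continuous_on UNIV (\<lambda>\<zeta> :: complex ^ 'n. ?w j *s \<zeta>)"
      by (rule continuous_on_smult[OF continuous_on_const continuous_on_id])
    show "continuous_on UNIV (\<lambda>\<zeta>. p k (?w j *s \<zeta>))" for k
      by (rule continuous_on_compose2[OF cont smult]) simp
  qed
  have "of_nat N * ?I = (\<Sum>j<N. ?I)" by simp
  also have "\<dots> = (\<Sum>j<N. \<integral>\<^sup>+\<zeta>. ennreal ((cmod (\<Sum>k<N. p k (?w j *s \<zeta>)))\<^sup>2) \<partial>sphere_measure)"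
  proof (rule sum.cong[OF refl])
    fix j
    have "(\<lambda>\<zeta>. ennreal ((cmod (\<Sum>k<N. p k \<zeta>))\<^sup>2)) \<in> borel_measurable borel"
      by (intro borel_measurable_cmod_sq(2) continuous_on_sum cont)
    from nn_integral_sphere_measure_smult[OF norm_cis this, of "2 * pi * real j / real N"]
    show "?I = (\<integral>\<^sup>+\<zeta>. ennreal ((cmod (\<Sum>k<N. p k (?w j *s \<zeta>)))\<^sup>2) \<partial>sphere_measure)" by simp
  qed
  also have "\<dots> = (\<integral>\<^sup>+\<zeta>. (\<Sum>j<N. ennreal ((cmod (\<Sum>k<N. p k (?w j *s \<zeta>)))\<^sup>2)) \<partial>sphere_measure)"
    by (rule nn_integral_sum[symmetric]) (rule borel_measurable_cmod_sq(1)[OF cont_w])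
  also have "\<dots> = (\<integral>\<^sup>+\<zeta>. of_nat N * (\<Sum>k<N. ennreal ((cmod (p k \<zeta>))\<^sup>2)) \<partial>sphere_measure)"
  proof (rule nn_integral_cong)
    fix \<zeta>
    have "(\<Sum>j<N. (cmod (\<Sum>k<N. p k (?w j *s \<zeta>)))\<^sup>2) = real N * (\<Sum>k<N. (cmod (p k \<zeta>))\<^sup>2)"
      using roots_of_unity_parseval[of "\<lambda>k. p k \<zeta>" N] by (simp add: hom mult.commute)
    then show "(\<Sum>j<N. ennreal ((cmod (\<Sum>k<N. p k (?w j *s \<zeta>)))\<^sup>2))
        = of_nat N * (\<Sum>k<N. ennreal ((cmod (p k \<zeta>))\<^sup>2))"
      by (simp add: sum_ennreal ennreal_mult sum_nonneg ennreal_of_nat_eq_real_of_nat)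
  qed
  also have "\<dots> = of_nat N * (\<Sum>k<N. ennreal (sphere_sq (p k)))"
    unfolding nn_integral_sphere_sq[OF cont, symmetric]
    by (subst nn_integral_cmult, intro borel_measurable_sum borel_measurable_cmod_sq cont)
      (subst nn_integral_sum, rule borel_measurable_cmod_sq(1)[OF cont], rule refl)
  also have "\<dots> = of_nat N * ennreal (\<Sum>k<N. sphere_sq (p k))"
    by (simp add: sum_ennreal)
  finally show ?thesis
    using False by (simp add: ennreal_mult_cancel_left ennreal_of_nat_eq_real_of_nat)
qed simp

lemma of_real_smult: "complex_of_real r *s z = r *\<^sub>R (z :: complex ^ 'n)"
  by (simp add: vec_eq_iff complex_eq_iff)

lemma sphere_sq_hpart_0: "sphere_sq (hpart f 0) = (cmod (f 0))\<^sup>2"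
proof -
  have "hpart f 0 = (\<lambda>z. f 0)" by (rule ext) simp
  then show ?thesis by (simp add: sphere_sq_const)
qed

text \<open>For r < 1 the partial sums of the expansion are uniformly bounded on the sphere of
  radius r, so orthogonality for finite sums passes to the limit by dominated convergence with a
  constant majorant.\<close>

lemma nn_integral_sphere_dilation:
  assumes hol: "holomorphic_n_on f (ball 0 1)" and r: "0 < r" "r < 1"
  shows "(\<integral>\<^sup>+\<zeta>. ennreal ((cmod (f (r *\<^sub>R \<zeta>)))\<^sup>2) \<partial>sphere_measure)
    = (\<Sum>k. ennreal (r ^ (2 * k) * sphere_sq (hpart f k)))"
proof -
  define p where "p = (\<lambda>k z. complex_of_real (r ^ k) * hpart f k z)"
  have cont: "continuous_on UNIV (p k)" for k
    unfolding p_def by (intro continuous_on_mult continuous_on_const continuous_on_hpart[OF hol])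
  have hom: "p k (t *s z) = t ^ k * p k z" for k t z
    by (simp add: p_def hpart_smult[OF hol])
  have sq: "sphere_sq (p k) = r ^ (2 * k) * sphere_sq (hpart f k)" for k
    unfolding p_def sphere_sq_cmult[OF continuous_on_hpart[OF hol]] using r
    by (simp add: power_mult mult.commute[of 2] norm_power)
  \<comment> \<open>Any radius strictly between r and 1 yields a geometric majorant of ratio r / R,
    whose sum is \<open>L\<close>.\<close>
  define R where "R = (1 + r) / 2"
  have R: "r < R" "R < 1" "0 < R" using r by (auto simp: R_def)
  obtain M where M: "M \<ge> 0" "\<And>k z. cmod (hpart f k z) \<le> M * (norm z / R) ^ k"
    using hpart_bound_ex[OF hol R(3,2)] by auto
  define L where "L = M * (1 / (1 - r / R))"
  have bound: "cmod (\<Sum>k<N. p k \<zeta>) \<le> L" if "norm \<zeta> = 1" for N \<zeta>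
  proof -
    have "cmod (\<Sum>k<N. p k \<zeta>) \<le> (\<Sum>k<N. M * (r / R) ^ k)"
    proof (rule sum_norm_le)
      fix k
      have "cmod (p k \<zeta>) = r ^ k * cmod (hpart f k \<zeta>)" using r by (simp add: p_def norm_mult norm_power)
      also have "\<dots> \<le> r ^ k * (M * (norm \<zeta> / R) ^ k)" using r by (intro mult_left_mono M(2)) auto
      also have "\<dots> = M * (r / R) ^ k" by (simp add: that power_divide)
      finally show "cmod (p k \<zeta>) \<le> M * (r / R) ^ k" .
    qed
    also have "\<dots> \<le> (\<Sum>k. M * (r / R) ^ k)"
      using r R M(1) by (intro sum_le_suminf summable_mult summable_geometric) auto
    also have "\<dots> = L"
      using r R unfolding L_def by (subst suminf_mult) (auto simp: suminf_geometric summable_geometric)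
    finally show ?thesis .
  qed
  have lim: "(\<lambda>N. \<Sum>k<N. p k \<zeta>) \<longlonglongrightarrow> f (r *\<^sub>R \<zeta>)" if "norm \<zeta> = 1" for \<zeta>
    using hpart_sums_slice[OF hol, of "complex_of_real r" \<zeta>] r that
    by (simp add: sums_def p_def of_real_smult mult.commute)
  have "(\<lambda>N. \<integral>\<^sup>+\<zeta>. ennreal ((cmod (\<Sum>k<N. p k \<zeta>))\<^sup>2) \<partial>sphere_measure)
      \<longlonglongrightarrow> (\<integral>\<^sup>+\<zeta>. ennreal ((cmod (f (r *\<^sub>R \<zeta>)))\<^sup>2) \<partial>sphere_measure)"
  proof (rule nn_integral_dominated_convergence[where w = "\<lambda>_. ennreal (L\<^sup>2)"])
    show "(\<lambda>\<zeta>. ennreal ((cmod (\<Sum>k<N. p k \<zeta>))\<^sup>2)) \<in> borel_measurable sphere_measure" for N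
      by (intro borel_measurable_cmod_sq continuous_on_sum cont)
    have "continuous_on (sphere 0 1) (\<lambda>\<zeta>. f (r *\<^sub>R \<zeta>))"
      by (rule continuous_on_compose2[OF holomorphic_n_on_imp_continuous_on[OF hol]])
        (use r in \<open>auto intro: continuous_intros\<close>)
    then have "continuous_on (sphere 0 1) (\<lambda>\<zeta>. (cmod (f (r *\<^sub>R \<zeta>)))\<^sup>2)"
      by (intro continuous_on_power continuous_on_norm)
    then show "(\<lambda>\<zeta>. ennreal ((cmod (f (r *\<^sub>R \<zeta>)))\<^sup>2)) \<in> borel_measurable sphere_measure"
      by (rule measurable_compose[OF borel_measurable_sphere_measure measurable_ennreal])
    show "AE \<zeta> in sphere_measure. ennreal ((cmod (\<Sum>k<N. p k \<zeta>))\<^sup>2) \<le> ennreal (L\<^sup>2)" for N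
      by (rule AE_I2) (auto simp: space_sphere_measure intro!: ennreal_leI power_mono bound)
    show "(\<integral>\<^sup>+\<zeta>. ennreal (L\<^sup>2) \<partial>(sphere_measure :: (complex ^ 'a) measure)) < \<infinity>"
      using nn_integral_sphere_le[of "\<lambda>_ :: complex ^ 'a. L\<^sup>2" "L\<^sup>2"]
      by (simp add: order_le_less_trans)
    show "AE \<zeta> in sphere_measure. (\<lambda>N. ennreal ((cmod (\<Sum>k<N. p k \<zeta>))\<^sup>2))
        \<longlonglongrightarrow> ennreal ((cmod (f (r *\<^sub>R \<zeta>)))\<^sup>2)"
      by (rule AE_I2) (auto simp: space_sphere_measure intro!: tendsto_intros lim)
  qed simp
  moreover have "(\<integral>\<^sup>+\<zeta>. ennreal ((cmod (\<Sum>k<N. p k \<zeta>))\<^sup>2) \<partial>sphere_measure)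
      = (\<Sum>k<N. ennreal (r ^ (2 * k) * sphere_sq (hpart f k)))" for N
    unfolding nn_integral_sphere_sum_homogeneous[OF cont hom] sq using r by (simp add: sum_ennreal)
  moreover have "(\<lambda>N. \<Sum>k<N. ennreal (r ^ (2 * k) * sphere_sq (hpart f k)))
      \<longlonglongrightarrow> (\<Sum>k. ennreal (r ^ (2 * k) * sphere_sq (hpart f k)))"
    by (intro summable_LIMSEQ summableI)
  ultimately show ?thesis by (auto intro: LIMSEQ_unique)
qed

text \<open>The supremum is at most the series, since r < 1 only shrinks the terms. Conversely each
  finite partial sum is a limit for r tending to 1, so only finite sums have to pass to the
  limit.\<close>

lemma hardy_norm_sq_eq:
  assumes hol: "holomorphic_n_on f (ball 0 1)"
  shows "hardy_norm_sq f = (\<Sum>k. ennreal (sphere_sq (hpart f k)))"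
proof (rule antisym)
  have eq: "hardy_norm_sq f = (SUP r\<in>{0<..<1}. \<Sum>k. ennreal (r ^ (2 * k) * sphere_sq (hpart f k)))"
    unfolding hardy_norm_sq_def
    by (intro SUP_cong refl) (simp add: nn_integral_sphere_dilation[OF hol])
  show "hardy_norm_sq f \<le> (\<Sum>k. ennreal (sphere_sq (hpart f k)))"
    unfolding eq
    by (intro SUP_least suminf_le summableI ennreal_leI) (auto intro!: mult_left_le_one_le power_le_one)
  show "(\<Sum>k. ennreal (sphere_sq (hpart f k))) \<le> hardy_norm_sq f"
    unfolding suminf_eq_SUP
  proof (rule SUP_least)
    fix N
    \<comment> \<open>The shift by 2 keeps \<open>r m\<close> positive at m = 0.\<close>
    define r where "r = (\<lambda>m::nat. 1 - 1 / (real m + 2))"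
    have r: "0 < r m" "r m < 1" for m by (auto simp: r_def field_simps)
    have "r \<longlonglongrightarrow> 1" unfolding r_def by real_asymp
    then have "(\<lambda>m. \<Sum>k<N. r m ^ (2 * k) * sphere_sq (hpart f k)) \<longlonglongrightarrow> (\<Sum>k<N. 1 ^ (2 * k) * sphere_sq (hpart f k))"
      by (intro tendsto_intros)
    then have "(\<lambda>m. ennreal (\<Sum>k<N. r m ^ (2 * k) * sphere_sq (hpart f k)))
        \<longlonglongrightarrow> ennreal (\<Sum>k<N. 1 ^ (2 * k) * sphere_sq (hpart f k))"
      by (rule tendsto_ennrealI)
    then have "ennreal (\<Sum>k<N. 1 ^ (2 * k) * sphere_sq (hpart f k)) \<le> hardy_norm_sq f"
    proof (rule LIMSEQ_le_const2, intro exI allI impI)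
      fix m
      have "ennreal (\<Sum>k<N. r m ^ (2 * k) * sphere_sq (hpart f k))
          = (\<Sum>k<N. ennreal (r m ^ (2 * k) * sphere_sq (hpart f k)))"
        using r[of m] by (simp add: sum_ennreal)
      also have "\<dots> \<le> (\<Sum>k. ennreal (r m ^ (2 * k) * sphere_sq (hpart f k)))"
        by (rule sum_le_suminf) auto
      also have "\<dots> \<le> hardy_norm_sq f"
        unfolding eq by (rule SUP_upper) (use r[of m] in auto)
      finally show "ennreal (\<Sum>k<N. r m ^ (2 * k) * sphere_sq (hpart f k)) \<le> hardy_norm_sq f" .
    qed
    then show "(\<Sum>k<N. ennreal (sphere_sq (hpart f k))) \<le> hardy_norm_sq f"
      by (simp add: sum_ennreal)
  qed
qed

lemma hardy_norm_sq_bounded_mult: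
  assumes bound: "\<And>z. z \<in> ball 0 1 \<Longrightarrow> cmod (h z) \<le> B" and "B \<ge> 0"
    and hol: "holomorphic_n_on f (ball 0 1)"
  shows "hardy_norm_sq (\<lambda>z. h z * f z) \<le> ennreal (B\<^sup>2) * hardy_norm_sq f"
  unfolding hardy_norm_sq_def
proof (rule SUP_least)
  fix r :: real assume r: "r \<in> {0<..<1}"
  have "continuous_on (sphere 0 1) (\<lambda>\<zeta>. f (r *\<^sub>R \<zeta>))"
    by (rule continuous_on_compose2[OF holomorphic_n_on_imp_continuous_on[OF hol]])
      (use r in \<open>auto intro: continuous_intros\<close>)
  then have "continuous_on (sphere 0 1) (\<lambda>\<zeta>. (cmod (f (r *\<^sub>R \<zeta>)))\<^sup>2)"
    by (intro continuous_on_power continuous_on_norm)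
  then have meas: "(\<lambda>\<zeta>. ennreal ((cmod (f (r *\<^sub>R \<zeta>)))\<^sup>2)) \<in> borel_measurable sphere_measure"
    by (rule measurable_compose[OF borel_measurable_sphere_measure measurable_ennreal])
  have "(\<integral>\<^sup>+\<zeta>. ennreal ((cmod (h (r *\<^sub>R \<zeta>) * f (r *\<^sub>R \<zeta>)))\<^sup>2) \<partial>sphere_measure)
      \<le> (\<integral>\<^sup>+\<zeta>. ennreal (B\<^sup>2) * ennreal ((cmod (f (r *\<^sub>R \<zeta>)))\<^sup>2) \<partial>sphere_measure)"
  proof (rule nn_integral_mono)
    fix \<zeta> :: "complex ^ 'a" assume "\<zeta> \<in> space sphere_measure"
    then have "cmod (h (r *\<^sub>R \<zeta>)) \<le> B" using r by (intro bound) (simp add: space_sphere_measure)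
    then show "ennreal ((cmod (h (r *\<^sub>R \<zeta>) * f (r *\<^sub>R \<zeta>)))\<^sup>2)
        \<le> ennreal (B\<^sup>2) * ennreal ((cmod (f (r *\<^sub>R \<zeta>)))\<^sup>2)"
      unfolding ennreal_mult[OF zero_le_power2 zero_le_power2, symmetric] norm_mult power_mult_distrib
      by (intro ennreal_leI mult_right_mono power_mono) auto
  qed
  also have "\<dots> = ennreal (B\<^sup>2) * (\<integral>\<^sup>+\<zeta>. ennreal ((cmod (f (r *\<^sub>R \<zeta>)))\<^sup>2) \<partial>sphere_measure)"
    by (rule nn_integral_cmult[OF meas])
  also have "\<dots> \<le> ennreal (B\<^sup>2) * (SUP r\<in>{0<..<1}. \<integral>\<^sup>+\<zeta>. ennreal ((cmod (f (r *\<^sub>R \<zeta>)))\<^sup>2) \<partial>sphere_measure)"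
    by (intro mult_left_mono SUP_upper r) simp
  finally show "(\<integral>\<^sup>+\<zeta>. ennreal ((cmod (h (r *\<^sub>R \<zeta>) * f (r *\<^sub>R \<zeta>)))\<^sup>2) \<partial>sphere_measure) \<le> \<dots>" .
qed

subsection \<open>Point evaluation\<close>

text \<open>In the punctured ball homogeneity gives |p(z)| \<le> |p(sgn z)|, and the integral of the
  squared right-hand side over it is, by construction of the surface measure, the sphere integral
  times the volume. No integration in polar coordinates occurs.\<close>

lemma nn_integral_ball_le_sphere_sq:
  fixes p :: "complex ^ 'n::finite \<Rightarrow> complex"
  assumes cont: "continuous_on UNIV p" and hom: "\<And>t z. p (t *s z) = t ^ k * p z"
  shows "(\<integral>\<^sup>+z. ennreal ((cmod (p z))\<^sup>2) * indicator (ball 0 1) z \<partial>lborel)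
    \<le> ennreal (sphere_sq p) * emeasure lborel (ball 0 1 :: (complex ^ 'n) set)"
proof -
  let ?B = "ball 0 1 :: (complex ^ 'n) set"
  have "(\<integral>\<^sup>+z. ennreal ((cmod (p z))\<^sup>2) * indicator ?B z \<partial>lborel)
      = (\<integral>\<^sup>+z. ennreal ((cmod (p z))\<^sup>2) * indicator (?B - {0}) z \<partial>lborel)"
  proof (rule nn_integral_cong_AE)
    have "AE z in lborel. z \<noteq> (0 :: complex ^ 'n)" by (rule AE_lborel_singleton)
    then show "AE z in lborel. ennreal ((cmod (p z))\<^sup>2) * indicator ?B z
        = ennreal ((cmod (p z))\<^sup>2) * indicator (?B - {0}) z"
      by eventually_elim (simp add: indicator_def)
  qed
  also have "\<dots> \<le> (\<integral>\<^sup>+z. ennreal ((cmod (p (sgn z)))\<^sup>2) * indicator (?B - {0}) z \<partial>lborel)"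
  proof (rule nn_integral_mono)
    fix z :: "complex ^ 'n"
    have "cmod (p z) \<le> cmod (p (sgn z))" if "z \<in> ?B - {0}"
    proof -
      have "z = complex_of_real (norm z) *s sgn z" using that by (simp add: of_real_smult sgn_div_norm)
      then have "p z = complex_of_real (norm z) ^ k * p (sgn z)" by (metis hom)
      then have "cmod (p z) = norm z ^ k * cmod (p (sgn z))" by (simp add: norm_mult norm_power)
      then show ?thesis using that by (simp add: mult_left_le_one_le power_le_one)
    qed
    then show "ennreal ((cmod (p z))\<^sup>2) * indicator (?B - {0}) z
        \<le> ennreal ((cmod (p (sgn z)))\<^sup>2) * indicator (?B - {0}) z"
      by (auto simp: indicator_def intro!: ennreal_leI power_mono)
  qed
  also have "\<dots> = ennreal (sphere_sq p) * emeasure lborel ?B"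
    unfolding nn_integral_sphere_sq[OF cont, symmetric]
      nn_integral_sphere_measure[OF borel_measurable_cmod_sq(2)[OF cont]]
    using emeasure_lborel_unit_ball[where 'a = "complex ^ 'n"]
    by (simp add: ennreal_divide_times ennreal_divide_self top.not_eq_extremum)
  finally show ?thesis .
qed

text \<open>Mean value inequality for the squared modulus over the ball of radius 1 - norm z around
  z, then comparison with the unit ball. Rotating the offset w by roots of unity reduces it to
  Parseval for the polynomial t -> p(z + t w), whose constant term is p(z).\<close>

lemma hpart_le_sphere_sq:
  fixes f :: "complex ^ 'n::finite \<Rightarrow> complex"
  assumes hol: "holomorphic_n_on f (ball 0 1)" and z: "norm z < 1"
  shows "(cmod (hpart f k z))\<^sup>2 * (1 - norm z) ^ DIM(complex ^ 'n) \<le> sphere_sq (hpart f k)"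
proof -
  \<comment> \<open>On a line the part has degree at most k, so k + 1 roots of unity
    suffice.\<close>
  let ?p = "hpart f k" and ?N = "Suc k" and ?\<rho> = "1 - norm z" and ?D = "DIM(complex ^ 'n)"
  let ?B = "ball 0 1 :: (complex ^ 'n) set" and ?v = "unit_ball_vol (DIM(complex ^ 'n))"
  let ?w = "\<lambda>j. cis (2 * pi * real j / real ?N)"
  define h where "h = (\<lambda>w. ennreal ((cmod (?p (z + w)))\<^sup>2) * indicator (ball 0 ?\<rho>) w)"
  have cont: "continuous_on UNIV ?p" by (rule continuous_on_hpart[OF hol])
  have "continuous_on UNIV (\<lambda>w. ?p (z + w))"
    by (rule continuous_on_compose2[OF cont]) (auto intro: continuous_intros)
  note [measurable] = borel_measurable_cmod_sq(2)[OF this] borel_measurable_cmod_sq(2)[OF cont]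
  have [measurable]: "ball 0 r \<in> sets (borel :: (complex ^ 'n) measure)" for r by simp
  have h: "h \<in> borel_measurable borel"
    unfolding h_def by measurable
  have hw: "(\<lambda>w. h (?w j *s w)) \<in> borel_measurable borel" for j
    by (rule measurable_compose[OF _ h])
      (intro borel_measurable_continuous_onI continuous_on_smult continuous_on_const continuous_on_id)
  have "of_nat ?N * (ennreal ((cmod (?p z))\<^sup>2) * emeasure lborel (ball (0 :: complex ^ 'n) ?\<rho>))
      = (\<integral>\<^sup>+w. of_nat ?N * ennreal ((cmod (?p z))\<^sup>2) * indicator (ball (0 :: complex ^ 'n) ?\<rho>) w \<partial>lborel)"
    by (subst nn_integral_cmult_indicator) (simp_all add: mult.assoc)
  also have "\<dots> \<le> (\<integral>\<^sup>+w. (\<Sum>j<?N. h (?w j *s w)) \<partial>lborel)"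
  proof (rule nn_integral_mono)
    fix w :: "complex ^ 'n"
    obtain c where "\<And>t. ?p (z + t *s w) = (\<Sum>e\<le>k. c e * t ^ e)"
      using hpart_line_polynomial[OF hol] by blast
    then have c: "?p (z + t *s w) = (\<Sum>e<?N. c e * t ^ e)" for t
      by (simp add: lessThan_Suc_atMost)
    have "?p z = c 0" using c[of 0] unfolding sum.lessThan_Suc_shift by simp
    moreover have "(cmod (c 0))\<^sup>2 \<le> (\<Sum>e<?N. (cmod (c e))\<^sup>2)"
      by (rule member_le_sum) simp_all
    ultimately have "real ?N * (cmod (?p z))\<^sup>2 \<le> real ?N * (\<Sum>e<?N. (cmod (c e))\<^sup>2)"
      by (intro mult_left_mono) simp_all
    also have "\<dots> = (\<Sum>j<?N. (cmod (?p (z + ?w j *s w)))\<^sup>2)"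
      unfolding roots_of_unity_parseval[symmetric] c ..
    finally have "ennreal (real ?N * (cmod (?p z))\<^sup>2) \<le> ennreal (\<Sum>j<?N. (cmod (?p (z + ?w j *s w)))\<^sup>2)"
      by (rule ennreal_leI)
    then have "of_nat ?N * ennreal ((cmod (?p z))\<^sup>2) \<le> (\<Sum>j<?N. ennreal ((cmod (?p (z + ?w j *s w)))\<^sup>2))"
      by (simp only: sum_ennreal zero_le_power2 ennreal_mult' of_nat_0_le_iff ennreal_of_nat_eq_real_of_nat)
    then show "of_nat ?N * ennreal ((cmod (?p z))\<^sup>2) * indicator (ball 0 ?\<rho>) w \<le> (\<Sum>j<?N. h (?w j *s w))"
      by (simp only: h_def indicator_def mem_ball_0 norm_vector_smult norm_cis mult_1_left)
        (simp split: if_splits)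
  qed
  also have "\<dots> = (\<Sum>j<?N. \<integral>\<^sup>+w. h (?w j *s w) \<partial>lborel)"
    by (rule nn_integral_sum) (use hw in simp)
  also have "\<dots> = (\<Sum>j<?N. \<integral>\<^sup>+w. h w \<partial>lborel)"
    by (intro sum.cong refl nn_integral_lborel_smult[OF norm_cis h])
  also have "\<dots> = of_nat ?N * (\<integral>\<^sup>+w. h w \<partial>lborel)" by simp
  also have "(\<integral>\<^sup>+w. h w \<partial>lborel)
      \<le> (\<integral>\<^sup>+w. ennreal ((cmod (?p (z + w)))\<^sup>2) * indicator ?B (z + w) \<partial>lborel)"
  proof (rule nn_integral_mono)
    fix w :: "complex ^ 'n"
    show "h w \<le> ennreal ((cmod (?p (z + w)))\<^sup>2) * indicator ?B (z + w)"
      using norm_triangle_ineq[of z w] by (auto simp: h_def indicator_def)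
  qed
  also have "\<dots> = (\<integral>\<^sup>+w. ennreal ((cmod (?p w))\<^sup>2) * indicator ?B w \<partial>lborel)"
    by (rule nn_integral_lborel_translate) measurable
  also have "\<dots> \<le> ennreal (sphere_sq ?p) * emeasure lborel ?B"
    by (rule nn_integral_ball_le_sphere_sq[OF cont hpart_smult[OF hol]])
  finally have "of_nat ?N * (ennreal ((cmod (?p z))\<^sup>2) * emeasure lborel (ball (0 :: complex ^ 'n) ?\<rho>))
      \<le> of_nat ?N * (ennreal (sphere_sq ?p) * emeasure lborel ?B)"
    by (simp add: mult_left_mono)
  then have "ennreal (real ?N * ((cmod (?p z))\<^sup>2 * (?v * ?\<rho> ^ ?D))) \<le> ennreal (real ?N * (sphere_sq ?p * ?v))"
    using z by (simp add: emeasure_ball ennreal_of_nat_eq_real_of_nat del: of_nat_Suc flip: ennreal_mult)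
  then have "real ?N * ((cmod (?p z))\<^sup>2 * (?v * ?\<rho> ^ ?D)) \<le> real ?N * (sphere_sq ?p * ?v)"
    by (subst (asm) ennreal_le_iff) auto
  then have "((cmod (?p z))\<^sup>2 * ?\<rho> ^ ?D) * ?v \<le> sphere_sq ?p * ?v"
    by (simp add: mult_ac del: of_nat_Suc)
  then show ?thesis
    using unit_ball_vol_pos[of ?D] by (simp del: unit_ball_vol_pos)
qed

text \<open>The previous bound is applied not at z but at a dilated point of norm at most R < 1, and
  homogeneity brings back the factor (s / R)^k. This geometric gain absorbs every power weight of k
  in \<open>sob_sq_point_bound\<close>.\<close>

lemma hpart_point_bound:
  assumes s: "0 < s" "s < 1"
  shows "\<exists>C q. C \<ge> 0 \<and> 0 < q \<and> q < 1 \<and>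
    (\<forall>(f :: complex ^ 'n::finite \<Rightarrow> complex) k z. holomorphic_n_on f (ball 0 1) \<longrightarrow> norm z \<le> s \<longrightarrow>
      cmod (hpart f k z) \<le> C * q ^ k * sqrt (sphere_sq (hpart f k)))"
proof -
  define R where "R = (1 + s) / 2"
  have R: "s < R" "R < 1" "0 < R" using s by (auto simp: R_def)
  define C where "C = 1 / sqrt ((1 - R) ^ DIM(complex ^ 'n))"
  have "cmod (hpart f k z) \<le> C * (s / R) ^ k * sqrt (sphere_sq (hpart f k))"
    if hol: "holomorphic_n_on f (ball 0 1)" and z: "norm z \<le> s" for f :: "complex ^ 'n \<Rightarrow> complex" and k z
  proof -
    let ?y = "complex_of_real (R / s) *s z"
    have y: "norm ?y \<le> R" "norm ?y < 1"
    proof -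
      have "R * norm z \<le> R * s" using z R by (intro mult_left_mono) auto
      then show "norm ?y \<le> R" using s R by (simp add: norm_vector_smult norm_divide field_simps)
      then show "norm ?y < 1" using R by simp
    qed
    have "(cmod (hpart f k ?y))\<^sup>2 * (1 - R) ^ DIM(complex ^ 'n)
        \<le> (cmod (hpart f k ?y))\<^sup>2 * (1 - norm ?y) ^ DIM(complex ^ 'n)"
      using y R by (intro mult_left_mono power_mono) auto
    also have "\<dots> \<le> sphere_sq (hpart f k)" by (rule hpart_le_sphere_sq[OF hol y(2)])
    finally have "sqrt ((cmod (hpart f k ?y))\<^sup>2 * (1 - R) ^ DIM(complex ^ 'n)) \<le> sqrt (sphere_sq (hpart f k))"
      by (rule real_sqrt_le_mono)
    then have *: "cmod (hpart f k ?y) \<le> C * sqrt (sphere_sq (hpart f k))"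
      using R by (simp add: real_sqrt_mult C_def field_simps)
    have "z = complex_of_real (s / R) *s ?y" using s R by (simp add: vec_eq_iff)
    then have "hpart f k z = complex_of_real (s / R) ^ k * hpart f k ?y"
      using hpart_smult[OF hol] by metis
    then have "cmod (hpart f k z) = (s / R) ^ k * cmod (hpart f k ?y)"
      using s R by (simp add: norm_mult norm_power norm_divide)
    also have "\<dots> \<le> (s / R) ^ k * (C * sqrt (sphere_sq (hpart f k)))"
      using s R * by (intro mult_left_mono) auto
    finally show ?thesis by (simp add: mult_ac)
  qed
  moreover have "C \<ge> 0" "0 < s / R" "s / R < 1" using s R by (auto simp: C_def)
  ultimately show ?thesis by blast
qed

subsection \<open>Hardy-Sobolev norms in terms of homogeneous parts\<close>

lemma holomorphic_n_on_series:
  fixes F :: "nat \<Rightarrow> complex ^ 'n::finite \<Rightarrow> complex"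
  assumes hol: "\<And>k. holomorphic_n_on (F k) (ball 0 1)"
    and bound: "\<And>s. 0 < s \<Longrightarrow> s < 1 \<Longrightarrow> \<exists>b. summable b \<and> (\<forall>k z. norm z \<le> s \<longrightarrow> cmod (F k z) \<le> b k)"
    and sums: "\<And>z. z \<in> ball 0 1 \<Longrightarrow> (\<lambda>k. F k z) sums g z"
  shows "holomorphic_n_on g (ball 0 1)"
proof (rule holomorphic_n_on_uniform_limit[where g = "\<lambda>n z. \<Sum>k<n. F k z"])
  show "holomorphic_n_on (\<lambda>z. \<Sum>k<n. F k z) (ball 0 1)" for n
    by (intro holomorphic_n_on_sum hol)
  fix z :: "complex ^ 'n" assume z: "z \<in> ball 0 1"
  define s where "s = (1 + norm z) / 2"
  have s: "0 < s" "s < 1" "s - norm z > 0" using z by (auto simp: s_def add_pos_nonneg)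
  have sub: "ball z (s - norm z) \<subseteq> cball 0 s"
  proof
    fix y assume "y \<in> ball z (s - norm z)"
    then show "y \<in> cball 0 s"
      using norm_triangle_sub[of y z] by (simp add: dist_norm norm_minus_commute)
  qed
  obtain b where b: "summable b" "\<And>k z. norm z \<le> s \<Longrightarrow> cmod (F k z) \<le> b k"
    using bound[OF s(1,2)] by blast
  have "uniform_limit (ball z (s - norm z)) (\<lambda>n z. \<Sum>k<n. F k z) (\<lambda>z. \<Sum>k. F k z) sequentially"
    by (rule Weierstrass_m_test[OF _ b(1)]) (use b(2) sub in force)
  moreover have "(\<Sum>k. F k y) = g y" if "y \<in> ball z (s - norm z)" for y
  proof -
    have "norm y \<le> s" using that sub by force
    then show ?thesis using sums[of y] s by (simp add: sums_iff)
  qed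
  ultimately have "uniform_limit (ball z (s - norm z)) (\<lambda>n z. \<Sum>k<n. F k z) g sequentially"
    using uniform_limit_cong'[of "ball z (s - norm z)" "\<lambda>n z. \<Sum>k<n. F k z" "\<lambda>n z. \<Sum>k<n. F k z"
        "\<lambda>z. \<Sum>k. F k z" g] by simp
  moreover have "ball z (s - norm z) \<subseteq> ball 0 1" using sub s by force
  ultimately show "\<exists>d>0. ball z d \<subseteq> ball 0 1 \<and> uniform_limit (ball z d) (\<lambda>n z. \<Sum>k<n. F k z) g sequentially"
    using s(3) by blast
qed simp

lemma summable_powr_geometric:
  assumes q: "0 < q" "q < 1"
  shows "summable (\<lambda>k. real k powr a * q ^ k)"
proof (rule summable_comparison_test_bigo)
  \<comment> \<open>Half of the exponential decay of q absorbs the power of k; the other half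
    remains as convergent majorant.\<close>
  define c where "c = - ln q / 2"
  have c: "c > 0" "q = exp (- 2 * c)" using q by (simp_all add: c_def)
  have "exp (- c) < 1" using c by simp
  then show "summable (\<lambda>k. norm (exp (- c) ^ k))"
    by (simp add: summable_geometric norm_power)
  have "(\<lambda>k. real k powr a * exp (- 2 * c * real k)) \<in> O(\<lambda>k. exp (- c * real k))"
    using c(1) by real_asymp
  then show "(\<lambda>k. real k powr a * q ^ k) \<in> O(\<lambda>k. exp (- c) ^ k)"
    by (simp add: c(2) mult_ac flip: exp_of_nat_mult)
qed

lemma radial_power_series:
  fixes f :: "complex ^ 'n::finite \<Rightarrow> complex"
  assumes hol: "holomorphic_n_on f (ball 0 1)" and s: "0 < s" "s < 1"
  shows "\<exists>b. summable b \<and> (\<forall>k z. norm z \<le> s \<longrightarrow> cmod (complex_of_real (real k powr \<beta>) * hpart f k z) \<le> b k)"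
proof -
  define R where "R = (1 + s) / 2"
  have R: "s < R" "R < 1" "0 < R" using s by (auto simp: R_def)
  obtain M where M: "M \<ge> 0" "\<And>k z. cmod (hpart f k z) \<le> M * (norm z / R) ^ k"
    using hpart_bound_ex[OF hol R(3,2)] by auto
  have "summable (\<lambda>k. M * (real k powr \<beta> * (s / R) ^ k))"
    using s R by (intro summable_mult summable_powr_geometric) auto
  moreover have "cmod (complex_of_real (real k powr \<beta>) * hpart f k z) \<le> M * (real k powr \<beta> * (s / R) ^ k)"
    if "norm z \<le> s" for k z
  proof -
    have "cmod (complex_of_real (real k powr \<beta>) * hpart f k z) \<le> real k powr \<beta> * (M * (norm z / R) ^ k)"
      unfolding norm_mult by (simp add: mult_left_mono M(2))
    also have "\<dots> \<le> real k powr \<beta> * (M * (s / R) ^ k)"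
      using that R M(1) by (intro mult_left_mono power_mono divide_right_mono) auto
    finally show ?thesis by (simp add: mult_ac)
  qed
  ultimately show ?thesis by blast
qed

text \<open>The defining series starts at degree 1, this one at 0: \<open>0 powr \<beta> = 0\<close>
  for every exponent, including 0, so the constant term does not contribute.\<close>

lemma radial_power_sums:
  assumes hol: "holomorphic_n_on f (ball 0 1)" and z: "z \<in> ball 0 1"
  shows "(\<lambda>k. complex_of_real (real k powr \<beta>) * hpart f k z) sums radial_power \<beta> f z"
proof -
  define s where "s = (1 + norm z) / 2"
  have s: "0 < s" "s < 1" "norm z \<le> s" using z by (auto simp: s_def add_pos_nonneg)
  obtain b where b: "summable b"
    "\<And>k. cmod (complex_of_real (real k powr \<beta>) * hpart f k z) \<le> b k"
    using radial_power_series[OF hol s(1,2), of \<beta>] s(3) by blast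
  have "summable (\<lambda>k. complex_of_real (real k powr \<beta>) * hpart f k z)"
    by (rule summable_comparison_test'[OF b(1), of 0]) (rule b(2))
  then have "summable (\<lambda>k. complex_of_real (real (Suc k) powr \<beta>) * hpart f (Suc k) z)"
    by (rule summable_Suc_iff[THEN iffD2])
  then have "(\<lambda>k. complex_of_real (real (Suc k) powr \<beta>) * hpart f (Suc k) z) sums radial_power \<beta> f z"
    using z unfolding radial_power_def homogeneous_part_eq_hpart[OF hol] by (simp add: summable_sums)
  from sums_Suc[OF this] show ?thesis by simp
qed

lemma radial_power_holomorphic:
  assumes "holomorphic_n_on f (ball 0 1)"
  shows "holomorphic_n_on (radial_power \<beta> f) (ball 0 1)"
  by (rule holomorphic_n_on_series[OF holomorphic_n_on_cmult[OF hpart_holomorphic[OF assms]]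
        radial_power_series[OF assms] radial_power_sums[OF assms]])

lemma hpart_radial_power:
  assumes "holomorphic_n_on f (ball 0 1)"
  shows "hpart (radial_power \<beta> f) k z = complex_of_real (real k powr \<beta>) * hpart f k z"
  by (rule hpart_unique[where F = "\<lambda>k z. complex_of_real (real k powr \<beta>) * hpart f k z"])
    (simp_all add: radial_power_sums assms hpart_smult)

lemma sphere_sq_hpart_radial_power:
  assumes "holomorphic_n_on f (ball 0 1)"
  shows "sphere_sq (hpart (radial_power \<beta> f) k) = real k powr (2 * \<beta>) * sphere_sq (hpart f k)"
proof -
  have "hpart (radial_power \<beta> f) k = (\<lambda>z. complex_of_real (real k powr \<beta>) * hpart f k z)"
    by (rule ext) (rule hpart_radial_power[OF assms])
  then show ?thesis
    by (simp add: sphere_sq_cmult continuous_on_hpart assms powr_add flip: power2_eq_square)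
      (simp add: power2_eq_square flip: powr_add)
qed

text \<open>
  The weight \<open>max 1 k\<close> accounts for the separate treatment of \<open>f(0)\<close> in the Hardy-Sobolev norm.
\<close>

definition sob_weight :: "real \<Rightarrow> nat \<Rightarrow> real"
  where "sob_weight \<beta> k = real (max 1 k) powr (2 * \<beta>)"

text \<open>Extended-valued, so that finiteness expresses membership and operator bounds can be
  stated for all holomorphic functions before a product is known to lie in the space.\<close>

definition sob_sq :: "real \<Rightarrow> (complex ^ 'n::finite \<Rightarrow> complex) \<Rightarrow> ennreal"
  where "sob_sq \<beta> f = (\<Sum>k. ennreal (sob_weight \<beta> k * sphere_sq (hpart f k)))"

lemma sob_weight_pos [simp]: "sob_weight \<beta> k > 0"
  by (simp add: sob_weight_def)

lemma sob_weight_nonneg [simp]: "sob_weight \<beta> k \<ge> 0"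
  by (simp add: less_imp_le)

lemma sob_weight_0 [simp]: "sob_weight \<beta> 0 = 1" "sob_weight 0 k = 1"
  by (simp_all add: sob_weight_def)

text \<open>Orders add under radial powers, except that these kill constants, which the first
  summand restores. The case \<alpha> = 0 yields the Hardy-Sobolev norm, the case \<beta> = 1 one
  step of the lift.\<close>

lemma sob_sq_radial_power:
  assumes "holomorphic_n_on f (ball 0 1)"
  shows "sob_sq (\<alpha> + \<beta>) f = ennreal ((cmod (f 0))\<^sup>2) + sob_sq \<alpha> (radial_power \<beta> f)"
proof -
  have "ennreal (sob_weight (\<alpha> + \<beta>) k * sphere_sq (hpart f k)) =
      (if k = 0 then ennreal ((cmod (f 0))\<^sup>2) else 0)
      + ennreal (sob_weight \<alpha> k * sphere_sq (hpart (radial_power \<beta> f) k))" for k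
    unfolding sphere_sq_hpart_radial_power[OF assms]
    by (cases "k = 0") (simp_all add: sob_weight_def sphere_sq_hpart_0 max_def distrib_left powr_add)
  moreover have "(\<Sum>k. if k = 0 then ennreal ((cmod (f 0))\<^sup>2) else 0) = ennreal ((cmod (f 0))\<^sup>2)"
    using sums_unique[OF sums_single[of 0 "\<lambda>_. ennreal ((cmod (f 0))\<^sup>2)"]] by simp
  ultimately show ?thesis
    unfolding sob_sq_def by (simp add: suminf_add[symmetric] summableI)
qed

lemma sob_sq_zero: "holomorphic_n_on f (ball 0 1) \<Longrightarrow> sob_sq 0 f = hardy_norm_sq f"
  by (simp add: sob_sq_def hardy_norm_sq_eq)

lemma sob_sq_eq_hardy_norm_sq:
  assumes "holomorphic_n_on f (ball 0 1)"
  shows "sob_sq \<beta> f = ennreal ((cmod (f 0))\<^sup>2) + hardy_norm_sq (radial_power \<beta> f)"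
  using sob_sq_radial_power[OF assms, of 0 \<beta>]
  by (simp add: sob_sq_zero radial_power_holomorphic assms)

lemma mem_hardy_sobolev_iff:
  "f \<in> hardy_sobolev \<beta> \<longleftrightarrow>
    holomorphic_n_on f (ball 0 1) \<and> (\<forall>z. z \<notin> ball 0 1 \<longrightarrow> f z = 0) \<and> sob_sq \<beta> f < \<infinity>"
proof (cases "holomorphic_n_on f (ball 0 1)")
  case True
  have "radial_power \<beta> f z = 0" if "z \<notin> ball 0 1" for z
    using that by (simp only: radial_power_def if_False)
  then show ?thesis
    using True radial_power_holomorphic[OF True, of \<beta>]
    by (auto simp: hardy_sobolev_def hardy_space_def sob_sq_eq_hardy_norm_sq ennreal_add_less_top)
qed (simp add: hardy_sobolev_def)

lemma hardy_sobolev_norm_eq: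
  assumes "f \<in> hardy_sobolev \<beta>"
  shows "hardy_sobolev_norm \<beta> f = sqrt (enn2real (sob_sq \<beta> f))"
proof -
  have hol: "holomorphic_n_on f (ball 0 1)" and fin: "sob_sq \<beta> f < \<infinity>"
    using assms by (simp_all add: mem_hardy_sobolev_iff)
  then have "hardy_norm_sq (radial_power \<beta> f) < top"
    by (simp add: sob_sq_eq_hardy_norm_sq ennreal_add_less_top)
  then show ?thesis
    using hol by (simp add: hardy_sobolev_norm_def sob_sq_eq_hardy_norm_sq enn2real_plus)
qed

lemma sob_sq_coeff_le:
  assumes "sob_sq \<beta> f \<le> ennreal c" "c \<ge> 0"
  shows "sob_weight \<beta> k * sphere_sq (hpart f k) \<le> c"
proof -
  have "ennreal (sob_weight \<beta> k * sphere_sq (hpart f k)) \<le> sob_sq \<beta> f"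
  proof -
    have "(\<Sum>j\<in>{k}. ennreal (sob_weight \<beta> j * sphere_sq (hpart f j))) \<le> sob_sq \<beta> f"
      unfolding sob_sq_def by (rule sum_le_suminf) auto
    then show ?thesis by simp
  qed
  then have "ennreal (sob_weight \<beta> k * sphere_sq (hpart f k)) \<le> ennreal c"
    using assms(1) by (rule order_trans)
  then show ?thesis using assms(2) by simp
qed

text \<open>Each homogeneous part is controlled by the norm up to a power of k, and the geometric
  factor of \<open>hpart_point_bound\<close> makes the sum converge. The constant depends on s and
  \<beta>, not on f; nothing is claimed about it as s tends to 1.\<close>

lemma sob_sq_point_bound:
  assumes s: "0 < s" "s < 1"
  shows "\<exists>C\<ge>0. \<forall>(f :: complex ^ 'n::finite \<Rightarrow> complex) c z. holomorphic_n_on f (ball 0 1) \<longrightarrow> c \<ge> 0 \<longrightarrow>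
    sob_sq \<beta> f \<le> ennreal c \<longrightarrow> norm z \<le> s \<longrightarrow> cmod (f z) \<le> C * sqrt c"
proof -
  obtain C q where C: "C \<ge> 0" and q: "0 < q" "q < 1" and
    bound: "\<And>(f :: complex ^ 'n \<Rightarrow> complex) k z. holomorphic_n_on f (ball 0 1) \<Longrightarrow> norm z \<le> s \<Longrightarrow>
      cmod (hpart f k z) \<le> C * q ^ k * sqrt (sphere_sq (hpart f k))"
    using hpart_point_bound[OF s, where 'n = 'n] by blast
  define b where "b = (\<lambda>k. C * q ^ k * real (max 1 k) powr (- \<beta>))"
  have "summable (\<lambda>k. real (Suc k) powr (- \<beta>) * q ^ Suc k)"
    by (rule summable_Suc_iff[THEN iffD2, OF summable_powr_geometric[OF q, of "- \<beta>"]])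
  then have "summable (\<lambda>k. b (Suc k))"
    unfolding b_def by (auto intro!: summable_mult simp: max_def mult_ac)
  then have b: "summable b" by (simp only: summable_Suc_iff)
  have b0: "b k \<ge> 0" for k using C q by (simp add: b_def)
  have "cmod (f z) \<le> (\<Sum>k. b k) * sqrt c"
    if hol: "holomorphic_n_on f (ball 0 1)" and c: "c \<ge> 0" "sob_sq \<beta> f \<le> ennreal c" and z: "norm z \<le> s"
    for f :: "complex ^ 'n \<Rightarrow> complex" and c z
  proof (rule norm_sums_le)
    show "(\<lambda>k. hpart f k z) sums f z" using z s by (intro hpart_sums[OF hol]) simp
    show "(\<lambda>k. b k * sqrt c) sums ((\<Sum>k. b k) * sqrt c)"
      by (intro sums_mult2 summable_sums b)
    fix k
    have "sphere_sq (hpart f k) \<le> real (max 1 k) powr (- (2 * \<beta>)) * c"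
      using sob_sq_coeff_le[OF c(2,1), of k] by (simp add: sob_weight_def powr_minus field_simps)
    then have "sqrt (sphere_sq (hpart f k)) \<le> sqrt ((real (max 1 k) powr (- \<beta>))\<^sup>2 * c)"
      by (simp add: power2_eq_square flip: powr_add)
    also have "\<dots> = real (max 1 k) powr (- \<beta>) * sqrt c"
      by (simp add: real_sqrt_mult)
    finally have "C * q ^ k * sqrt (sphere_sq (hpart f k)) \<le> C * q ^ k * (real (max 1 k) powr (- \<beta>) * sqrt c)"
      using C q by (intro mult_left_mono) auto
    with bound[OF hol z, of k] show "cmod (hpart f k z) \<le> b k * sqrt c"
      by (simp add: b_def mult_ac)
  qed
  moreover have "(\<Sum>k. b k) \<ge> 0" by (intro suminf_nonneg b b0)
  ultimately show ?thesis by blast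
qed

subsection \<open>Multiplication operators\<close>

lemma cmod_add_sq_le: "(cmod (a + b))\<^sup>2 \<le> 2 * (cmod a)\<^sup>2 + 2 * (cmod b)\<^sup>2"
proof -
  have "(cmod (a + b))\<^sup>2 \<le> (cmod a + cmod b)\<^sup>2"
    by (intro power_mono norm_triangle_ineq) simp
  also have "\<dots> \<le> 2 * (cmod a)\<^sup>2 + 2 * (cmod b)\<^sup>2"
    using sum_squares_bound[of "cmod a" "cmod b"] by (simp add: power2_sum)
  finally show ?thesis .
qed

lemma sphere_sq_add_le:
  assumes "continuous_on UNIV p" "continuous_on UNIV q"
  shows "sphere_sq (\<lambda>z. p z + q z) \<le> 2 * sphere_sq p + 2 * sphere_sq q"
proof -
  have "ennreal (sphere_sq (\<lambda>z. p z + q z)) = (\<integral>\<^sup>+\<zeta>. ennreal ((cmod (p \<zeta> + q \<zeta>))\<^sup>2) \<partial>sphere_measure)"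
    by (rule nn_integral_sphere_sq[symmetric]) (intro continuous_on_add assms)
  also have "\<dots> \<le> (\<integral>\<^sup>+\<zeta>. ennreal 2 * ennreal ((cmod (p \<zeta>))\<^sup>2) + ennreal 2 * ennreal ((cmod (q \<zeta>))\<^sup>2) \<partial>sphere_measure)"
  proof (rule nn_integral_mono)
    fix \<zeta>
    have "ennreal ((cmod (p \<zeta> + q \<zeta>))\<^sup>2) \<le> ennreal (2 * (cmod (p \<zeta>))\<^sup>2 + 2 * (cmod (q \<zeta>))\<^sup>2)"
      by (intro ennreal_leI cmod_add_sq_le)
    then show "ennreal ((cmod (p \<zeta> + q \<zeta>))\<^sup>2)
        \<le> ennreal 2 * ennreal ((cmod (p \<zeta>))\<^sup>2) + ennreal 2 * ennreal ((cmod (q \<zeta>))\<^sup>2)"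
      by (simp add: ennreal_plus ennreal_mult' del: ennreal_numeral)
  qed
  also have "\<dots> = ennreal 2 * ennreal (sphere_sq p) + ennreal 2 * ennreal (sphere_sq q)"
    unfolding nn_integral_sphere_sq[OF assms(1), symmetric] nn_integral_sphere_sq[OF assms(2), symmetric]
    using borel_measurable_cmod_sq(1)[OF assms(1)] borel_measurable_cmod_sq(1)[OF assms(2)]
    by (simp add: nn_integral_add nn_integral_cmult)
  also have "\<dots> = ennreal (2 * sphere_sq p + 2 * sphere_sq q)"
    by (simp add: ennreal_plus ennreal_mult' del: ennreal_numeral)
  finally show ?thesis by (subst (asm) ennreal_le_iff) simp_all
qed

lemma hpart_add_fun:
  "holomorphic_n_on f (ball 0 1) \<Longrightarrow> holomorphic_n_on g (ball 0 1) \<Longrightarrow>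
    hpart (\<lambda>z. f z + g z) k = (\<lambda>z. hpart f k z + hpart g k z)"
  by (rule ext) (rule hpart_add)

lemma hpart_cmult_fun:
  "holomorphic_n_on f (ball 0 1) \<Longrightarrow> hpart (\<lambda>z. c * f z) k = (\<lambda>z. c * hpart f k z)"
  by (rule ext) (rule hpart_cmult)

lemma sob_sq_cong:
  assumes "\<And>z. z \<in> ball 0 1 \<Longrightarrow> f z = g z"
  shows "sob_sq \<beta> f = sob_sq \<beta> g"
proof -
  have "hpart f k = hpart g k" for k by (rule ext) (rule hpart_cong[OF assms])
  then show ?thesis by (simp add: sob_sq_def)
qed

lemma sob_sq_add_le:
  assumes "holomorphic_n_on f (ball 0 1)" "holomorphic_n_on g (ball 0 1)"
  shows "sob_sq \<beta> (\<lambda>z. f z + g z) \<le> 2 * sob_sq \<beta> f + 2 * sob_sq \<beta> g"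
proof -
  have "ennreal (sob_weight \<beta> k * sphere_sq (hpart (\<lambda>z. f z + g z) k))
      \<le> 2 * ennreal (sob_weight \<beta> k * sphere_sq (hpart f k))
        + 2 * ennreal (sob_weight \<beta> k * sphere_sq (hpart g k))" for k
  proof -
    have "sob_weight \<beta> k * sphere_sq (hpart (\<lambda>z. f z + g z) k)
        \<le> sob_weight \<beta> k * (2 * sphere_sq (hpart f k) + 2 * sphere_sq (hpart g k))"
      unfolding hpart_add_fun[OF assms]
      by (intro mult_left_mono sphere_sq_add_le continuous_on_hpart assms) simp
    also have "\<dots> = 2 * (sob_weight \<beta> k * sphere_sq (hpart f k)) + 2 * (sob_weight \<beta> k * sphere_sq (hpart g k))"
      by (simp add: algebra_simps)
    finally have "ennreal (sob_weight \<beta> k * sphere_sq (hpart (\<lambda>z. f z + g z) k))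
        \<le> ennreal (2 * (sob_weight \<beta> k * sphere_sq (hpart f k)) + 2 * (sob_weight \<beta> k * sphere_sq (hpart g k)))"
      by (rule ennreal_leI)
    then show ?thesis by (simp add: ennreal_plus ennreal_mult'[of 2])
  qed
  then have "sob_sq \<beta> (\<lambda>z. f z + g z) \<le> (\<Sum>k. 2 * ennreal (sob_weight \<beta> k * sphere_sq (hpart f k))
        + 2 * ennreal (sob_weight \<beta> k * sphere_sq (hpart g k)))"
    unfolding sob_sq_def by (intro suminf_le summableI)
  also have "\<dots> = 2 * sob_sq \<beta> f + 2 * sob_sq \<beta> g"
    unfolding sob_sq_def by (simp add: suminf_add[symmetric] summableI)
  finally show ?thesis .
qed

lemma sob_sq_cmult:
  assumes "holomorphic_n_on f (ball 0 1)"
  shows "sob_sq \<beta> (\<lambda>z. c * f z) = ennreal ((cmod c)\<^sup>2) * sob_sq \<beta> f"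
proof -
  have "ennreal (sob_weight \<beta> k * sphere_sq (hpart (\<lambda>z. c * f z) k))
      = ennreal ((cmod c)\<^sup>2) * ennreal (sob_weight \<beta> k * sphere_sq (hpart f k))" for k
    unfolding hpart_cmult_fun[OF assms] sphere_sq_cmult[OF continuous_on_hpart[OF assms]]
    by (simp add: mult_ac flip: ennreal_mult)
  then show ?thesis unfolding sob_sq_def by simp
qed

text \<open>C bounds the square of the operator norm. For C > 0 the inequality is void at functions
  of infinite norm, so it then says something about the space only.\<close>

definition sob_mult_bound :: "real \<Rightarrow> real \<Rightarrow> (complex ^ 'n::finite \<Rightarrow> complex) \<Rightarrow> bool"
  where "sob_mult_bound \<beta> C h \<longleftrightarrow>
    (\<forall>f. holomorphic_n_on f (ball 0 1) \<longrightarrow> sob_sq \<beta> (\<lambda>z. h z * f z) \<le> ennreal C * sob_sq \<beta> f)"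

lemma sob_mult_boundD:
  "sob_mult_bound \<beta> C h \<Longrightarrow> holomorphic_n_on f (ball 0 1) \<Longrightarrow>
    sob_sq \<beta> (\<lambda>z. h z * f z) \<le> ennreal C * sob_sq \<beta> f"
  by (simp add: sob_mult_bound_def)

text \<open>Order 0 is the Hardy space, where a sup bound enters directly as a pointwise factor;
  negative orders follow by \<open>sob_mult_bound_mono\<close>.\<close>

lemma sob_mult_bound_zero:
  assumes "holomorphic_n_on h (ball 0 1)" "B \<ge> 0" "\<And>z. z \<in> ball 0 1 \<Longrightarrow> cmod (h z) \<le> B"
  shows "sob_mult_bound 0 (B\<^sup>2) h"
  unfolding sob_mult_bound_def
  by (auto simp: sob_sq_zero holomorphic_n_on_mult assms intro!: hardy_norm_sq_bounded_mult)

text \<open>By \<open>hpart_mult\<close> the degree k of a product sees only degrees at most k of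
  the factors. This serves to truncate f, and in \<open>mult_partial_sums_bounded\<close> to
  truncate the multiplier itself.\<close>

lemma hpart_mult_truncate:
  assumes "holomorphic_n_on g (ball 0 1)" "holomorphic_n_on g' (ball 0 1)" "holomorphic_n_on h (ball 0 1)"
    "holomorphic_n_on h' (ball 0 1)"
    and "\<And>j z. j < N \<Longrightarrow> hpart g j z = hpart g' j z" "\<And>j z. j < N \<Longrightarrow> hpart h j z = hpart h' j z"
    and "k < N"
  shows "hpart (\<lambda>z. g z * h z) k = hpart (\<lambda>z. g' z * h' z) k"
  by (rule ext) (use assms in \<open>simp add: hpart_mult\<close>)

lemma hpart_partial_sum:
  assumes hol: "holomorphic_n_on f (ball 0 1)"
  shows "hpart (\<lambda>z. \<Sum>j<N. hpart f j z) k z = (if k < N then hpart f k z else 0)"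
proof (rule hpart_unique[where F = "\<lambda>k z. if k < N then hpart f k z else 0"])
  show "(\<lambda>k. if k < N then hpart f k z else 0) sums (\<Sum>j<N. hpart f j z)" for z
    using sums_If_finite_set[of "{..<N}" "\<lambda>k. hpart f k z"] by simp
qed (simp add: hpart_smult[OF hol])

text \<open>
  A multiplication operator is lower triangular for the grading by degree, so it may be applied to
  the partial sums of the homogeneous expansion.
\<close>

lemma sob_mult_bound_partial_sums:
  assumes bound: "sob_mult_bound \<beta> C h" and C: "C \<ge> 0"
    and h: "holomorphic_n_on h (ball 0 1)" and f: "holomorphic_n_on f (ball 0 1)"
  shows "(\<Sum>k<N. sob_weight \<beta> k * sphere_sq (hpart (\<lambda>z. h z * f z) k))
    \<le> C * (\<Sum>k<N. sob_weight \<beta> k * sphere_sq (hpart f k))"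
proof -
  define p where "p = (\<lambda>z. \<Sum>j<N. hpart f j z)"
  have p: "holomorphic_n_on p (ball 0 1)"
    unfolding p_def by (intro holomorphic_n_on_sum hpart_holomorphic f)
  have hp: "hpart p k = (\<lambda>z. if k < N then hpart f k z else 0)" for k
    unfolding p_def by (rule ext) (rule hpart_partial_sum[OF f])
  have "ennreal (\<Sum>k<N. sob_weight \<beta> k * sphere_sq (hpart (\<lambda>z. h z * f z) k))
      = (\<Sum>k<N. ennreal (sob_weight \<beta> k * sphere_sq (hpart (\<lambda>z. h z * p z) k)))"
  proof -
    have "hpart (\<lambda>z. h z * f z) k = hpart (\<lambda>z. h z * p z) k" if "k < N" for k
      by (rule hpart_mult_truncate[OF h h f p _ _ that]) (simp_all add: hp)
    then have "(\<Sum>k<N. sob_weight \<beta> k * sphere_sq (hpart (\<lambda>z. h z * f z) k))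
        = (\<Sum>k<N. sob_weight \<beta> k * sphere_sq (hpart (\<lambda>z. h z * p z) k))"
      by (intro sum.cong) auto
    then show ?thesis by (simp only:) (rule sum_ennreal[symmetric], simp)
  qed
  also have "\<dots> \<le> sob_sq \<beta> (\<lambda>z. h z * p z)"
    unfolding sob_sq_def by (rule sum_le_suminf) auto
  also have "\<dots> \<le> ennreal C * sob_sq \<beta> p" by (rule sob_mult_boundD[OF bound p])
  also have "sob_sq \<beta> p = (\<Sum>k<N. ennreal (sob_weight \<beta> k * sphere_sq (hpart p k)))"
    unfolding sob_sq_def by (rule suminf_finite) (auto simp: hp sphere_sq_const)
  also have "\<dots> = ennreal (\<Sum>k<N. sob_weight \<beta> k * sphere_sq (hpart f k))"
  proof -
    have "hpart p k = hpart f k" if "k < N" for k using that by (simp add: hp)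
    then show ?thesis by (subst sum_ennreal) (auto intro!: arg_cong[where f = ennreal] sum.cong)
  qed
  finally have "ennreal (\<Sum>k<N. sob_weight \<beta> k * sphere_sq (hpart (\<lambda>z. h z * f z) k))
      \<le> ennreal (C * (\<Sum>k<N. sob_weight \<beta> k * sphere_sq (hpart f k)))"
    using C by (simp add: ennreal_mult sum_nonneg)
  then show ?thesis
    using C by (subst (asm) ennreal_le_iff) (auto intro!: mult_nonneg_nonneg sum_nonneg)
qed

text \<open>Abel summation: the weighted sum of y - x is a combination of its partial sums with
  coefficients d k - d (k + 1) \<ge> 0 and the last weight. A termwise comparison would not do, as a
  multiplier moves mass between degrees.\<close>

lemma decreasing_weight_sum_mono:
  fixes x y d :: "nat \<Rightarrow> real"
  assumes le: "\<And>N. (\<Sum>k<N. x k) \<le> (\<Sum>k<N. y k)"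
    and d: "\<And>k. d (Suc k) \<le> d k" "\<And>k. d k \<ge> 0"
  shows "(\<Sum>k<N. d k * x k) \<le> (\<Sum>k<N. d k * y k)"
proof -
  \<comment> \<open>Summed up to \<open>Suc N\<close>, so that d N is the weight of the last
    term.\<close>
  have "d N * (\<Sum>k<Suc N. y k - x k) \<le> (\<Sum>k<Suc N. d k * (y k - x k))" for N
  proof (induction N)
    case (Suc N)
    have "d (Suc N) * (\<Sum>k<Suc N. y k - x k) \<le> d N * (\<Sum>k<Suc N. y k - x k)"
      using le[of "Suc N"] d(1)[of N] by (intro mult_right_mono) (simp_all add: sum_subtractf)
    with Suc show ?case by (simp add: distrib_left del: sum.lessThan_Suc add: sum.lessThan_Suc[of _ "Suc N"])
  qed simp
  moreover have "0 \<le> d N * (\<Sum>k<Suc N. y k - x k)" for N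
    using le[of "Suc N"] d(2)[of N] by (intro mult_nonneg_nonneg) (simp_all add: sum_subtractf)
  ultimately have "0 \<le> (\<Sum>k<Suc N. d k * (y k - x k))" for N
    by (rule order_trans[rotated])
  then have "0 \<le> (\<Sum>k<N. d k * (y k - x k))" for N
    by (cases N) simp_all
  then show ?thesis by (simp add: right_diff_distrib sum_subtractf)
qed

lemma sob_mult_bound_mono:
  fixes h :: "complex ^ 'n::finite \<Rightarrow> complex"
  assumes bound: "sob_mult_bound \<beta> C h" and C: "C \<ge> 0"
    and h: "holomorphic_n_on h (ball 0 1)" and le: "\<alpha> \<le> \<beta>"
  shows "sob_mult_bound \<alpha> C h"
  unfolding sob_mult_bound_def
proof (intro allI impI)
  fix f :: "complex ^ 'n \<Rightarrow> complex" assume f: "holomorphic_n_on f (ball 0 1)"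
  \<comment> \<open>The quotient of the two weights; it decreases in k because \<alpha> \<le>
    \<beta>.\<close>
  define d where "d = (\<lambda>k. real (max 1 k) powr (2 * (\<alpha> - \<beta>)))"
  have d: "sob_weight \<alpha> k = d k * sob_weight \<beta> k" for k
    by (simp add: d_def sob_weight_def algebra_simps flip: powr_add)
  have dec: "d (Suc k) \<le> d k" "d k \<ge> 0" for k
    unfolding d_def using le by (auto intro!: powr_mono2')
  show "sob_sq \<alpha> (\<lambda>z. h z * f z) \<le> ennreal C * sob_sq \<alpha> f"
    unfolding sob_sq_def[of _ "\<lambda>z. h z * f z"] suminf_eq_SUP
  proof (rule SUP_least)
    fix N
    have "(\<Sum>k<N. d k * (sob_weight \<beta> k * sphere_sq (hpart (\<lambda>z. h z * f z) k)))
        \<le> (\<Sum>k<N. d k * (C * (sob_weight \<beta> k * sphere_sq (hpart f k))))"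
      using sob_mult_bound_partial_sums[OF bound C h f]
      by (intro decreasing_weight_sum_mono dec) (simp add: sum_distrib_left)
    then have "(\<Sum>k<N. sob_weight \<alpha> k * sphere_sq (hpart (\<lambda>z. h z * f z) k))
        \<le> C * (\<Sum>k<N. sob_weight \<alpha> k * sphere_sq (hpart f k))"
      by (simp add: d sum_distrib_left mult_ac)
    then have "ennreal (\<Sum>k<N. sob_weight \<alpha> k * sphere_sq (hpart (\<lambda>z. h z * f z) k))
        \<le> ennreal (C * (\<Sum>k<N. sob_weight \<alpha> k * sphere_sq (hpart f k)))"
      by (rule ennreal_leI)
    also have "\<dots> = ennreal C * (\<Sum>k<N. ennreal (sob_weight \<alpha> k * sphere_sq (hpart f k)))"
      by (subst sum_ennreal) (auto intro!: ennreal_mult sum_nonneg C)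
    also have "\<dots> \<le> ennreal C * sob_sq \<alpha> f"
      unfolding sob_sq_def by (intro mult_left_mono sum_le_suminf) auto
    finally show "(\<Sum>k<N. ennreal (sob_weight \<alpha> k * sphere_sq (hpart (\<lambda>z. h z * f z) k)))
        \<le> ennreal C * sob_sq \<alpha> f"
      by (simp add: sum_ennreal)
  qed
qed

section \<open>The Leibniz rule and inverses of multipliers\<close>

lemma radial_power_mult:
  assumes f: "holomorphic_n_on f (ball 0 1)" and g: "holomorphic_n_on g (ball 0 1)" and z: "z \<in> ball 0 1"
  shows "radial_power 1 (\<lambda>z. f z * g z) z = f z * radial_power 1 g z + radial_power 1 f z * g z"
proof (rule sums_unique2)
  have fg: "holomorphic_n_on (\<lambda>z. f z * g z) (ball 0 1)" by (rule holomorphic_n_on_mult[OF f g])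
  let ?h = "\<lambda>z. f z * radial_power 1 g z + radial_power 1 f z * g z"
  have h1: "holomorphic_n_on (\<lambda>z. f z * radial_power 1 g z) (ball 0 1)"
    and h2: "holomorphic_n_on (\<lambda>z. radial_power 1 f z * g z) (ball 0 1)"
    by (intro holomorphic_n_on_mult radial_power_holomorphic f g)+
  show "(\<lambda>k. hpart ?h k z) sums ?h z"
    by (rule hpart_sums[OF holomorphic_n_on_add[OF h1 h2] z])
  have "hpart ?h k z = complex_of_real (real k powr 1) * hpart (\<lambda>z. f z * g z) k z" for k
  proof -
    have "hpart ?h k z = (\<Sum>i\<le>k. hpart f i z * (of_nat (k - i) * hpart g (k - i) z)
        + of_nat i * hpart f i z * hpart g (k - i) z)"
      by (simp add: hpart_add h1 h2 hpart_mult radial_power_holomorphic f g hpart_radial_power sum.distrib)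
    \<comment> \<open>The Leibniz rule in terms of degrees: i + (k - i) = k. This additivity is
      special to order 1.\<close>
    also have "\<dots> = (\<Sum>i\<le>k. of_nat k * (hpart f i z * hpart g (k - i) z))"
      by (intro sum.cong) (auto simp: of_nat_diff algebra_simps)
    finally show ?thesis by (simp add: hpart_mult f g sum_distrib_left)
  qed
  then show "(\<lambda>k. hpart ?h k z) sums radial_power 1 (\<lambda>z. f z * g z) z"
    using radial_power_sums[OF fg z, of 1] by simp
qed

lemma radial_power_cong:
  assumes "holomorphic_n_on f (ball 0 1)" "holomorphic_n_on g (ball 0 1)"
    "\<And>z. z \<in> ball 0 1 \<Longrightarrow> f z = g z"
  shows "radial_power \<beta> f = radial_power \<beta> g"
proof -
  have "hpart f = hpart g" by (intro ext) (rule hpart_cong[OF assms(3)])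
  then show ?thesis
    unfolding radial_power_def homogeneous_part_eq_hpart[OF assms(1)] homogeneous_part_eq_hpart[OF assms(2)]
    by (rule arg_cong)
qed

text \<open>
  If \<open>\<phi> \<psi> = 1\<close>, the Leibniz rule for the radial derivative \<open>R\<close> gives
  \<open>R(\<psi> f) = 2 \<psi> R f - \<psi>\<^sup>2 R(\<phi> f)\<close>, in which \<open>\<psi>\<close> acts only on functions of order \<open>\<alpha>\<close>.
\<close>

lemma sob_mult_bound_inverse_step:
  fixes \<phi> \<psi> :: "complex ^ 'n::finite \<Rightarrow> complex"
  assumes \<phi>: "holomorphic_n_on \<phi> (ball 0 1)" and \<psi>: "holomorphic_n_on \<psi> (ball 0 1)"
    and inv: "\<And>z. z \<in> ball 0 1 \<Longrightarrow> \<phi> z * \<psi> z = 1"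
    and C: "sob_mult_bound (\<alpha> + 1) C \<phi>" "C \<ge> 0" and D: "sob_mult_bound \<alpha> D \<psi>" "D \<ge> 0"
  shows "sob_mult_bound (\<alpha> + 1) ((cmod (\<psi> 0))\<^sup>2 + (8 * D + 2 * D * D * C)) \<psi>"
  unfolding sob_mult_bound_def
proof (intro allI impI)
  fix f :: "complex ^ 'n \<Rightarrow> complex" assume f: "holomorphic_n_on f (ball 0 1)"
  let ?R = "radial_power 1"
  let ?g = "\<lambda>z. \<psi> z * f z" and ?q = "\<lambda>z. \<phi> z * f z"
  have g: "holomorphic_n_on ?g (ball 0 1)" and q: "holomorphic_n_on ?q (ball 0 1)"
    by (intro holomorphic_n_on_mult \<phi> \<psi> f)+
  note R = radial_power_holomorphic
  have eq: "?R ?g z = 2 * (\<psi> z * ?R f z) + (- 1) * (\<psi> z * (\<psi> z * ?R ?q z))" if z: "z \<in> ball 0 1" for z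
  proof -
    have "?R f = ?R (\<lambda>z. \<phi> z * ?g z)"
    proof (rule radial_power_cong[OF f holomorphic_n_on_mult[OF \<phi> g]])
      fix z assume "z \<in> (ball 0 1 :: (complex ^ 'n) set)"
      then show "f z = \<phi> z * ?g z" using inv[of z] by (metis mult.assoc mult_1)
    qed
    \<comment> \<open>Steps 1 to 4 eliminate \<psi> R(\<phi>) \<psi> f, where the derivative falls
      on the multiplier and no bound at order \<alpha> is at hand. Expanding R f through
      \<open>\<phi> * (\<psi> * f)\<close> keeps the derivative of \<psi> out.\<close>
    then have 1: "?R f z = \<phi> z * ?R ?g z + ?R \<phi> z * (\<psi> z * f z)"
      using radial_power_mult[OF \<phi> g z] by simp
    have 2: "?R ?q z = \<phi> z * ?R f z + ?R \<phi> z * f z"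
      by (rule radial_power_mult[OF \<phi> f z])
    have "\<psi> z * ?R f z = (\<phi> z * \<psi> z) * ?R ?g z + \<psi> z * ?R \<phi> z * (\<psi> z * f z)"
      unfolding 1 by (simp add: algebra_simps)
    then have 3: "\<psi> z * ?R f z = ?R ?g z + \<psi> z * ?R \<phi> z * (\<psi> z * f z)" by (simp add: inv[OF z])
    have "\<psi> z * (\<psi> z * ?R ?q z) = (\<phi> z * \<psi> z) * (\<psi> z * ?R f z) + \<psi> z * ?R \<phi> z * (\<psi> z * f z)"
      unfolding 2 by (simp add: algebra_simps)
    then have 4: "\<psi> z * (\<psi> z * ?R ?q z) = \<psi> z * ?R f z + \<psi> z * ?R \<phi> z * (\<psi> z * f z)" by (simp add: inv[OF z])
    show ?thesis unfolding 4 using 3 by (simp add: algebra_simps)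
  qed
  have sob1: "sob_sq (\<alpha> + 1) u = ennreal ((cmod (u 0))\<^sup>2) + sob_sq \<alpha> (?R u)"
    if "holomorphic_n_on u (ball 0 1)" for u :: "complex ^ 'n \<Rightarrow> complex"
    by (rule sob_sq_radial_power[OF that])
  have Rle: "sob_sq \<alpha> (?R u) \<le> sob_sq (\<alpha> + 1) u"
    if "holomorphic_n_on u (ball 0 1)" for u :: "complex ^ 'n \<Rightarrow> complex"
    unfolding sob1[OF that] by simp
  let ?S = "sob_sq (\<alpha> + 1) f"
  have "sob_sq \<alpha> (?R ?g) = sob_sq \<alpha> (\<lambda>z. 2 * (\<psi> z * ?R f z) + (- 1) * (\<psi> z * (\<psi> z * ?R ?q z)))"
    by (rule sob_sq_cong[OF eq])
  also have "\<dots> \<le> 2 * sob_sq \<alpha> (\<lambda>z. 2 * (\<psi> z * ?R f z)) + 2 * sob_sq \<alpha> (\<lambda>z. (- 1) * (\<psi> z * (\<psi> z * ?R ?q z)))"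
    by (intro sob_sq_add_le holomorphic_n_on_cmult holomorphic_n_on_mult \<psi> R f q)
  \<comment> \<open>The constants are 8 = 2 * |2|^2 and 2 = 2 * |-1|^2.\<close>
  also have "\<dots> = 8 * sob_sq \<alpha> (\<lambda>z. \<psi> z * ?R f z) + 2 * sob_sq \<alpha> (\<lambda>z. \<psi> z * (\<psi> z * ?R ?q z))"
    by (subst (1 2) sob_sq_cmult, (intro holomorphic_n_on_mult \<psi> R f q)+) (simp add: mult.assoc[symmetric])
  also have "\<dots> \<le> 8 * (ennreal D * ?S) + 2 * (ennreal D * (ennreal D * (ennreal C * ?S)))"
  proof (intro add_mono mult_left_mono)
    have "sob_sq \<alpha> (\<lambda>z. \<psi> z * ?R f z) \<le> ennreal D * sob_sq \<alpha> (?R f)"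
      by (rule sob_mult_boundD[OF D(1) R[OF f]])
    also have "\<dots> \<le> ennreal D * ?S" by (intro mult_left_mono Rle f) simp
    finally show "sob_sq \<alpha> (\<lambda>z. \<psi> z * ?R f z) \<le> ennreal D * ?S" .
    have "sob_sq \<alpha> (\<lambda>z. \<psi> z * (\<psi> z * ?R ?q z)) \<le> ennreal D * sob_sq \<alpha> (\<lambda>z. \<psi> z * ?R ?q z)"
      by (rule sob_mult_boundD[OF D(1) holomorphic_n_on_mult[OF \<psi> R[OF q]]])
    also have "\<dots> \<le> ennreal D * (ennreal D * sob_sq \<alpha> (?R ?q))"
      by (intro mult_left_mono sob_mult_boundD[OF D(1) R[OF q]]) simp
    also have "\<dots> \<le> ennreal D * (ennreal D * (ennreal C * ?S))"
      by (intro mult_left_mono order_trans[OF Rle[OF q] sob_mult_boundD[OF C(1) f]]) simp_all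
    finally show "sob_sq \<alpha> (\<lambda>z. \<psi> z * (\<psi> z * ?R ?q z)) \<le> ennreal D * (ennreal D * (ennreal C * ?S))" .
  qed simp_all
  also have "\<dots> = ennreal (8 * D + 2 * D * D * C) * ?S"
    using C D by (simp add: ennreal_plus ennreal_mult distrib_right mult.assoc)
  finally have "sob_sq \<alpha> (?R ?g) \<le> ennreal (8 * D + 2 * D * D * C) * ?S" .
  \<comment> \<open>The value at 0 is invisible to the radial derivative and is estimated
    separately, \<open>?S\<close> containing |f(0)|^2.\<close>
  moreover have "ennreal ((cmod (\<psi> 0 * f 0))\<^sup>2) \<le> ennreal ((cmod (\<psi> 0))\<^sup>2) * ?S"
    unfolding sob1[OF f] norm_mult power_mult_distrib
    by (simp add: ennreal_mult distrib_left)
  ultimately show "sob_sq (\<alpha> + 1) ?g \<le> ennreal ((cmod (\<psi> 0))\<^sup>2 + (8 * D + 2 * D * D * C)) * ?S"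
    unfolding sob1[OF g] using C D by (simp add: ennreal_plus distrib_right add_mono)
qed

lemma sob_mult_bound_inverse:
  fixes \<phi> \<psi> :: "complex ^ 'n::finite \<Rightarrow> complex"
  assumes \<phi>: "holomorphic_n_on \<phi> (ball 0 1)" and \<psi>: "holomorphic_n_on \<psi> (ball 0 1)"
    and inv: "\<And>z. z \<in> ball 0 1 \<Longrightarrow> \<phi> z * \<psi> z = 1"
    and C: "sob_mult_bound \<beta> C \<phi>" "C \<ge> 0"
    and B: "\<And>z. z \<in> ball 0 1 \<Longrightarrow> cmod (\<psi> z) \<le> B"
  shows "\<exists>D\<ge>0. sob_mult_bound \<beta> D \<psi>"
proof -
  \<comment> \<open>For \<beta> \<le> 0 this is 0, and the base case is already the claim.\<close>
  define m where "m = nat \<lceil>\<beta>\<rceil>"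
  have m: "\<beta> - real m \<le> 0" unfolding m_def by linarith
  have "B \<ge> 0" using B[of 0] by (simp add: order_trans[OF norm_ge_zero])
  have "j \<le> m \<Longrightarrow> \<exists>D\<ge>0. sob_mult_bound (\<beta> - real m + real j) D \<psi>" for j
  proof (induction j)
    case 0
    have "sob_mult_bound (\<beta> - real m) (B\<^sup>2) \<psi>"
      by (rule sob_mult_bound_mono[OF sob_mult_bound_zero[OF \<psi> \<open>B \<ge> 0\<close> B] _ \<psi> m]) simp_all
    then show ?case by (intro exI[of _ "B\<^sup>2"]) simp
  next
    case (Suc j)
    then obtain D where D: "D \<ge> 0" "sob_mult_bound (\<beta> - real m + real j) D \<psi>" by auto
    \<comment> \<open>As j < m, this order is at most \<beta>, so the bound for \<phi> descends to
      it with the same C.\<close>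
    have "sob_mult_bound (\<beta> - real m + real j + 1) C \<phi>"
      using Suc.prems by (intro sob_mult_bound_mono[OF C \<phi>]) simp
    from sob_mult_bound_inverse_step[OF \<phi> \<psi> inv this C(2) D(2,1)]
    show ?case using C(2) D(1)
      by (intro exI[of _ "(cmod (\<psi> 0))\<^sup>2 + (8 * D + 2 * D * D * C)"]) (simp add: add_ac)
  qed
  from this[of m] show ?thesis by simp
qed

subsection \<open>Boundedness of pointwise multipliers\<close>

text \<open>Cauchy-Schwarz with weights 2^-(j+1), obtained by iterating |a + b|^2 \<le> 2 |a|^2 + 2
  |b|^2. Working with squares avoids roots of extended reals, and the growing factors are harmless
  against squared norms of size 16^-j.\<close>

lemma cmod_suminf_sq_le:
  fixes c :: "nat \<Rightarrow> complex"
  assumes "c sums s"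
  shows "ennreal ((cmod s)\<^sup>2) \<le> (\<Sum>j. ennreal (2 ^ Suc j * (cmod (c j))\<^sup>2))"
proof -
  have fin: "(cmod (\<Sum>j<m. c j))\<^sup>2 \<le> (\<Sum>j<m. 2 ^ Suc j * (cmod (c j))\<^sup>2)" for m and c :: "nat \<Rightarrow> complex"
  proof (induction m arbitrary: c)
    case (Suc m)
    have "(cmod (\<Sum>j<Suc m. c j))\<^sup>2 \<le> 2 * (cmod (c 0))\<^sup>2 + 2 * (cmod (\<Sum>j<m. c (Suc j)))\<^sup>2"
      unfolding sum.lessThan_Suc_shift by (rule cmod_add_sq_le)
    also have "\<dots> \<le> 2 * (cmod (c 0))\<^sup>2 + 2 * (\<Sum>j<m. 2 ^ Suc j * (cmod (c (Suc j)))\<^sup>2)"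
      using Suc.IH[of "\<lambda>j. c (Suc j)"] by simp
    also have "\<dots> = (\<Sum>j<Suc m. 2 ^ Suc j * (cmod (c j))\<^sup>2)"
      unfolding sum.lessThan_Suc_shift by (simp add: sum_distrib_left mult.assoc)
    finally show ?case .
  qed simp
  have "(\<lambda>m. ennreal ((cmod (\<Sum>j<m. c j))\<^sup>2)) \<longlonglongrightarrow> ennreal ((cmod s)\<^sup>2)"
    using assms unfolding sums_def by (intro tendsto_intros)
  then show ?thesis
  proof (rule LIMSEQ_le_const2, intro exI allI impI)
    fix m
    have "ennreal ((cmod (\<Sum>j<m. c j))\<^sup>2) \<le> ennreal (\<Sum>j<m. 2 ^ Suc j * (cmod (c j))\<^sup>2)"
      by (intro ennreal_leI fin)
    also have "\<dots> = (\<Sum>j<m. ennreal (2 ^ Suc j * (cmod (c j))\<^sup>2))"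
      by (rule sum_ennreal[symmetric]) simp
    also have "\<dots> \<le> (\<Sum>j. ennreal (2 ^ Suc j * (cmod (c j))\<^sup>2))"
      by (rule sum_le_suminf) auto
    finally show "ennreal ((cmod (\<Sum>j<m. c j))\<^sup>2) \<le> (\<Sum>j. ennreal (2 ^ Suc j * (cmod (c j))\<^sup>2))" .
  qed
qed

lemma sphere_sq_sums_le:
  assumes cont: "\<And>j. continuous_on UNIV (p j)" "continuous_on UNIV q"
    and sums: "\<And>z. (\<lambda>j. p j z) sums q z"
  shows "ennreal (sphere_sq q) \<le> (\<Sum>j. ennreal (2 ^ Suc j) * ennreal (sphere_sq (p j)))"
proof -
  have "ennreal (sphere_sq q) = (\<integral>\<^sup>+\<zeta>. ennreal ((cmod (q \<zeta>))\<^sup>2) \<partial>sphere_measure)"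
    by (rule nn_integral_sphere_sq[symmetric]) (rule cont)
  also have "\<dots> \<le> (\<integral>\<^sup>+\<zeta>. (\<Sum>j. ennreal (2 ^ Suc j) * ennreal ((cmod (p j \<zeta>))\<^sup>2)) \<partial>sphere_measure)"
    using cmod_suminf_sq_le[OF sums] by (intro nn_integral_mono) (simp add: ennreal_mult del: power_Suc)
  also have "\<dots> = (\<Sum>j. \<integral>\<^sup>+\<zeta>. ennreal (2 ^ Suc j) * ennreal ((cmod (p j \<zeta>))\<^sup>2) \<partial>sphere_measure)"
    by (rule nn_integral_suminf)
      (rule borel_measurable_times_ennreal[OF borel_measurable_const borel_measurable_cmod_sq(1)[OF cont(1)]])
  also have "\<dots> = (\<Sum>j. ennreal (2 ^ Suc j) * ennreal (sphere_sq (p j)))"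
    unfolding nn_integral_sphere_sq[OF cont(1), symmetric]
    using borel_measurable_cmod_sq(1)[OF cont(1)] by (simp add: nn_integral_cmult del: power_Suc)
  finally show ?thesis .
qed

lemma ennreal_suminf_swap:
  fixes f :: "nat \<Rightarrow> nat \<Rightarrow> ennreal"
  shows "(\<Sum>i. \<Sum>j. f i j) = (\<Sum>j. \<Sum>i. f i j)"
proof -
  have "(\<Sum>i. \<Sum>j. f i j) = (\<integral>\<^sup>+i. (\<Sum>j. f i j) \<partial>count_space UNIV)"
    by (rule nn_integral_count_space_nat[symmetric])
  also have "\<dots> = (\<Sum>j. \<integral>\<^sup>+i. f i j \<partial>count_space UNIV)"
    by (rule nn_integral_suminf) simp
  also have "\<dots> = (\<Sum>j. \<Sum>i. f i j)" by (simp add: nn_integral_count_space_nat)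
  finally show ?thesis .
qed

lemma hpart_sum:
  fixes m :: nat
  assumes "\<And>n. holomorphic_n_on (y n) (ball 0 1)"
  shows "hpart (\<lambda>z. \<Sum>n<m. y n z) k z = (\<Sum>n<m. hpart (y n) k z)"
proof (induction m)
  case 0
  show ?case by (simp add: hpart_def)
next
  case (Suc m)
  then show ?case by (simp add: hpart_add holomorphic_n_on_sum assms)
qed

text \<open>Completeness for rapidly convergent series, with an explicit tail. Pointwise convergence
  comes from point evaluations, the norm estimate from the homogeneous parts degree by degree. The
  constant 16/7 is 2 / (1 - 1/8), where 1/8 = 2/16 is the decay left after the weights
  2^(j+1).\<close>

lemma sob_complete:
  fixes y :: "nat \<Rightarrow> complex ^ 'n::finite \<Rightarrow> complex"
  assumes hol: "\<And>n. holomorphic_n_on (y n) (ball 0 1)"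
    and small: "\<And>n. sob_sq \<beta> (y n) \<le> ennreal ((1/16) ^ n)"
  obtains x where "holomorphic_n_on x (ball 0 1)" "\<And>z. z \<notin> ball 0 1 \<Longrightarrow> x z = 0"
    "\<And>m. sob_sq \<beta> (\<lambda>z. x z - (\<Sum>n<m. y n z)) \<le> ennreal (16 / 7 * (1/16) ^ m)"
proof -
  have sqrt16: "sqrt ((1/16) ^ n) = (1/4) ^ n" for n
    by (simp add: real_sqrt_power real_sqrt_divide)
  have bnd: "\<exists>C\<ge>0. \<forall>n z. norm z \<le> s \<longrightarrow> cmod (y n z) \<le> C * (1/4) ^ n" if s: "0 < s" "s < 1" for s
  proof -
    obtain C where C: "C \<ge> 0" "\<And>(f :: complex ^ 'n \<Rightarrow> complex) c z. holomorphic_n_on f (ball 0 1) \<Longrightarrow> c \<ge> 0 \<Longrightarrow>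
        sob_sq \<beta> f \<le> ennreal c \<Longrightarrow> norm z \<le> s \<Longrightarrow> cmod (f z) \<le> C * sqrt c"
      using sob_sq_point_bound[OF s, of \<beta>, where 'n = 'n] by blast
    have "cmod (y n z) \<le> C * (1/4) ^ n" if "norm z \<le> s" for n z
      using C(2)[OF hol _ small that] unfolding sqrt16 by simp
    then show ?thesis using C(1) by blast
  qed
  have summ: "summable (\<lambda>n. C * (1/4) ^ n :: real)" for C
    by (intro summable_mult summable_geometric) simp
  define x where "x = (\<lambda>z. if z \<in> ball 0 1 then \<Sum>n. y n z else 0)"
  have sums: "(\<lambda>n. y n z) sums x z" if z: "z \<in> ball 0 1" for z
  proof -
    have "0 < (1 + norm z) / 2" "(1 + norm z) / 2 < 1" "norm z \<le> (1 + norm z) / 2"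
      using z by (auto simp: add_pos_nonneg)
    then obtain C where "\<And>n. cmod (y n z) \<le> C * (1/4) ^ n" using bnd by blast
    then have "summable (\<lambda>n. y n z)" by (rule summable_comparison_test'[OF summ, of 0])
    then show ?thesis using z by (simp add: x_def summable_sums)
  qed
  have holx: "holomorphic_n_on x (ball 0 1)"
  proof (rule holomorphic_n_on_series[OF hol _ sums])
    fix s :: real assume "0 < s" "s < 1"
    then obtain C where "\<And>n z. norm z \<le> s \<Longrightarrow> cmod (y n z) \<le> C * (1/4) ^ n" using bnd by blast
    then show "\<exists>b. summable b \<and> (\<forall>n z. norm z \<le> s \<longrightarrow> cmod (y n z) \<le> b n)"
      using summ by blast
  qed
  define t where "t = (\<lambda>m z. x z - (\<Sum>n<m. y n z))"
  have holt: "holomorphic_n_on (t m) (ball 0 1)" for m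
    unfolding t_def by (intro holomorphic_n_on_diff holx holomorphic_n_on_sum hol)
  have hpt: "hpart (t m) k z = hpart x k z - (\<Sum>n<m. hpart (y n) k z)" for m k z
    unfolding t_def by (simp add: hpart_diff holx holomorphic_n_on_sum hol hpart_sum)
  have hsums: "(\<lambda>n. hpart (y n) k z) sums hpart x k z" for k z
  proof -
    obtain C where C: "C \<ge> 0" "\<And>n z. norm z \<le> 1/2 \<Longrightarrow> cmod (y n z) \<le> C * (1/4) ^ n"
      using bnd[of "1/2"] by auto
    \<comment> \<open>The tails tend to 0 uniformly on the ball of radius 1/2, so by Cauchy's
      inequality their k-th parts at z tend to 0 as well; 4/3 is the geometric sum of ratio
      1/4.\<close>
    have le: "cmod (hpart (t m) k z) \<le> (C * (4/3) * (1/4) ^ m) * (norm z / (1/2)) ^ k" for m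
    proof (rule hpart_bound[OF holt])
      fix w :: "complex ^ 'n" assume w: "w \<in> cball 0 (1/2)"
      then have "w \<in> ball 0 1" by simp
      from sums_split_initial_segment[OF sums[OF this], of m]
      have "(\<lambda>n. y (n + m) w) sums t m w" by (simp add: t_def)
      moreover have "(\<lambda>n. (C * (1/4) ^ m) * (1/4) ^ n) sums ((C * (1/4) ^ m) * (1 / (1 - 1/4)))"
        by (intro sums_mult geometric_sums) simp
      moreover have "cmod (y (n + m) w) \<le> (C * (1/4) ^ m) * (1/4) ^ n" for n
        using C(2)[of w "n + m"] w by (simp add: power_add mult_ac)
      ultimately have "cmod (t m w) \<le> (C * (1/4) ^ m) * (1 / (1 - 1/4))" by (rule norm_sums_le)
      then show "cmod (t m w) \<le> C * (4/3) * (1/4) ^ m" by (simp add: mult_ac)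
    qed simp_all
    have "(\<lambda>m. (C * (4/3) * (1/4) ^ m) * (norm z / (1/2)) ^ k) \<longlonglongrightarrow> (C * (4/3) * 0) * (norm z / (1/2)) ^ k"
      by (intro tendsto_intros LIMSEQ_realpow_zero) simp_all
    then have "(\<lambda>m. (C * (4/3) * (1/4) ^ m) * (norm z / (1/2)) ^ k) \<longlonglongrightarrow> 0"
      by (simp only: mult_zero_right mult_zero_left)
    then have "(\<lambda>m. hpart (t m) k z) \<longlonglongrightarrow> 0"
      by (rule Lim_null_comparison[OF always_eventually[OF allI[OF le]]])
    from tendsto_diff[OF tendsto_const[of "hpart x k z"] this]
    show ?thesis by (simp add: sums_def hpt)
  qed
  have "sob_sq \<beta> (t m) \<le> ennreal (16 / 7 * (1/16) ^ m)" for m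
  proof -
    have "(\<lambda>j. hpart (y (j + m)) k z) sums hpart (t m) k z" for k z
      using sums_split_initial_segment[OF hsums[of k z], of m] by (simp add: hpt)
    then have "ennreal (sphere_sq (hpart (t m) k))
        \<le> (\<Sum>j. ennreal (2 ^ Suc j) * ennreal (sphere_sq (hpart (y (j + m)) k)))" for k
      by (intro sphere_sq_sums_le continuous_on_hpart hol holt)
    then have "ennreal (sob_weight \<beta> k * sphere_sq (hpart (t m) k))
        \<le> ennreal (sob_weight \<beta> k) * (\<Sum>j. ennreal (2 ^ Suc j) * ennreal (sphere_sq (hpart (y (j + m)) k)))" for k
      by (simp only: ennreal_mult sob_weight_nonneg sphere_sq_nonneg mult_left_mono zero_le)
    also have "ennreal (sob_weight \<beta> k) * (\<Sum>j. ennreal (2 ^ Suc j) * ennreal (sphere_sq (hpart (y (j + m)) k)))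
        = (\<Sum>j. ennreal (2 ^ Suc j) * ennreal (sob_weight \<beta> k * sphere_sq (hpart (y (j + m)) k)))" for k
      by (simp add: ennreal_mult mult_ac del: power_Suc flip: ennreal_suminf_cmult)
    finally have "sob_sq \<beta> (t m) \<le> (\<Sum>k. \<Sum>j. ennreal (2 ^ Suc j) * ennreal (sob_weight \<beta> k * sphere_sq (hpart (y (j + m)) k)))"
      unfolding sob_sq_def by (intro suminf_le summableI)
    also have "\<dots> = (\<Sum>j. \<Sum>k. ennreal (2 ^ Suc j) * ennreal (sob_weight \<beta> k * sphere_sq (hpart (y (j + m)) k)))"
      by (rule ennreal_suminf_swap)
    also have "\<dots> = (\<Sum>j. ennreal (2 ^ Suc j) * sob_sq \<beta> (y (j + m)))"
      by (simp add: sob_sq_def)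
    also have "\<dots> \<le> (\<Sum>j. ennreal (2 * (1/16) ^ m * (1/8) ^ j))"
    proof (intro suminf_le summableI)
      fix j
      have "ennreal (2 ^ Suc j) * sob_sq \<beta> (y (j + m)) \<le> ennreal (2 ^ Suc j) * ennreal ((1/16) ^ (j + m))"
        by (intro mult_left_mono small) simp
      also have "\<dots> = ennreal (2 ^ Suc j * (1/16) ^ (j + m))" by (simp add: ennreal_mult)
      also have "2 ^ Suc j * (1/16) ^ (j + m) = 2 * (1/16) ^ m * (1/8 :: real) ^ j"
      proof -
        have "(2::real) ^ j * (1/16) ^ j = (1/8) ^ j" by (simp flip: power_mult_distrib)
        then show ?thesis by (simp add: power_add)
      qed
      finally show "ennreal (2 ^ Suc j) * sob_sq \<beta> (y (j + m)) \<le> ennreal (2 * (1/16) ^ m * (1/8) ^ j)" .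
    qed
    also have "\<dots> = ennreal (2 * (1/16) ^ m * (1 / (1 - 1/8)))"
      by (intro suminf_ennreal_eq sums_mult geometric_sums) simp_all
    finally show ?thesis by (simp add: mult_ac)
  qed
  then show ?thesis using that[of x] holx unfolding t_def by (simp add: x_def)
qed

text \<open>For fixed N the multiplier may be replaced by a polynomial, which is bounded on the
  closed ball and acts at order 0; passing between the weights of order 0 and \<beta> on finitely
  many degrees costs a constant. The dependence of C on N is what the gliding hump has to
  remove.\<close>

lemma mult_partial_sums_bounded:
  fixes \<phi> :: "complex ^ 'n::finite \<Rightarrow> complex"
  assumes \<phi>: "holomorphic_n_on \<phi> (ball 0 1)"
  shows "\<exists>C\<ge>0. \<forall>f c. holomorphic_n_on f (ball 0 1) \<longrightarrow> c \<ge> 0 \<longrightarrow> sob_sq \<beta> f \<le> ennreal c \<longrightarrow>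
    (\<Sum>k<N. sob_weight \<beta> k * sphere_sq (hpart (\<lambda>z. \<phi> z * f z) k)) \<le> C * c"
proof -
  define p where "p = (\<lambda>z. \<Sum>j<N. hpart \<phi> j z)"
  have p: "holomorphic_n_on p (ball 0 1)"
    unfolding p_def by (intro holomorphic_n_on_sum hpart_holomorphic \<phi>)
  have "continuous_on (cball 0 1) p"
    unfolding p_def by (intro continuous_on_sum continuous_on_hpart \<phi>)
  then have "bounded (p ` cball 0 1)"
    by (intro compact_imp_bounded compact_continuous_image compact_cball)
  then obtain B where B: "\<And>z. z \<in> cball 0 1 \<Longrightarrow> cmod (p z) \<le> B"
    unfolding bounded_iff by blast
  have "B \<ge> 0" using B[of 0] by (simp add: order_trans[OF norm_ge_zero])
  have pB: "sob_mult_bound 0 (B\<^sup>2) p"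
    using B by (intro sob_mult_bound_zero p \<open>B \<ge> 0\<close>) auto
  define U where "U = (\<Sum>k<N. sob_weight \<beta> k)"
  define V where "V = (\<Sum>k<N. 1 / sob_weight \<beta> k)"
  have UV: "U \<ge> 0" "V \<ge> 0" by (auto simp: U_def V_def intro!: sum_nonneg)
  have "(\<Sum>k<N. sob_weight \<beta> k * sphere_sq (hpart (\<lambda>z. \<phi> z * f z) k)) \<le> (U * (B\<^sup>2 * V)) * c"
    if f: "holomorphic_n_on f (ball 0 1)" and c: "c \<ge> 0" "sob_sq \<beta> f \<le> ennreal c"
    for f :: "complex ^ 'n \<Rightarrow> complex" and c
  proof -
    have "(\<Sum>k<N. sob_weight \<beta> k * sphere_sq (hpart (\<lambda>z. \<phi> z * f z) k))
        \<le> (\<Sum>k<N. U * sphere_sq (hpart (\<lambda>z. \<phi> z * f z) k))"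
      unfolding U_def by (intro sum_mono mult_right_mono member_le_sum) auto
    also have "\<dots> = U * (\<Sum>k<N. sphere_sq (hpart (\<lambda>z. p z * f z) k))"
      unfolding sum_distrib_left
    proof (intro sum.cong refl)
      fix k assume "k \<in> {..<N}"
      then have "hpart (\<lambda>z. \<phi> z * f z) k = hpart (\<lambda>z. p z * f z) k"
        by (intro hpart_mult_truncate[where N = N] \<phi> f p) (simp_all add: p_def hpart_partial_sum \<phi>)
      then show "U * sphere_sq (hpart (\<lambda>z. \<phi> z * f z) k) = U * sphere_sq (hpart (\<lambda>z. p z * f z) k)"
        by simp
    qed
    also have "\<dots> \<le> U * (B\<^sup>2 * (\<Sum>k<N. sphere_sq (hpart f k)))"
      using sob_mult_bound_partial_sums[OF pB _ p f, of N] UV by (intro mult_left_mono) simp_all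
    also have "(\<Sum>k<N. sphere_sq (hpart f k)) \<le> (\<Sum>k<N. 1 / sob_weight \<beta> k * c)"
    proof (rule sum_mono)
      fix k
      have "sphere_sq (hpart f k) * sob_weight \<beta> k \<le> c"
        using sob_sq_coeff_le[OF c(2,1), of k] by (simp add: mult.commute)
      then show "sphere_sq (hpart f k) \<le> 1 / sob_weight \<beta> k * c"
        using sob_weight_pos[of \<beta> k] by (simp add: pos_le_divide_eq)
    qed
    also have "\<dots> = V * c" by (simp add: V_def sum_distrib_right)
    finally show ?thesis using UV by (simp add: mult_left_mono mult.assoc)
  qed
  moreover have "U * (B\<^sup>2 * V) \<ge> 0" using UV by simp
  ultimately show ?thesis by blast
qed

text \<open>
  The closed graph theorem for multipliers, by a gliding hump argument: were the truncated
  operators not uniformly bounded, a suitably signed sum of almost extremal functions would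
  be mapped out of the space.
\<close>

lemma pointwise_multiplier_imp_sob_mult_bound:
  fixes \<phi> :: "complex ^ 'n::finite \<Rightarrow> complex"
  assumes mult: "pointwise_multiplier \<beta> \<phi>"
  shows "\<exists>C\<ge>0. sob_mult_bound \<beta> C \<phi>"
proof -
  let ?hol = "\<lambda>f. holomorphic_n_on f (ball (0 :: complex ^ 'n) 1)"
  have \<phi>: "?hol \<phi>" using mult by (simp add: pointwise_multiplier_def)
  have \<phi>f: "?hol (\<lambda>z. \<phi> z * f z)" if "?hol f" for f by (rule holomorphic_n_on_mult[OF \<phi> that])
  \<comment> \<open>The square of a seminorm, finite for each N; the supremum over N is
    \<open>sob_sq \<beta>\<close> of the product.\<close>
  define W where "W = (\<lambda>N f. \<Sum>k<N. sob_weight \<beta> k * sphere_sq (hpart (\<lambda>z. \<phi> z * f z) k))"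
  have W0: "W N f \<ge> 0" for N f unfolding W_def by (intro sum_nonneg) simp
  have W_cmult: "W N (\<lambda>z. a * f z) = (cmod a)\<^sup>2 * W N f" if f: "?hol f" for N a f
  proof -
    have "(\<lambda>z. \<phi> z * (a * f z)) = (\<lambda>z. a * (\<phi> z * f z))" by (simp add: mult_ac)
    then show ?thesis
      by (simp add: W_def hpart_cmult_fun[OF \<phi>f[OF f]] sphere_sq_cmult continuous_on_hpart \<phi>f f
          sum_distrib_left mult_ac)
  qed
  have W_add: "W N (\<lambda>z. f z + g z) \<le> 2 * W N f + 2 * W N g" if f: "?hol f" and g: "?hol g" for N f g
  proof -
    have "sob_weight \<beta> k * sphere_sq (hpart (\<lambda>z. \<phi> z * f z + \<phi> z * g z) k)
        \<le> 2 * (sob_weight \<beta> k * sphere_sq (hpart (\<lambda>z. \<phi> z * f z) k))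
          + 2 * (sob_weight \<beta> k * sphere_sq (hpart (\<lambda>z. \<phi> z * g z) k))" for k
    proof -
      have "sphere_sq (hpart (\<lambda>z. \<phi> z * f z + \<phi> z * g z) k)
          \<le> 2 * sphere_sq (hpart (\<lambda>z. \<phi> z * f z) k) + 2 * sphere_sq (hpart (\<lambda>z. \<phi> z * g z) k)"
        unfolding hpart_add_fun[OF \<phi>f[OF f] \<phi>f[OF g]]
        by (intro sphere_sq_add_le continuous_on_hpart \<phi>f f g)
      from mult_left_mono[OF this sob_weight_nonneg[of \<beta> k]] show ?thesis
        by (simp add: algebra_simps)
    qed
    then have "W N (\<lambda>z. f z + g z) \<le> (\<Sum>k<N. 2 * (sob_weight \<beta> k * sphere_sq (hpart (\<lambda>z. \<phi> z * f z) k))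
          + 2 * (sob_weight \<beta> k * sphere_sq (hpart (\<lambda>z. \<phi> z * g z) k)))"
      unfolding W_def distrib_left by (rule sum_mono)
    then show ?thesis by (simp add: W_def sum.distrib sum_distrib_left)
  qed
  have W_bounded: "\<exists>C\<ge>0. \<forall>f c. ?hol f \<longrightarrow> c \<ge> 0 \<longrightarrow> sob_sq \<beta> f \<le> ennreal c \<longrightarrow> W N f \<le> C * c" for N
    unfolding W_def by (rule mult_partial_sums_bounded[OF \<phi>])
  \<comment> \<open>\<open>Sup (S N)\<close> is the squared norm of the N-th truncated
    operator.\<close>
  define S where "S = (\<lambda>N. {W N h | h. ?hol h \<and> sob_sq \<beta> h \<le> 1})"
  have bdd: "bdd_above (S N)" for N
  proof -
    obtain C where "\<And>f c. ?hol f \<Longrightarrow> c \<ge> 0 \<Longrightarrow> sob_sq \<beta> f \<le> ennreal c \<Longrightarrow> W N f \<le> C * c"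
      using W_bounded by blast
    from this[where c = 1] show ?thesis unfolding S_def by (auto intro!: bdd_aboveI[of _ C])
  qed
  have W_le: "W N f \<le> Sup (S N) * c" if f: "?hol f" and c: "c > 0" "sob_sq \<beta> f \<le> ennreal c" for N f c
  proof -
    let ?a = "complex_of_real (1 / sqrt c)"
    have a: "(cmod ?a)\<^sup>2 = 1 / c" using c(1) by (simp add: norm_divide power_divide)
    have "sob_sq \<beta> (\<lambda>z. ?a * f z) \<le> ennreal (1 / c) * ennreal c"
      unfolding sob_sq_cmult[OF f] a by (intro mult_left_mono c) simp
    also have "\<dots> = 1" using c(1) by (simp flip: ennreal_mult)
    finally have "W N (\<lambda>z. ?a * f z) \<in> S N"
      unfolding S_def using holomorphic_n_on_cmult[OF f] by blast
    then have "W N (\<lambda>z. ?a * f z) \<le> Sup (S N)" by (rule cSup_upper[OF _ bdd])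
    then show ?thesis unfolding W_cmult[OF f] a using c(1) by (simp add: field_simps)
  qed
  have "\<exists>K. \<forall>N. Sup (S N) \<le> K"
  proof (rule ccontr)
    assume "\<not> ?thesis"
    \<comment> \<open>32^n beats the scaling 16^-n of the n-th hump and leaves the growth
      2^n.\<close>
    then have "\<forall>n. \<exists>N. Sup (S N) > 32 ^ n" by (meson not_le)
    then have "\<exists>N. \<forall>n. Sup (S (N n)) > 32 ^ n" by (rule choice)
    then obtain N where N: "\<And>n::nat. Sup (S (N n)) > 32 ^ n" by blast
    define b where "b = (\<lambda>n. Sup (S (N n)))"
    have b: "b n > 32 ^ n" "b n > 0" for n
      using N[of n] less_trans[OF zero_less_power[of "32::real" n] N[of n]] by (simp_all add: b_def)
    \<comment> \<open>The fraction 2/3 of the supremum leaves room for the tail, which will cost 2 *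
      16/7 * 1/16 = 2/7: what remains is 2/3 - 2/7 = 8/21 > 0.\<close>
    have "\<exists>h. ?hol h \<and> sob_sq \<beta> h \<le> 1 \<and> W (N n) h \<ge> 2/3 * b n" for n
    proof -
      have "W (N n) (\<lambda>z. 0 * 0) \<in> S (N n)"
      proof -
        have "sob_sq \<beta> (\<lambda>z :: complex ^ 'n. 0 * (0 :: complex)) = 0"
          by (subst sob_sq_cmult[OF holomorphic_n_on_const]) simp
        then show ?thesis unfolding S_def using holomorphic_n_on_const[of 0] by fastforce
      qed
      then have "S (N n) \<noteq> {}" by blast
      moreover have "2/3 * b n < Sup (S (N n))" using b[of n] by (simp add: b_def)
      ultimately obtain w where "w \<in> S (N n)" "2/3 * b n < w" using less_cSupD by blast
      then show ?thesis unfolding S_def by (auto intro: less_imp_le)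
    qed
    then have "\<exists>h. \<forall>n. ?hol (h n) \<and> sob_sq \<beta> (h n) \<le> 1 \<and> W (N n) (h n) \<ge> 2/3 * b n"
      by (intro choice allI)
    then obtain h where h: "\<And>n. ?hol (h n)" "\<And>n. sob_sq \<beta> (h n) \<le> 1" "\<And>n. W (N n) (h n) \<ge> 2/3 * b n"
      by blast
    define u where "u = (\<lambda>n z. complex_of_real ((1/4) ^ n) * h n z)"
    have u: "?hol (u n)" for n unfolding u_def by (intro holomorphic_n_on_cmult h)
    have Wu: "W (N n) (u n) \<ge> 2/3 * b n * (1/16) ^ n" for n
    proof -
      have "W (N n) (u n) = (1/16) ^ n * W (N n) (h n)"
        unfolding u_def W_cmult[OF h(1)] by (simp add: norm_power norm_divide flip: power_mult power_mult_distrib)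
          (simp add: power_mult mult.commute[of _ 2] power2_eq_square)
      then show ?thesis using mult_left_mono[OF h(3)[of n], of "(1/16) ^ n"] by (simp add: mult_ac)
    qed
    \<comment> \<open>The sign is chosen so that the earlier terms do not cancel the new hump: the
      average of W over X + u and X - u is at least W of u. The choice depends on the sum so far,
      hence the recursion for \<open>X\<close>.\<close>
    define s where "s = (\<lambda>n x. if W (N n) (\<lambda>z. x z + u n z) \<ge> W (N n) (u n) then 1 else (- 1 :: complex))"
    define X where "X = rec_nat (\<lambda>z. 0) (\<lambda>n x z. x z + s n x * u n z)"
    define y where "y = (\<lambda>n z. s n (X n) * u n z)"
    have X_Suc: "X (Suc n) = (\<lambda>z. X n z + y n z)" for n by (simp add: X_def y_def)
    have X_sum: "X n z = (\<Sum>j<n. y j z)" for n z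
      by (induction n) (simp_all add: X_Suc, simp add: X_def)
    have s1: "(cmod (s n x))\<^sup>2 = 1" for n x by (simp add: s_def)
    have y: "?hol (y n)" for n unfolding y_def by (intro holomorphic_n_on_cmult u)
    have X: "?hol (X n)" for n
      using holomorphic_n_on_sum[of "{..<n}" y, OF y] by (simp add: X_sum[abs_def])
    have hump: "W (N n) (X (Suc n)) \<ge> W (N n) (u n)" for n
    proof (cases "W (N n) (\<lambda>z. X n z + u n z) \<ge> W (N n) (u n)")
      case True
      then show ?thesis by (simp add: X_Suc y_def s_def)
    next
      case False
      have p: "?hol (\<lambda>z. X n z + u n z)" "?hol (\<lambda>z. X n z - u n z)"
        by (intro holomorphic_n_on_add holomorphic_n_on_diff X u)+
      have "4 * W (N n) (u n) = W (N n) (\<lambda>z. 2 * u n z)" by (simp add: W_cmult[OF u])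
      also have "(\<lambda>z. 2 * u n z) = (\<lambda>z. (X n z + u n z) + (- 1) * (X n z - u n z))" by simp
      also have "W (N n) \<dots> \<le> 2 * W (N n) (\<lambda>z. X n z + u n z) + 2 * W (N n) (\<lambda>z. (- 1) * (X n z - u n z))"
        by (rule W_add[OF p(1) holomorphic_n_on_cmult[OF p(2)]])
      also have "W (N n) (\<lambda>z. (- 1) * (X n z - u n z)) = W (N n) (\<lambda>z. X n z - u n z)"
        unfolding W_cmult[OF p(2)] by simp
      finally have "W (N n) (\<lambda>z. X n z - u n z) \<ge> W (N n) (u n)" using False by linarith
      then show ?thesis using False by (simp add: X_Suc y_def s_def)
    qed
    have "sob_sq \<beta> (y n) \<le> ennreal ((1/16) ^ n)" for n
    proof -
      have "sob_sq \<beta> (y n) = ennreal ((1/16) ^ n) * sob_sq \<beta> (h n)"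
        unfolding y_def sob_sq_cmult[OF u] s1 unfolding u_def sob_sq_cmult[OF h(1)]
        by (simp add: norm_power norm_divide flip: power_mult power_mult_distrib)
          (simp add: power_mult mult.commute[of _ 2] power2_eq_square)
      also have "\<dots> \<le> ennreal ((1/16) ^ n) * 1" by (intro mult_left_mono h) simp
      finally show ?thesis by simp
    qed
    then obtain x where x: "?hol x" "\<And>z. z \<notin> ball 0 1 \<Longrightarrow> x z = 0"
      and tail: "\<And>m. sob_sq \<beta> (\<lambda>z. x z - (\<Sum>n<m. y n z)) \<le> ennreal (16 / 7 * (1/16) ^ m)"
      using sob_complete[of y \<beta>, OF y] by blast
    have "sob_sq \<beta> x \<le> ennreal (16/7)" using tail[of 0] by simp
    then have "sob_sq \<beta> x < \<infinity>" by (rule order_le_less_trans) simp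
    then have "x \<in> hardy_sobolev \<beta>" using x by (simp add: mem_hardy_sobolev_iff)
    then have "mult_op \<phi> x \<in> hardy_sobolev \<beta>" using mult by (simp add: pointwise_multiplier_def)
    then have fin: "sob_sq \<beta> (\<lambda>z. \<phi> z * x z) < \<infinity>" by (simp add: mem_hardy_sobolev_iff mult_op_def)
    define L where "L = enn2real (sob_sq \<beta> (\<lambda>z. \<phi> z * x z))"
    have WL: "W n x \<le> L" for n
    proof -
      have "ennreal (W n x) = (\<Sum>k<n. ennreal (sob_weight \<beta> k * sphere_sq (hpart (\<lambda>z. \<phi> z * x z) k)))"
        unfolding W_def by (rule sum_ennreal[symmetric]) simp
      also have "\<dots> \<le> sob_sq \<beta> (\<lambda>z. \<phi> z * x z)"
        unfolding sob_sq_def by (rule sum_le_suminf) auto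
      also have "\<dots> = ennreal L" using fin by (simp add: L_def)
      finally show ?thesis by (subst (asm) ennreal_le_iff) (simp_all add: L_def)
    qed
    \<comment> \<open>Up to the factor 2 of \<open>W_add\<close>, x inherits the hump of stage n:
      the later terms cost at most b n times their squared norm, and 4/21 is half of the remaining
      8/21.\<close>
    have "2 ^ n * (4/21) \<le> L" for n
    proof -
      let ?t = "\<lambda>z. x z - X (Suc n) z"
      have t: "?hol ?t" by (intro holomorphic_n_on_diff x X)
      have "W (N n) (X (Suc n)) = W (N n) (\<lambda>z. x z + (- 1) * ?t z)" by simp
      also have "\<dots> \<le> 2 * W (N n) x + 2 * W (N n) (\<lambda>z. (- 1) * ?t z)"
        by (rule W_add[OF x(1) holomorphic_n_on_cmult[OF t]])
      also have "W (N n) (\<lambda>z. (- 1) * ?t z) = W (N n) ?t" unfolding W_cmult[OF t] by simp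
      also have "W (N n) ?t \<le> b n * (16 / 7 * (1/16) ^ Suc n)"
        unfolding b_def by (rule W_le[OF t]) (use tail[of "Suc n"] in \<open>simp_all add: X_sum\<close>)
      finally have "2/3 * b n * (1/16) ^ n \<le> 2 * W (N n) x + 2 * (b n * (16 / 7 * (1/16) ^ Suc n))"
        using hump[of n] Wu[of n] by linarith
      then have "b n * (1/16) ^ n * (8/21) \<le> 2 * L" using WL[of "N n"] by simp
      moreover have "32 ^ n * (1/16) ^ n \<le> b n * (1/16 :: real) ^ n"
        using b(1)[of n] by (intro mult_right_mono) auto
      moreover have "32 ^ n * (1/16 :: real) ^ n = 2 ^ n" by (simp flip: power_mult_distrib)
      ultimately show ?thesis by linarith
    qed
    moreover obtain n where "L * (21/4) < 2 ^ n" using real_arch_pow[of 2 "L * (21/4)"] by auto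
    ultimately have "2 ^ n * (4/21) \<le> L" "L * (21/4) < 2 ^ n" by blast+
    then show False by simp
  qed
  then obtain K where K: "\<And>N. Sup (S N) \<le> K" by blast
  \<comment> \<open>The maximum with 1 makes the constant positive, so that its product with an
    infinite norm is infinite and not 0.\<close>
  have "sob_mult_bound \<beta> (max K 1) \<phi>"
    unfolding sob_mult_bound_def
  proof (intro allI impI)
    fix f assume f: "?hol f"
    show "sob_sq \<beta> (\<lambda>z. \<phi> z * f z) \<le> ennreal (max K 1) * sob_sq \<beta> f"
    proof (cases "sob_sq \<beta> f = \<infinity>")
      case True
      have "max K 1 > 0" by simp
      then show ?thesis using True by (simp add: ennreal_mult_top)
    next
      case False
      define c where "c = enn2real (sob_sq \<beta> f)"
      have c: "c \<ge> 0" "sob_sq \<beta> f = ennreal c" using False by (simp_all add: c_def less_top)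
      have W: "W n f \<le> max K 1 * c" for n
      \<comment> \<open>\<open>W_le\<close> normalises by c > 0; at c = 0 the bound for the single
        truncated operator gives W n f \<le> 0.\<close>
      proof (cases "c = 0")
        case True
        obtain C where "\<And>f c. ?hol f \<Longrightarrow> c \<ge> 0 \<Longrightarrow> sob_sq \<beta> f \<le> ennreal c \<Longrightarrow> W n f \<le> C * c"
          using W_bounded by blast
        from this[OF f c(1)] show ?thesis using c True by simp
      next
        case False
        then have "W n f \<le> Sup (S n) * c" using c by (intro W_le f) simp_all
        also have "\<dots> \<le> max K 1 * c" using c(1) K[of n] by (intro mult_right_mono) auto
        finally show ?thesis .
      qed
      show ?thesis
        unfolding sob_sq_def[of _ "\<lambda>z. \<phi> z * f z"] suminf_eq_SUP
      proof (rule SUP_least)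
        fix n
        have "(\<Sum>k<n. ennreal (sob_weight \<beta> k * sphere_sq (hpart (\<lambda>z. \<phi> z * f z) k))) = ennreal (W n f)"
          unfolding W_def by (rule sum_ennreal) simp
        also have "\<dots> \<le> ennreal (max K 1 * c)" by (intro ennreal_leI W)
        also have "\<dots> = ennreal (max K 1) * sob_sq \<beta> f" unfolding c(2) using c(1) by (intro ennreal_mult) auto
        finally show "(\<Sum>k<n. ennreal (sob_weight \<beta> k * sphere_sq (hpart (\<lambda>z. \<phi> z * f z) k)))
            \<le> ennreal (max K 1) * sob_sq \<beta> f" .
      qed
    qed
  qed
  then show ?thesis by (intro exI[of _ "max K 1"]) simp
qed

subsection \<open>The spectrum\<close>

lemma hardy_sobolev_diff_cmult:
  assumes f: "f \<in> hardy_sobolev \<beta>" and g: "g \<in> hardy_sobolev \<beta>"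
  shows "(\<lambda>z. f z - c * g z) \<in> hardy_sobolev \<beta>"
proof -
  have hol: "holomorphic_n_on f (ball 0 1)" "holomorphic_n_on g (ball 0 1)"
    and fin: "sob_sq \<beta> f < \<infinity>" "sob_sq \<beta> g < \<infinity>"
    using f g by (simp_all add: mem_hardy_sobolev_iff)
  have "sob_sq \<beta> (\<lambda>z. f z + (- c) * g z) \<le> 2 * sob_sq \<beta> f + 2 * sob_sq \<beta> (\<lambda>z. (- c) * g z)"
    by (intro sob_sq_add_le holomorphic_n_on_cmult hol)
  also have "\<dots> < \<infinity>"
    using fin unfolding sob_sq_cmult[OF hol(2)] by (simp add: ennreal_mult_less_top ennreal_add_less_top)
  finally show ?thesis
    using f g by (auto simp: mem_hardy_sobolev_iff intro!: holomorphic_n_on_diff holomorphic_n_on_cmult)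
qed

lemma mult_op_bounded_operator_on:
  assumes \<psi>: "holomorphic_n_on \<psi> (ball 0 1)" and D: "sob_mult_bound \<beta> D \<psi>" "D \<ge> 0"
  shows "bounded_operator_on (hardy_sobolev \<beta>) (hardy_sobolev_norm \<beta>) (mult_op \<psi>)"
proof -
  have in_H: "mult_op \<psi> f \<in> hardy_sobolev \<beta>"
    and le: "sob_sq \<beta> (mult_op \<psi> f) \<le> ennreal D * sob_sq \<beta> f" if f: "f \<in> hardy_sobolev \<beta>" for f
  proof -
    have hol: "holomorphic_n_on f (ball 0 1)" and fin: "sob_sq \<beta> f < \<infinity>"
      using f by (simp_all add: mem_hardy_sobolev_iff)
    show le: "sob_sq \<beta> (mult_op \<psi> f) \<le> ennreal D * sob_sq \<beta> f"
      unfolding mult_op_def by (rule sob_mult_boundD[OF D(1) hol])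
    also have "\<dots> < \<infinity>" using fin by (simp add: ennreal_mult_less_top)
    finally show "mult_op \<psi> f \<in> hardy_sobolev \<beta>"
      using f by (auto simp: mem_hardy_sobolev_iff mult_op_def intro!: holomorphic_n_on_mult \<psi>)
  qed
  have "hardy_sobolev_norm \<beta> (mult_op \<psi> f) \<le> sqrt D * hardy_sobolev_norm \<beta> f" if f: "f \<in> hardy_sobolev \<beta>" for f
  proof -
    have "enn2real (sob_sq \<beta> (mult_op \<psi> f)) \<le> enn2real (ennreal D * sob_sq \<beta> f)"
      using f by (intro enn2real_mono le) (auto simp: mem_hardy_sobolev_iff ennreal_mult_less_top)
    also have "\<dots> = D * enn2real (sob_sq \<beta> f)" using D(2) by (simp add: enn2real_mult)
    finally show ?thesis
      unfolding hardy_sobolev_norm_eq[OF f] hardy_sobolev_norm_eq[OF in_H[OF f]] real_sqrt_mult[symmetric]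
      by (rule real_sqrt_le_mono)
  qed
  then show ?thesis
    unfolding bounded_operator_on_def
    using in_H by (auto simp: mult_op_def algebra_simps)
qed

text \<open>Applying the inverse once to 1 bounds 1 / |\<phi>(z) - c| only through the constant of
  point evaluation at z, which need not be uniform up to the sphere. For n-th powers that constant
  does not depend on n, so letting n tend to infinity leaves a bound that is uniform in z.\<close>

lemma not_in_spectrum_imp_not_in_closure:
  fixes \<phi> :: "complex ^ 'n::finite \<Rightarrow> complex"
  assumes S: "bounded_operator_on (hardy_sobolev \<beta>) (hardy_sobolev_norm \<beta>) S"
    and inv: "\<And>f. f \<in> hardy_sobolev \<beta> \<Longrightarrow> (\<lambda>x. mult_op \<phi> (S f) x - c * S f x) = f"
  shows "c \<notin> closure (\<phi> ` ball 0 1)"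
proof -
  let ?H = "hardy_sobolev \<beta> :: (complex ^ 'n \<Rightarrow> complex) set" and ?N = "hardy_sobolev_norm \<beta>"
  \<comment> \<open>The constant function 1, cut off because members of the space vanish off the
    ball.\<close>
  define e where "e = (\<lambda>z :: complex ^ 'n. if z \<in> ball 0 1 then 1 else (0::complex))"
  have e: "e \<in> ?H"
  proof -
    have hp: "hpart (\<lambda>z :: complex ^ 'n. 1) k = (\<lambda>z. if k = 0 then 1 else 0)" for k
    proof
      fix z :: "complex ^ 'n"
      show "hpart (\<lambda>z. 1) k z = (if k = 0 then 1 else 0)"
        by (rule hpart_unique[where F = "\<lambda>k z. if k = 0 then 1 else 0"])
          (use sums_single[of 0 "\<lambda>_. 1 :: complex"] in simp_all)
    qed
    have "sob_sq \<beta> e = sob_sq \<beta> (\<lambda>z :: complex ^ 'n. 1)"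
      by (rule sob_sq_cong) (simp add: e_def)
    also have "\<dots> = (\<Sum>k\<in>{0}. ennreal (sob_weight \<beta> k * sphere_sq (hpart (\<lambda>z :: complex ^ 'n. 1) k)))"
      unfolding sob_sq_def by (rule suminf_finite) (auto simp: hp sphere_sq_const)
    also have "\<dots> < \<infinity>" by simp
    finally have "sob_sq \<beta> e < \<infinity>" .
    moreover have "holomorphic_n_on e (ball 0 1)"
      by (rule holomorphic_n_on_cong[OF holomorphic_n_on_const[of 1]]) (simp add: e_def)
    ultimately show ?thesis by (auto simp: mem_hardy_sobolev_iff e_def)
  qed
  have S_H: "S f \<in> ?H" if "f \<in> ?H" for f using S that by (simp add: bounded_operator_on_def)
  obtain C0 where C0: "\<And>f. f \<in> ?H \<Longrightarrow> ?N (S f) \<le> C0 * ?N f"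
    using S unfolding bounded_operator_on_def by blast
  \<comment> \<open>At least 1, so that 1 / C is positive.\<close>
  define C where "C = max C0 1"
  have N0: "?N f \<ge> 0" for f :: "complex ^ 'n \<Rightarrow> complex" by (simp add: hardy_sobolev_norm_def)
  have C: "C \<ge> 1" "?N (S f) \<le> C * ?N f" if "f \<in> ?H" for f
    using C0[OF that] mult_right_mono[OF max.cobounded1[of C0 1] N0[of f]] by (auto simp: C_def)
  have eq: "(\<phi> z - c) * S f z = f z" if "f \<in> ?H" for f z
    using fun_cong[OF inv[OF that], of z] by (simp add: mult_op_def algebra_simps)
  have iter: "(S ^^ n) e \<in> ?H \<and> ?N ((S ^^ n) e) \<le> C ^ n * ?N e \<and>
      (\<forall>z\<in>ball 0 1. (\<phi> z - c) ^ n * (S ^^ n) e z = 1)" for n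
  proof (induction n)
    case 0
    then show ?case using e by (simp add: e_def)
  next
    case (Suc n)
    have "?N (S ((S ^^ n) e)) \<le> C * (C ^ n * ?N e)"
      using Suc C[of "(S ^^ n) e"] by (meson mult_left_mono order_trans zero_le_one)
    moreover have "(\<phi> z - c) ^ Suc n * (S ^^ Suc n) e z = 1" if z: "z \<in> ball 0 1" for z
    proof -
      have "(\<phi> z - c) ^ Suc n * (S ^^ Suc n) e z = (\<phi> z - c) ^ n * ((\<phi> z - c) * S ((S ^^ n) e) z)"
        by simp
      also have "\<dots> = (\<phi> z - c) ^ n * (S ^^ n) e z" using eq Suc by simp
      also have "\<dots> = 1" using Suc z by blast
      finally show ?thesis .
    qed
    ultimately show ?case using Suc S_H by (simp add: mult.assoc)
  qed
  have lower: "1 / C \<le> cmod (\<phi> z - c)" if z: "z \<in> ball 0 1" for z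
  proof (rule ccontr)
    assume small: "\<not> 1 / C \<le> cmod (\<phi> z - c)"
    have "C > 0" using C(1)[OF e] by simp
    then have q: "C * cmod (\<phi> z - c) < 1" using small by (simp add: field_simps)
    define s where "s = (1 + norm z) / 2"
    have s: "0 < s" "s < 1" "norm z \<le> s" using z by (auto simp: s_def add_pos_nonneg)
    obtain K where K: "\<And>(f :: complex ^ 'n \<Rightarrow> complex) c z. holomorphic_n_on f (ball 0 1) \<Longrightarrow> c \<ge> 0 \<Longrightarrow>
        sob_sq \<beta> f \<le> ennreal c \<Longrightarrow> norm z \<le> s \<Longrightarrow> cmod (f z) \<le> K * sqrt c" and "K \<ge> 0"
      using sob_sq_point_bound[OF s(1,2), of \<beta>, where 'n = 'n] by blast
    have K': "cmod (f z) \<le> K * ?N f" if "f \<in> ?H" for f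
      using that K[of f "enn2real (sob_sq \<beta> f)" z] s(3)
      unfolding hardy_sobolev_norm_eq[OF that] by (simp add: mem_hardy_sobolev_iff)
    have "1 \<le> (K * ?N e) * (C * cmod (\<phi> z - c)) ^ n" for n
    proof -
      have "1 = cmod (\<phi> z - c) ^ n * cmod ((S ^^ n) e z)"
        using iter[of n] z by (metis norm_mult norm_one norm_power)
      also have "\<dots> \<le> cmod (\<phi> z - c) ^ n * (K * (C ^ n * ?N e))"
        using iter[of n] K'[of "(S ^^ n) e"] \<open>K \<ge> 0\<close>
        by (intro mult_left_mono) (auto intro: order_trans mult_left_mono)
      finally show ?thesis by (simp add: power_mult_distrib mult_ac)
    qed
    moreover have "(\<lambda>n. (K * ?N e) * (C * cmod (\<phi> z - c)) ^ n) \<longlonglongrightarrow> (K * ?N e) * 0"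
      using q \<open>C > 0\<close> by (intro tendsto_intros LIMSEQ_realpow_zero) auto
    ultimately have "1 \<le> (K * ?N e) * 0" by (intro LIMSEQ_le_const) auto
    then show False by simp
  qed
  show ?thesis
  proof
    assume "c \<in> closure (\<phi> ` ball 0 1)"
    moreover have "1 / C > 0" using C(1)[OF e] by simp
    ultimately obtain z where "z \<in> ball 0 1" "dist (\<phi> z) c < 1 / C"
      unfolding closure_approachable by blast
    then show False using lower[of z] by (simp add: dist_norm)
  qed
qed

lemma not_in_closure_imp_invertible:
  fixes \<phi> :: "complex ^ 'n::finite \<Rightarrow> complex"
  assumes mult: "pointwise_multiplier \<beta> \<phi>" and c: "c \<notin> closure (\<phi> ` ball 0 1)"
  shows "\<exists>S. bounded_operator_on (hardy_sobolev \<beta>) (hardy_sobolev_norm \<beta>) S \<and>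
    (\<forall>f\<in>hardy_sobolev \<beta>. S (\<lambda>x. mult_op \<phi> f x - c * f x) = f) \<and>
    (\<forall>f\<in>hardy_sobolev \<beta>. (\<lambda>x. mult_op \<phi> (S f) x - c * S f x) = f)"
proof -
  obtain \<delta> where \<delta>: "\<delta> > 0" "\<And>z. z \<in> ball 0 1 \<Longrightarrow> \<delta> \<le> cmod (\<phi> z - c)"
    using c unfolding closure_approachable by (auto simp: dist_norm not_less)
  define \<phi>' where "\<phi>' = (\<lambda>z. \<phi> z - c)"
  define \<psi> where "\<psi> = (\<lambda>z. inverse (\<phi>' z))"
  have \<phi>': "holomorphic_n_on \<phi>' (ball 0 1)"
    using mult unfolding \<phi>'_def pointwise_multiplier_def
    by (intro holomorphic_n_on_diff holomorphic_n_on_const) blast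
  have nz: "\<phi>' z \<noteq> 0" if "z \<in> ball 0 1" for z using \<delta>(2)[OF that] \<delta>(1) by (auto simp: \<phi>'_def)
  have \<psi>: "holomorphic_n_on \<psi> (ball 0 1)"
    unfolding \<psi>_def by (rule holomorphic_n_on_inverse[OF \<phi>' nz])
  have inv: "\<phi>' z * \<psi> z = 1" if "z \<in> ball 0 1" for z using nz[OF that] by (simp add: \<psi>_def)
  have "mult_op \<phi>' f \<in> hardy_sobolev \<beta>" if f: "f \<in> hardy_sobolev \<beta>" for f
  proof -
    have "mult_op \<phi> f \<in> hardy_sobolev \<beta>" using mult f by (simp add: pointwise_multiplier_def)
    from hardy_sobolev_diff_cmult[OF this f, of c] show ?thesis
      by (simp add: mult_op_def \<phi>'_def left_diff_distrib)
  qed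
  then have "pointwise_multiplier \<beta> \<phi>'" using \<phi>' by (simp add: pointwise_multiplier_def)
  then obtain C where C: "sob_mult_bound \<beta> C \<phi>'" "C \<ge> 0"
    using pointwise_multiplier_imp_sob_mult_bound by blast
  have "cmod (\<psi> z) \<le> 1 / \<delta>" if "z \<in> ball 0 1" for z
    using \<delta>(2)[OF that] \<delta>(1) unfolding \<psi>_def \<phi>'_def
    by (simp add: norm_divide inverse_eq_divide frac_le)
  then obtain D where D: "sob_mult_bound \<beta> D \<psi>" "D \<ge> 0"
    using sob_mult_bound_inverse[OF \<phi>' \<psi> inv C] by blast
  \<comment> \<open>Off the ball \<phi> - c may vanish and \<psi> need not invert it; both
    compositions are the identity there because f is 0.\<close>
  have off: "f z = 0" if "f \<in> hardy_sobolev \<beta>" "z \<notin> ball 0 1" for f and z :: "complex ^ 'n"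
    using that unfolding mem_hardy_sobolev_iff by blast
  have cancel: "\<psi> z * (\<phi> z * f z - c * f z) = f z" "\<phi> z * (\<psi> z * f z) - c * (\<psi> z * f z) = f z"
    if f: "f \<in> hardy_sobolev \<beta>" for f z
  proof -
    have "\<psi> z * (\<phi> z * f z - c * f z) = (\<phi>' z * \<psi> z) * f z"
      and "\<phi> z * (\<psi> z * f z) - c * (\<psi> z * f z) = (\<phi>' z * \<psi> z) * f z"
      by (simp_all add: \<phi>'_def algebra_simps)
    moreover have "(\<phi>' z * \<psi> z) * f z = f z"
      using inv[of z] off[OF f, of z] by (cases "z \<in> ball 0 1") simp_all
    ultimately show "\<psi> z * (\<phi> z * f z - c * f z) = f z" "\<phi> z * (\<psi> z * f z) - c * (\<psi> z * f z) = f z"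
      by simp_all
  qed
  show ?thesis
    using mult_op_bounded_operator_on[OF \<psi> D] cancel
    by (intro exI[of _ "mult_op \<psi>"]) (simp add: mult_op_def)
qed

theorem theoremA:
  fixes \<beta> :: real and \<phi> :: "complex ^ 'n::finite \<Rightarrow> complex"
  assumes "pointwise_multiplier \<beta> \<phi>"
  shows "spectrum_on (hardy_sobolev \<beta>) (hardy_sobolev_norm \<beta>) (mult_op \<phi>)
    = closure (\<phi> ` ball 0 1)"
proof (intro set_eqI iffI)
  fix c assume "c \<in> spectrum_on (hardy_sobolev \<beta>) (hardy_sobolev_norm \<beta>) (mult_op \<phi>)"
  then show "c \<in> closure (\<phi> ` ball 0 1)"
    using not_in_closure_imp_invertible[OF assms, of c] unfolding spectrum_on_def mem_Collect_eq
    by argo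
next
  fix c assume c: "c \<in> closure (\<phi> ` ball 0 1)"
  show "c \<in> spectrum_on (hardy_sobolev \<beta>) (hardy_sobolev_norm \<beta>) (mult_op \<phi>)"
    unfolding spectrum_on_def mem_Collect_eq
  proof
    assume "\<exists>S. bounded_operator_on (hardy_sobolev \<beta>) (hardy_sobolev_norm \<beta>) S \<and>
      (\<forall>f\<in>hardy_sobolev \<beta>. S (\<lambda>x. mult_op \<phi> f x - c * f x) = f) \<and>
      (\<forall>f\<in>hardy_sobolev \<beta>. (\<lambda>x. mult_op \<phi> (S f) x - c * S f x) = f)"
    then show False using not_in_spectrum_imp_not_in_closure[of \<beta> _ \<phi> c] c by auto
  qed
qed

end
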